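(* For any quasi-Hopf algebra $H$ the monoidal category ${}^H\mathscr{M}$ of left $H$-modules is a closed monoidal category with internal hom-functor $\hom:({}^H\mathscr{M})^{\mathrm{op}}\times{}^H\mathscr{M}\to{}^H\mathscr{M}$ given on objects by $\hom(V,W)=\mathrm{Hom}_k(V,W)$ with the $H$-action $h\triangleright L=(h_{(1)}\triangleright_W\,\cdot\,)\circ L\circ(S(h_{(2)})\triangleright_V\,\cdot\,)$ and on morphisms by $\hom(f^{\mathrm{op}},g)(L)=g\circ L\circ f$. That is, there is a bijection $\mathrm{Hom}_{{}^H\mathscr{M}}(V\otimes W,X)\simeq\mathrm{Hom}_{{}^H\mathscr{M}}(V,\hom(W,X))$, natural in the objects $V,W,X$ of ${}^H\mathscr{M}$.
   Context: Fix a commutative ring $k$ with unit; $\otimes=\otimes_k$. A quasi-bialgebra is an associative unital $k$-algebra $H$ with algebra homomorphisms $\Delta:H\to H\otimes H$, $\epsilon:H\to k$ and an invertible $\phi\in H^{\otimes 3}$ such that for all $h\in H$: $(\epsilon\otimes\mathrm{id})\Delta(h)=h=(\mathrm{id}\otimes\epsilon)\Delta(h)$; $(\mathrm{id}\otimes\Delta)\Delta(h)\cdot\phi=\phi\cdot(\Delta\otimes\mathrm{id})\Delta(h)$; $(\mathrm{id}\otimes\mathrm{id}\otimes\Delta)(\phi)\cdot(\Delta\otimes\mathrm{id}\otimes\mathrm{id})(\phi)=(1\otimes\phi)\cdot(\mathrm{id}\otimes\Delta\otimes\mathrm{id})(\phi)\cdot(\phi\otimes1)$; $(\mathrm{id}\otimes\epsilon\otimes\mathrm{id})(\phi)=1\otimes1$.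 Notation (summation understood): $\Delta(h)=h_{(1)}\otimes h_{(2)}$, $\phi=\phi^{(1)}\otimes\phi^{(2)}\otimes\phi^{(3)}$, $\phi^{-1}=\phi^{(-1)}\otimes\phi^{(-2)}\otimes\phi^{(-3)}$. A quasi-Hopf algebra is a quasi-bialgebra with a quasi-antipode $(S,\alpha,\beta)$: an algebra anti-automorphism $S:H\to H$ and $\alpha,\beta\in H$ with $S(h_{(1)})\alpha h_{(2)}=\epsilon(h)\alpha$, $h_{(1)}\beta S(h_{(2)})=\epsilon(h)\beta$ for all $h$, $\phi^{(1)}\beta S(\phi^{(2)})\alpha\phi^{(3)}=1$, $S(\phi^{(-1)})\alpha\phi^{(-2)}\beta S(\phi^{(-3)})=1$. ${}^H\mathscr{M}$ is the category of left $H$-modules (action denoted $\triangleright$) and $H$-equivariant $k$-linear maps. Its monoidal structure: $V\otimes W$ with $h\triangleright(v\otimes w)=(h_{(1)}\triangleright v)\otimes(h_{(2)}\triangleright w)$; unit object $I=k$ with $h\triangleright c=\epsilon(h)c$; associator $\Phi_{V,W,X}((v\otimes w)\otimes x)=(\phi^{(1)}\triangleright v)\otimes((\phi^{(2)}\triangleright w)\otimes(\phi^{(3)}\triangleright x))$; unitors $c\otimes v\mapsto cv$, $v\otimes c\mapsto cv$. *)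

theory Defs
  imports "HOL-Algebra.Module" "HOL-Library.FuncSet"
begin

section \<open>Tensor products over a commutative ring\<close>

text \<open>
  The library has no tensor product of modules.  A tensor is a class of finite formal sums
  \<open>v\<^sub>1 \<otimes> w\<^sub>1 + \<dots> + v\<^sub>n \<otimes> w\<^sub>n\<close>, written as lists of pairs, under the congruence generated by
  commutativity, biadditivity and balancedness over \<open>k\<close>.  Scalars are absorbed into the first
  factor, and \<open>(-v) \<otimes> w\<close> is the negative of \<open>v \<otimes> w\<close>, so that no coefficients are needed.
\<close>

type_synonym ('a, 'b) tens = "('a \<times> 'b) list set"

inductive tensor_eq ::
    "'k ring \<Rightarrow> ('k, 'v, 'm) module_scheme \<Rightarrow> ('k, 'w, 'n) module_scheme
      \<Rightarrow> ('v \<times> 'w) list \<Rightarrow> ('v \<times> 'w) list \<Rightarrow> bool"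
  for k V W where
  refl: "l \<in> lists (carrier V \<times> carrier W) \<Longrightarrow> tensor_eq k V W l l"
| sym: "tensor_eq k V W l l' \<Longrightarrow> tensor_eq k V W l' l"
| trans: "tensor_eq k V W l l' \<Longrightarrow> tensor_eq k V W l' l'' \<Longrightarrow> tensor_eq k V W l l''"
| append: "tensor_eq k V W l l' \<Longrightarrow> tensor_eq k V W m m' \<Longrightarrow> tensor_eq k V W (l @ m) (l' @ m')"
| swap: "p \<in> carrier V \<times> carrier W \<Longrightarrow> q \<in> carrier V \<times> carrier W \<Longrightarrow>
    tensor_eq k V W [p, q] [q, p]"
| add_left: "v \<in> carrier V \<Longrightarrow> v' \<in> carrier V \<Longrightarrow> w \<in> carrier W \<Longrightarrow>
    tensor_eq k V W [(v \<oplus>\<^bsub>V\<^esub> v', w)] [(v, w), (v', w)]"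
| add_right: "v \<in> carrier V \<Longrightarrow> w \<in> carrier W \<Longrightarrow> w' \<in> carrier W \<Longrightarrow>
    tensor_eq k V W [(v, w \<oplus>\<^bsub>W\<^esub> w')] [(v, w), (v, w')]"
| balance: "c \<in> carrier k \<Longrightarrow> v \<in> carrier V \<Longrightarrow> w \<in> carrier W \<Longrightarrow>
    tensor_eq k V W [(c \<odot>\<^bsub>V\<^esub> v, w)] [(v, c \<odot>\<^bsub>W\<^esub> w)]"
| zero: "w \<in> carrier W \<Longrightarrow> tensor_eq k V W [(\<zero>\<^bsub>V\<^esub>, w)] []"

definition tensor_class ::
    "'k ring \<Rightarrow> ('k, 'v, 'm) module_scheme \<Rightarrow> ('k, 'w, 'n) module_scheme
      \<Rightarrow> ('v \<times> 'w) list \<Rightarrow> ('v, 'w) tens" where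
  "tensor_class k V W l = {l'. tensor_eq k V W l l'}"

definition simple_tensor ::
    "'k ring \<Rightarrow> ('k, 'v, 'm) module_scheme \<Rightarrow> ('k, 'w, 'n) module_scheme
      \<Rightarrow> 'v \<Rightarrow> 'w \<Rightarrow> ('v, 'w) tens" where
  "simple_tensor k V W v w = tensor_class k V W [(v, w)]"

text \<open>
  The fields \<open>mult\<close> and \<open>one\<close> are meaningful when \<open>V\<close> and \<open>W\<close> are algebras; they give the algebra
  \<open>V \<otimes> W\<close>.  For mere modules they carry no information, as the module locale ignores them.
\<close>

definition tensor ::
    "'k ring \<Rightarrow> ('k, 'v, 'm) module_scheme \<Rightarrow> ('k, 'w, 'n) module_scheme
      \<Rightarrow> ('k, ('v, 'w) tens) module" where
  "tensor k V W =
    \<lparr> carrier = tensor_class k V W ` lists (carrier V \<times> carrier W),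
      monoid.mult = (\<lambda>s t. \<Union>l\<in>s. \<Union>m\<in>t. tensor_class k V W
                      [(a \<otimes>\<^bsub>V\<^esub> c, b \<otimes>\<^bsub>W\<^esub> d). (a, b) \<leftarrow> l, (c, d) \<leftarrow> m]),
      one = simple_tensor k V W \<one>\<^bsub>V\<^esub> \<one>\<^bsub>W\<^esub>,
      ring.zero = tensor_class k V W [],
      add = (\<lambda>s t. \<Union>l\<in>s. \<Union>m\<in>t. tensor_class k V W (l @ m)),
      smult = (\<lambda>c s. \<Union>l\<in>s. tensor_class k V W (map (\<lambda>(v, w). (c \<odot>\<^bsub>V\<^esub> v, w)) l)) \<rparr>"

text \<open>
  \<open>tensor_lift M f\<close> is the additive map \<open>v \<otimes> w \<mapsto> f v w\<close> into \<open>M\<close>.  It is used only for \<open>k\<close>-bilinear \<open>f\<close>,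
  where the value does not depend on the chosen representative; it renders Sweedler sums such
  as \<open>f h\<^sub>(\<^sub>1\<^sub>) h\<^sub>(\<^sub>2\<^sub>)\<close>.
\<close>

definition tensor_lift ::
    "('m, 'r) ring_scheme \<Rightarrow> ('a \<Rightarrow> 'b \<Rightarrow> 'm) \<Rightarrow> ('a, 'b) tens \<Rightarrow> 'm" where
  "tensor_lift M f t = foldr (\<lambda>(v, w) y. f v w \<oplus>\<^bsub>M\<^esub> y) (SOME l. l \<in> t) \<zero>\<^bsub>M\<^esub>"

definition tensor_map ::
    "'k ring \<Rightarrow> ('k, 'v, 'm) module_scheme \<Rightarrow> ('k, 'w, 'n) module_scheme
      \<Rightarrow> ('a \<Rightarrow> 'v) \<Rightarrow> ('b \<Rightarrow> 'w) \<Rightarrow> ('a, 'b) tens \<Rightarrow> ('v, 'w) tens" where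
  \<comment> \<open>\<open>V\<close> and \<open>W\<close> are the codomains of \<open>f\<close> and \<open>g\<close>\<close>
  "tensor_map k V W f g = tensor_lift (tensor k V W) (\<lambda>a b. simple_tensor k V W (f a) (g b))"

definition tensor_reassoc ::
    "'k ring \<Rightarrow> ('k, 'u, 'l) module_scheme \<Rightarrow> ('k, 'v, 'm) module_scheme
      \<Rightarrow> ('k, 'w, 'n) module_scheme \<Rightarrow> (('u, 'v) tens, 'w) tens \<Rightarrow> ('u, ('v, 'w) tens) tens" where
  \<comment> \<open>the canonical map \<open>(u \<otimes> v) \<otimes> w \<mapsto> u \<otimes> (v \<otimes> w)\<close>\<close>
  "tensor_reassoc k U V W =
    tensor_lift (tensor k U (tensor k V W)) (\<lambda>s w.
      tensor_lift (tensor k U (tensor k V W)) (\<lambda>u v.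
        simple_tensor k U (tensor k V W) u (simple_tensor k V W v w)) s)"

section \<open>Linear maps and algebras\<close>

definition linear_map ::
    "'k ring \<Rightarrow> ('k, 'v, 'm) module_scheme \<Rightarrow> ('k, 'w, 'n) module_scheme \<Rightarrow> ('v \<Rightarrow> 'w) \<Rightarrow> bool" where
  "linear_map k V W f \<longleftrightarrow>
    f \<in> carrier V \<rightarrow> carrier W \<and>
    (\<forall>x\<in>carrier V. \<forall>y\<in>carrier V. f (x \<oplus>\<^bsub>V\<^esub> y) = f x \<oplus>\<^bsub>W\<^esub> f y) \<and>
    (\<forall>c\<in>carrier k. \<forall>x\<in>carrier V. f (c \<odot>\<^bsub>V\<^esub> x) = c \<odot>\<^bsub>W\<^esub> f x)"

text \<open>The library's \<open>algebra\<close> locale is restricted to commutative algebras.\<close>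

locale assoc_algebra = module k A + ring A for k (structure) and A (structure) +
  assumes smult_mult_left: "\<lbrakk>c \<in> carrier k; x \<in> carrier A; y \<in> carrier A\<rbrakk> \<Longrightarrow>
      (c \<odot>\<^bsub>A\<^esub> x) \<otimes>\<^bsub>A\<^esub> y = c \<odot>\<^bsub>A\<^esub> (x \<otimes>\<^bsub>A\<^esub> y)"
    and smult_mult_right: "\<lbrakk>c \<in> carrier k; x \<in> carrier A; y \<in> carrier A\<rbrakk> \<Longrightarrow>
      x \<otimes>\<^bsub>A\<^esub> (c \<odot>\<^bsub>A\<^esub> y) = c \<odot>\<^bsub>A\<^esub> (x \<otimes>\<^bsub>A\<^esub> y)"

definition algebra_hom ::
    "'k ring \<Rightarrow> ('k, 'v, 'm) module_scheme \<Rightarrow> ('k, 'w, 'n) module_scheme \<Rightarrow> ('v \<Rightarrow> 'w) \<Rightarrow> bool" where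
  "algebra_hom k A B f \<longleftrightarrow> linear_map k A B f \<and> f \<in> ring_hom A B"

definition base_algebra :: "'k ring \<Rightarrow> ('k, 'k) module" where
  "base_algebra k = \<lparr> carrier = carrier k, monoid.mult = mult k, one = one k,
     ring.zero = zero k, add = add k, smult = mult k \<rparr>"

section \<open>Quasi-Hopf algebras\<close>

text \<open>
  \<open>H\<^sup>\<otimes>\<^sup>3\<close> and \<open>H\<^sup>\<otimes>\<^sup>4\<close> are bracketed to the right; identities that are stated with other bracketings
  are transported along the canonical reassociation maps.
\<close>

record ('k, 'h) quasi_bialgebra_data = "('k, 'h) module" +
  comult :: "'h \<Rightarrow> ('h, 'h) tens" (\<open>\<Delta>\<index>\<close>)
  counit :: "'h \<Rightarrow> 'k" (\<open>\<epsilon>\<index>\<close>)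
  reassociator :: "('h, ('h, 'h) tens) tens" (\<open>\<phi>\<index>\<close>)

record ('k, 'h) quasi_hopf_data = "('k, 'h) quasi_bialgebra_data" +
  antipode :: "'h \<Rightarrow> 'h"
  alpha :: "'h"
  beta :: "'h"

abbreviation tensor2 :: "'k ring \<Rightarrow> ('k, 'h, 'm) module_scheme \<Rightarrow> ('k, ('h, 'h) tens) module" where
  "tensor2 k H \<equiv> tensor k H H"

abbreviation tensor3 ::
    "'k ring \<Rightarrow> ('k, 'h, 'm) module_scheme \<Rightarrow> ('k, ('h, ('h, 'h) tens) tens) module" where
  "tensor3 k H \<equiv> tensor k H (tensor2 k H)"

abbreviation tensor4 ::
    "'k ring \<Rightarrow> ('k, 'h, 'm) module_scheme \<Rightarrow> ('k, ('h, ('h, ('h, 'h) tens) tens) tens) module" where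
  "tensor4 k H \<equiv> tensor k H (tensor3 k H)"

locale quasi_bialgebra = assoc_algebra k H
  for k :: "'k ring" (structure)
    and H :: "('k, 'h, 'z) quasi_bialgebra_data_scheme" (structure) +
  assumes comult_hom: "algebra_hom k H (tensor2 k H) \<Delta>\<^bsub>H\<^esub>"
    and counit_hom: "algebra_hom k H (base_algebra k) \<epsilon>\<^bsub>H\<^esub>"
    and reassociator_Units: "\<phi>\<^bsub>H\<^esub> \<in> Units (tensor3 k H)"
    \<comment> \<open>\<open>k \<otimes> H\<close> and \<open>H \<otimes> k\<close> are identified with \<open>H\<close> by scalar multiplication\<close>
    and counit_left: "h \<in> carrier H \<Longrightarrow>
      tensor_lift H (\<lambda>c x. c \<odot>\<^bsub>H\<^esub> x) (tensor_map k (base_algebra k) H \<epsilon>\<^bsub>H\<^esub> id (\<Delta>\<^bsub>H\<^esub> h)) = h"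
    and counit_right: "h \<in> carrier H \<Longrightarrow>
      tensor_lift H (\<lambda>x c. c \<odot>\<^bsub>H\<^esub> x) (tensor_map k H (base_algebra k) id \<epsilon>\<^bsub>H\<^esub> (\<Delta>\<^bsub>H\<^esub> h)) = h"
    and quasi_coassoc: "h \<in> carrier H \<Longrightarrow>
      tensor_map k H (tensor2 k H) id \<Delta>\<^bsub>H\<^esub> (\<Delta>\<^bsub>H\<^esub> h) \<otimes>\<^bsub>tensor3 k H\<^esub> \<phi>\<^bsub>H\<^esub> =
      \<phi>\<^bsub>H\<^esub> \<otimes>\<^bsub>tensor3 k H\<^esub>
        tensor_reassoc k H H H (tensor_map k (tensor2 k H) H \<Delta>\<^bsub>H\<^esub> id (\<Delta>\<^bsub>H\<^esub> h))"
    and pentagon: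
      "tensor_map k H (tensor3 k H) id (tensor_map k H (tensor2 k H) id \<Delta>\<^bsub>H\<^esub>) \<phi>\<^bsub>H\<^esub> \<otimes>\<^bsub>tensor4 k H\<^esub>
       tensor_reassoc k H H (tensor2 k H)
         (tensor_map k (tensor2 k H) (tensor2 k H) \<Delta>\<^bsub>H\<^esub> id \<phi>\<^bsub>H\<^esub>) =
       simple_tensor k H (tensor3 k H) \<one>\<^bsub>H\<^esub> \<phi>\<^bsub>H\<^esub> \<otimes>\<^bsub>tensor4 k H\<^esub>
       tensor_map k H (tensor3 k H) id
         (\<lambda>t. tensor_reassoc k H H H (tensor_map k (tensor2 k H) H \<Delta>\<^bsub>H\<^esub> id t)) \<phi>\<^bsub>H\<^esub>
         \<otimes>\<^bsub>tensor4 k H\<^esub>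
       tensor_map k H (tensor3 k H) id (tensor_reassoc k H H H)
         (tensor_reassoc k H (tensor2 k H) H (simple_tensor k (tensor3 k H) H \<phi>\<^bsub>H\<^esub> \<one>\<^bsub>H\<^esub>))"
    and counit_reassociator:
      "tensor_map k H H id
         (\<lambda>t. tensor_lift H (\<lambda>c x. c \<odot>\<^bsub>H\<^esub> x) (tensor_map k (base_algebra k) H \<epsilon>\<^bsub>H\<^esub> id t)) \<phi>\<^bsub>H\<^esub> =
       \<one>\<^bsub>tensor2 k H\<^esub>"

locale quasi_hopf_algebra = quasi_bialgebra k H
  for k :: "'k ring" (structure) and H :: "('k, 'h, 'z) quasi_hopf_data_scheme" (structure) +
  assumes antipode_linear: "linear_map k H H (antipode H)"
    and antipode_bij: "bij_betw (antipode H) (carrier H) (carrier H)"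
    and antipode_one: "antipode H \<one>\<^bsub>H\<^esub> = \<one>\<^bsub>H\<^esub>"
    and antipode_mult: "\<lbrakk>a \<in> carrier H; b \<in> carrier H\<rbrakk> \<Longrightarrow>
      antipode H (a \<otimes>\<^bsub>H\<^esub> b) = antipode H b \<otimes>\<^bsub>H\<^esub> antipode H a"
    and alpha_closed: "alpha H \<in> carrier H"
    and beta_closed: "beta H \<in> carrier H"
    and antipode_alpha: "h \<in> carrier H \<Longrightarrow>
      tensor_lift H (\<lambda>a b. antipode H a \<otimes>\<^bsub>H\<^esub> alpha H \<otimes>\<^bsub>H\<^esub> b) (\<Delta>\<^bsub>H\<^esub> h) = \<epsilon>\<^bsub>H\<^esub> h \<odot>\<^bsub>H\<^esub> alpha H"
    and antipode_beta: "h \<in> carrier H \<Longrightarrow>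
      tensor_lift H (\<lambda>a b. a \<otimes>\<^bsub>H\<^esub> beta H \<otimes>\<^bsub>H\<^esub> antipode H b) (\<Delta>\<^bsub>H\<^esub> h) = \<epsilon>\<^bsub>H\<^esub> h \<odot>\<^bsub>H\<^esub> beta H"
    and antipode_reassociator:
      "tensor_lift H (\<lambda>a. tensor_lift H (\<lambda>b c.
         a \<otimes>\<^bsub>H\<^esub> beta H \<otimes>\<^bsub>H\<^esub> antipode H b \<otimes>\<^bsub>H\<^esub> alpha H \<otimes>\<^bsub>H\<^esub> c)) \<phi>\<^bsub>H\<^esub> = \<one>\<^bsub>H\<^esub>"
    and antipode_reassociator_inv:
      "tensor_lift H (\<lambda>a. tensor_lift H (\<lambda>b c.
         antipode H a \<otimes>\<^bsub>H\<^esub> alpha H \<otimes>\<^bsub>H\<^esub> b \<otimes>\<^bsub>H\<^esub> beta H \<otimes>\<^bsub>H\<^esub> antipode H c))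
         (inv\<^bsub>tensor3 k H\<^esub> \<phi>\<^bsub>H\<^esub>) = \<one>\<^bsub>H\<^esub>"

section \<open>Categories and functors\<close>

text \<open>
  Hom-sets need not be disjoint, hence composition and the action of a functor on morphisms take
  the objects involved as arguments.  \<open>Comp C a b c g f\<close> is \<open>g \<circ> f\<close> for \<open>f : a \<rightarrow> b\<close> and \<open>g : b \<rightarrow> c\<close>.
\<close>

record ('o, 'm) cat =
  Ob :: "'o set"
  Hom :: "'o \<Rightarrow> 'o \<Rightarrow> 'm set"
  Ident :: "'o \<Rightarrow> 'm"
  Comp :: "'o \<Rightarrow> 'o \<Rightarrow> 'o \<Rightarrow> 'm \<Rightarrow> 'm \<Rightarrow> 'm"

definition is_category :: "('o, 'm) cat \<Rightarrow> bool" where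
  "is_category C \<longleftrightarrow>
    (\<forall>a\<in>Ob C. Ident C a \<in> Hom C a a) \<and>
    (\<forall>a\<in>Ob C. \<forall>b\<in>Ob C. \<forall>c\<in>Ob C. \<forall>f\<in>Hom C a b. \<forall>g\<in>Hom C b c. Comp C a b c g f \<in> Hom C a c) \<and>
    (\<forall>a\<in>Ob C. \<forall>b\<in>Ob C. \<forall>f\<in>Hom C a b.
      Comp C a a b f (Ident C a) = f \<and> Comp C a b b (Ident C b) f = f) \<and>
    (\<forall>a\<in>Ob C. \<forall>b\<in>Ob C. \<forall>c\<in>Ob C. \<forall>d\<in>Ob C. \<forall>f\<in>Hom C a b. \<forall>g\<in>Hom C b c. \<forall>h\<in>Hom C c d.
      Comp C a c d h (Comp C a b c g f) = Comp C a b d (Comp C b c d h g) f)"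

definition op_cat :: "('o, 'm) cat \<Rightarrow> ('o, 'm) cat" where
  "op_cat C = \<lparr> Ob = Ob C, Hom = (\<lambda>a b. Hom C b a), Ident = Ident C,
     Comp = (\<lambda>a b c g f. Comp C c b a f g) \<rparr>"

definition prod_cat :: "('o, 'm) cat \<Rightarrow> ('p, 'n) cat \<Rightarrow> ('o \<times> 'p, 'm \<times> 'n) cat" where
  "prod_cat C D = \<lparr> Ob = Ob C \<times> Ob D,
     Hom = (\<lambda>(a, a') (b, b'). Hom C a b \<times> Hom D a' b'),
     Ident = (\<lambda>(a, a'). (Ident C a, Ident D a')),
     Comp = (\<lambda>(a, a') (b, b') (c, c') (g, g') (f, f'). (Comp C a b c g f, Comp D a' b' c' g' f')) \<rparr>"

record ('o, 'm, 'p, 'n) func =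
  on_ob :: "'o \<Rightarrow> 'p"
  on_mor :: "'o \<Rightarrow> 'o \<Rightarrow> 'm \<Rightarrow> 'n"

definition is_functor :: "('o, 'm) cat \<Rightarrow> ('p, 'n) cat \<Rightarrow> ('o, 'm, 'p, 'n) func \<Rightarrow> bool" where
  "is_functor C D F \<longleftrightarrow>
    (\<forall>a\<in>Ob C. on_ob F a \<in> Ob D) \<and>
    (\<forall>a\<in>Ob C. \<forall>b\<in>Ob C. \<forall>f\<in>Hom C a b. on_mor F a b f \<in> Hom D (on_ob F a) (on_ob F b)) \<and>
    (\<forall>a\<in>Ob C. on_mor F a a (Ident C a) = Ident D (on_ob F a)) \<and>
    (\<forall>a\<in>Ob C. \<forall>b\<in>Ob C. \<forall>c\<in>Ob C. \<forall>f\<in>Hom C a b. \<forall>g\<in>Hom C b c.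
      on_mor F a c (Comp C a b c g f) =
      Comp D (on_ob F a) (on_ob F b) (on_ob F c) (on_mor F b c g) (on_mor F a b f))"

definition id_func :: "('o, 'm, 'o, 'm) func" where
  "id_func = \<lparr> on_ob = (\<lambda>a. a), on_mor = (\<lambda>a b f. f) \<rparr>"

section \<open>The category of left modules\<close>

record ('k, 'h, 'v) lmod = "('k, 'v) module" +
  act :: "'h \<Rightarrow> 'v \<Rightarrow> 'v"

locale left_module = module k V
  for k :: "'k ring" (structure) and H :: "('k, 'h, 'z) module_scheme" (structure)
    and V :: "('k, 'h, 'v) lmod" (structure) +
  assumes act_closed: "\<lbrakk>h \<in> carrier H; v \<in> carrier V\<rbrakk> \<Longrightarrow> act V h v \<in> carrier V"
    and act_add_left: "\<lbrakk>h \<in> carrier H; h' \<in> carrier H; v \<in> carrier V\<rbrakk> \<Longrightarrow>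
      act V (h \<oplus>\<^bsub>H\<^esub> h') v = act V h v \<oplus>\<^bsub>V\<^esub> act V h' v"
    and act_add_right: "\<lbrakk>h \<in> carrier H; v \<in> carrier V; v' \<in> carrier V\<rbrakk> \<Longrightarrow>
      act V h (v \<oplus>\<^bsub>V\<^esub> v') = act V h v \<oplus>\<^bsub>V\<^esub> act V h v'"
    and act_smult_left: "\<lbrakk>c \<in> carrier k; h \<in> carrier H; v \<in> carrier V\<rbrakk> \<Longrightarrow>
      act V (c \<odot>\<^bsub>H\<^esub> h) v = c \<odot>\<^bsub>V\<^esub> act V h v"
    and act_smult_right: "\<lbrakk>c \<in> carrier k; h \<in> carrier H; v \<in> carrier V\<rbrakk> \<Longrightarrow>
      act V h (c \<odot>\<^bsub>V\<^esub> v) = c \<odot>\<^bsub>V\<^esub> act V h v"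
    and act_one: "v \<in> carrier V \<Longrightarrow> act V \<one>\<^bsub>H\<^esub> v = v"
    and act_mult: "\<lbrakk>h \<in> carrier H; h' \<in> carrier H; v \<in> carrier V\<rbrakk> \<Longrightarrow>
      act V (h \<otimes>\<^bsub>H\<^esub> h') v = act V h (act V h' v)"

text \<open>
  Maps are taken to be extensional (\<open>undefined\<close> off the carrier), so that equality of morphisms is
  equality on the carrier.
\<close>

definition lmod_hom ::
    "'k ring \<Rightarrow> ('k, 'h, 'z) module_scheme \<Rightarrow> ('k, 'h, 'v) lmod \<Rightarrow> ('k, 'h, 'w) lmod
      \<Rightarrow> ('v \<Rightarrow> 'w) set" where
  "lmod_hom k H V W = {f \<in> extensional (carrier V). linear_map k V W f \<and>
     (\<forall>h\<in>carrier H. \<forall>v\<in>carrier V. f (act V h v) = act W h (f v))}"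

definition lmod_iso ::
    "'k ring \<Rightarrow> ('k, 'h, 'z) module_scheme \<Rightarrow> ('k, 'h, 'v) lmod \<Rightarrow> ('k, 'h, 'w) lmod
      \<Rightarrow> ('v \<Rightarrow> 'w) \<Rightarrow> bool" where
  "lmod_iso k H V W f \<longleftrightarrow> f \<in> lmod_hom k H V W \<and>
     (\<exists>g\<in>lmod_hom k H W V.
        compose (carrier V) g f = (\<lambda>v\<in>carrier V. v) \<and> compose (carrier W) f g = (\<lambda>w\<in>carrier W. w))"

text \<open>
  For each type \<open>'v\<close> this is the category of all left \<open>H\<close>-modules whose underlying set is a subset
  of \<open>'v\<close>; the type plays the role of a universe.  Since HOL has no type closed under tensor
  products, a tensor product lives in a different universe than its factors.  Morphisms between
  modules in different universes are covered by \<open>lmod_hom\<close>, and natural isomorphisms below may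
  relate functors with values in different universes.
\<close>

definition LMod ::
    "'k ring \<Rightarrow> ('k, 'h, 'z) module_scheme \<Rightarrow> (('k, 'h, 'v) lmod, 'v \<Rightarrow> 'v) cat" where
  "LMod k H = \<lparr> Ob = {V. left_module k H V}, Hom = lmod_hom k H,
     Ident = (\<lambda>V. \<lambda>v\<in>carrier V. v), Comp = (\<lambda>U V W g f. compose (carrier U) g f) \<rparr>"

definition lmod_natural_iso ::
    "'k ring \<Rightarrow> ('k, 'h, 'z) module_scheme \<Rightarrow> ('o, 'm) cat
      \<Rightarrow> ('o, 'm, ('k, 'h, 'v) lmod, 'v \<Rightarrow> 'v) func \<Rightarrow> ('o, 'm, ('k, 'h, 'w) lmod, 'w \<Rightarrow> 'w) func
      \<Rightarrow> ('o \<Rightarrow> 'v \<Rightarrow> 'w) \<Rightarrow> bool" where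
  "lmod_natural_iso k H C F G \<eta> \<longleftrightarrow>
    is_functor C (LMod k H) F \<and> is_functor C (LMod k H) G \<and>
    (\<forall>a\<in>Ob C. lmod_iso k H (on_ob F a) (on_ob G a) (\<eta> a)) \<and>
    (\<forall>a\<in>Ob C. \<forall>b\<in>Ob C. \<forall>f\<in>Hom C a b.
      compose (carrier (on_ob F a)) (\<eta> b) (on_mor F a b f) =
      compose (carrier (on_ob F a)) (on_mor G a b f) (\<eta> a))"

definition tensor_ob ::
    "'k ring \<Rightarrow> ('k, 'h, 'z) quasi_bialgebra_data_scheme \<Rightarrow> ('k, 'h, 'v) lmod \<Rightarrow> ('k, 'h, 'w) lmod
      \<Rightarrow> ('k, 'h, ('v, 'w) tens) lmod" where
  "tensor_ob k H V W = module.extend (tensor k V W)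
     (lmod.fields (\<lambda>h t. tensor_lift (tensor k V W)
        (\<lambda>a b. tensor_map k V W (act V a) (act W b) t) (\<Delta>\<^bsub>H\<^esub> h)))"

definition tensor_mor ::
    "'k ring \<Rightarrow> ('k, 'h, 'v) lmod \<Rightarrow> ('k, 'h, 'w) lmod \<Rightarrow> ('k, 'h, 'x) lmod \<Rightarrow> ('k, 'h, 'y) lmod
      \<Rightarrow> ('v \<Rightarrow> 'x) \<Rightarrow> ('w \<Rightarrow> 'y) \<Rightarrow> ('v, 'w) tens \<Rightarrow> ('x, 'y) tens" where
  \<comment> \<open>\<open>f \<otimes> g : V \<otimes> W \<rightarrow> V' \<otimes> W'\<close>\<close>
  "tensor_mor k V W V' W' f g = (\<lambda>t\<in>carrier (tensor k V W). tensor_map k V' W' f g t)"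

definition tensor_func ::
    "'k ring \<Rightarrow> ('k, 'h, 'z) quasi_bialgebra_data_scheme \<Rightarrow>
      (('k, 'h, 'v) lmod \<times> ('k, 'h, 'w) lmod, ('v \<Rightarrow> 'v) \<times> ('w \<Rightarrow> 'w),
       ('k, 'h, ('v, 'w) tens) lmod, ('v, 'w) tens \<Rightarrow> ('v, 'w) tens) func" where
  "tensor_func k H = \<lparr> on_ob = (\<lambda>(V, W). tensor_ob k H V W),
     on_mor = (\<lambda>(V, W) (V', W') (f, g). tensor_mor k V W V' W' f g) \<rparr>"

definition unit_ob ::
    "'k ring \<Rightarrow> ('k, 'h, 'z) quasi_bialgebra_data_scheme \<Rightarrow> ('k, 'h, 'k) lmod" where
  "unit_ob k H = module.extend (base_algebra k) (lmod.fields (\<lambda>h c. \<epsilon>\<^bsub>H\<^esub> h \<otimes>\<^bsub>k\<^esub> c))"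

definition tensor_left_func ::
    "'k ring \<Rightarrow> ('k, 'h, 'z) quasi_bialgebra_data_scheme \<Rightarrow>
      (('k, 'h, 'v) lmod \<times> ('k, 'h, 'w) lmod \<times> ('k, 'h, 'x) lmod,
       ('v \<Rightarrow> 'v) \<times> ('w \<Rightarrow> 'w) \<times> ('x \<Rightarrow> 'x), ('k, 'h, (('v, 'w) tens, 'x) tens) lmod,
       (('v, 'w) tens, 'x) tens \<Rightarrow> (('v, 'w) tens, 'x) tens) func" where
  \<comment> \<open>\<open>(V, W, X) \<mapsto> (V \<otimes> W) \<otimes> X\<close>\<close>
  "tensor_left_func k H =
    \<lparr> on_ob = (\<lambda>(V, W, X). tensor_ob k H (tensor_ob k H V W) X),
      on_mor = (\<lambda>(V, W, X) (V', W', X') (f, g, l).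
        tensor_mor k (tensor_ob k H V W) X (tensor_ob k H V' W') X'
          (tensor_mor k V W V' W' f g) l) \<rparr>"

definition tensor_right_func ::
    "'k ring \<Rightarrow> ('k, 'h, 'z) quasi_bialgebra_data_scheme \<Rightarrow>
      (('k, 'h, 'v) lmod \<times> ('k, 'h, 'w) lmod \<times> ('k, 'h, 'x) lmod,
       ('v \<Rightarrow> 'v) \<times> ('w \<Rightarrow> 'w) \<times> ('x \<Rightarrow> 'x), ('k, 'h, ('v, ('w, 'x) tens) tens) lmod,
       ('v, ('w, 'x) tens) tens \<Rightarrow> ('v, ('w, 'x) tens) tens) func" where
  \<comment> \<open>\<open>(V, W, X) \<mapsto> V \<otimes> (W \<otimes> X)\<close>\<close>
  "tensor_right_func k H =
    \<lparr> on_ob = (\<lambda>(V, W, X). tensor_ob k H V (tensor_ob k H W X)),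
      on_mor = (\<lambda>(V, W, X) (V', W', X') (f, g, l).
        tensor_mor k V (tensor_ob k H W X) V' (tensor_ob k H W' X')
          f (tensor_mor k W X W' X' g l)) \<rparr>"

definition associator ::
    "'k ring \<Rightarrow> ('k, 'h, 'z) quasi_bialgebra_data_scheme \<Rightarrow>
      ('k, 'h, 'v) lmod \<times> ('k, 'h, 'w) lmod \<times> ('k, 'h, 'x) lmod \<Rightarrow>
      (('v, 'w) tens, 'x) tens \<Rightarrow> ('v, ('w, 'x) tens) tens" where
  "associator k H = (\<lambda>(V, W, X).
     let P = tensor_ob k H V (tensor_ob k H W X) in
     (\<lambda>t\<in>carrier (tensor_ob k H (tensor_ob k H V W) X).
       tensor_lift P (\<lambda>a. tensor_lift P (\<lambda>b c.
         tensor_map k V (tensor_ob k H W X) (act V a) (tensor_map k W X (act W b) (act X c))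
           (tensor_reassoc k V W X t))) \<phi>\<^bsub>H\<^esub>))"

definition tensor_unit_left_func ::
    "'k ring \<Rightarrow> ('k, 'h, 'z) quasi_bialgebra_data_scheme \<Rightarrow>
      (('k, 'h, 'v) lmod, 'v \<Rightarrow> 'v, ('k, 'h, ('k, 'v) tens) lmod, ('k, 'v) tens \<Rightarrow> ('k, 'v) tens) func" where
  "tensor_unit_left_func k H = \<lparr> on_ob = tensor_ob k H (unit_ob k H),
     on_mor = (\<lambda>V W. tensor_mor k (unit_ob k H) V (unit_ob k H) W (Ident (LMod k H) (unit_ob k H))) \<rparr>"

definition tensor_unit_right_func ::
    "'k ring \<Rightarrow> ('k, 'h, 'z) quasi_bialgebra_data_scheme \<Rightarrow>
      (('k, 'h, 'v) lmod, 'v \<Rightarrow> 'v, ('k, 'h, ('v, 'k) tens) lmod, ('v, 'k) tens \<Rightarrow> ('v, 'k) tens) func" where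
  "tensor_unit_right_func k H = \<lparr> on_ob = (\<lambda>V. tensor_ob k H V (unit_ob k H)),
     on_mor = (\<lambda>V W f. tensor_mor k V (unit_ob k H) W (unit_ob k H) f (Ident (LMod k H) (unit_ob k H))) \<rparr>"

definition left_unitor ::
    "'k ring \<Rightarrow> ('k, 'h, 'z) quasi_bialgebra_data_scheme \<Rightarrow> ('k, 'h, 'v) lmod \<Rightarrow> ('k, 'v) tens \<Rightarrow> 'v" where
  "left_unitor k H V =
     (\<lambda>t\<in>carrier (tensor_ob k H (unit_ob k H) V). tensor_lift V (\<lambda>c v. c \<odot>\<^bsub>V\<^esub> v) t)"

definition right_unitor ::
    "'k ring \<Rightarrow> ('k, 'h, 'z) quasi_bialgebra_data_scheme \<Rightarrow> ('k, 'h, 'v) lmod \<Rightarrow> ('v, 'k) tens \<Rightarrow> 'v" where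
  "right_unitor k H V =
     (\<lambda>t\<in>carrier (tensor_ob k H V (unit_ob k H)). tensor_lift V (\<lambda>v c. c \<odot>\<^bsub>V\<^esub> v) t)"

section \<open>The internal hom-functor\<close>

definition linear_homs ::
    "'k ring \<Rightarrow> ('k, 'v, 'm) module_scheme \<Rightarrow> ('k, 'w, 'n) module_scheme
      \<Rightarrow> ('k, 'v \<Rightarrow> 'w) module" where
  \<comment> \<open>\<open>Hom\<^sub>k(V, W)\<close> as a \<open>k\<close>-module; there is no ring structure\<close>
  "linear_homs k V W =
    \<lparr> carrier = {L \<in> extensional (carrier V). linear_map k V W L},
      monoid.mult = undefined, one = undefined,
      ring.zero = (\<lambda>v\<in>carrier V. \<zero>\<^bsub>W\<^esub>),
      add = (\<lambda>L M. \<lambda>v\<in>carrier V. L v \<oplus>\<^bsub>W\<^esub> M v),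
      smult = (\<lambda>c L. \<lambda>v\<in>carrier V. c \<odot>\<^bsub>W\<^esub> L v) \<rparr>"

definition hom_ob ::
    "'k ring \<Rightarrow> ('k, 'h, 'z) quasi_hopf_data_scheme \<Rightarrow> ('k, 'h, 'v) lmod \<Rightarrow> ('k, 'h, 'w) lmod
      \<Rightarrow> ('k, 'h, 'v \<Rightarrow> 'w) lmod" where
  "hom_ob k H V W = module.extend (linear_homs k V W)
     (lmod.fields (\<lambda>h L. tensor_lift (linear_homs k V W)
        (\<lambda>a b. \<lambda>v\<in>carrier V. act W a (L (act V (antipode H b) v))) (\<Delta>\<^bsub>H\<^esub> h)))"

definition hom_mor ::
    "'k ring \<Rightarrow> ('k, 'h, 'v) lmod \<Rightarrow> ('k, 'h, 'w) lmod \<Rightarrow> ('k, 'h, 'x) lmod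
      \<Rightarrow> ('x \<Rightarrow> 'v) \<Rightarrow> ('w \<Rightarrow> 'y) \<Rightarrow> ('v \<Rightarrow> 'w) \<Rightarrow> ('x \<Rightarrow> 'y)" where
  \<comment> \<open>\<open>hom(f, g) : hom(V, W) \<rightarrow> hom(V', W')\<close> for \<open>f : V' \<rightarrow> V\<close> and \<open>g : W \<rightarrow> W'\<close>\<close>
  "hom_mor k V W V' f g = (\<lambda>L\<in>carrier (linear_homs k V W). \<lambda>v\<in>carrier V'. g (L (f v)))"

definition hom_func ::
    "'k ring \<Rightarrow> ('k, 'h, 'z) quasi_hopf_data_scheme \<Rightarrow>
      (('k, 'h, 'v) lmod \<times> ('k, 'h, 'w) lmod, ('v \<Rightarrow> 'v) \<times> ('w \<Rightarrow> 'w),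
       ('k, 'h, 'v \<Rightarrow> 'w) lmod, ('v \<Rightarrow> 'w) \<Rightarrow> ('v \<Rightarrow> 'w)) func" where
  "hom_func k H = \<lparr> on_ob = (\<lambda>(V, W). hom_ob k H V W),
     on_mor = (\<lambda>(V, W) (V', W') (f, g). hom_mor k V W V' f g) \<rparr>"

end

theory Submission
  imports Defs
begin

text \<open>
  Everything is reduced to actions of tensor powers of \<open>H\<close>.  If \<open>A\<close> acts on \<open>V\<close> and \<open>B\<close> acts on \<open>W\<close>,
  then the algebra \<open>A \<otimes> B\<close> acts componentwise on \<open>V \<otimes> W\<close> (\<open>tensor_act\<close>).  This action is natural in
  all its arguments (\<open>tensor_map_act\<close>) and compatible with rebracketing (\<open>tensor_reassoc_act\<close>).  The
  \<open>H\<close>-module \<open>V \<otimes> W\<close> is its pullback along \<open>\<Delta>\<close>, and the associator is rebracketing followed by the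
  action of \<open>\<phi> \<in> H \<otimes> H \<otimes> H\<close>.  Hence the associator is \<open>H\<close>-linear by quasi-coassociativity, and it is
  bijective because \<open>\<phi>\<close> is invertible.  Both sides of the pentagon for modules are actions of the two
  sides of the pentagon for \<open>\<phi>\<close> on a rebracketed tensor, and the triangle is the counit condition
  on \<open>\<phi>\<close>.

  For the internal hom, \<open>Hom\<^sub>k(W, X)\<close> carries the action \<open>(a \<otimes> b) \<cdot> L = a \<circ> L \<circ> S(b)\<close> of \<open>H \<otimes> H\<close>, which
  is again pulled back along \<open>\<Delta>\<close>.  Write \<open>\<psi>\<close> for the inverse of \<open>\<phi>\<close>, with sums over components
  understood.  The bijection and its inverse are
  \<open>\<theta>(L)(v)(w) = L(\<psi>\<^sub>1 v \<otimes> \<psi>\<^sub>2 \<beta> S(\<psi>\<^sub>3) w)\<close> and \<open>\<theta>'(M)(v \<otimes> w) = \<phi>\<^sub>1 M(v)(S(\<phi>\<^sub>2) \<alpha> \<phi>\<^sub>3 w)\<close>,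
  called \<open>curry_map\<close> and \<open>uncurry_map\<close> below.  They take \<open>H\<close>-linear maps to \<open>H\<close>-linear maps because
  quasi-coassociativity moves \<open>(\<Delta> \<otimes> id) \<Delta>(h)\<close> across \<open>\<phi>\<close> or \<open>\<psi>\<close>, where it becomes
  \<open>(id \<otimes> \<Delta>) \<Delta>(h)\<close>, and the comultiplied pair is then absorbed by \<open>\<alpha>\<close> or \<open>\<beta>\<close> at the price of a
  counit.

  That \<open>\<theta>\<close> and \<open>\<theta>'\<close> are mutually inverse is a statement about fourfold tensors.  The composite
  \<open>\<theta>' \<circ> \<theta>\<close> acts through the contraction \<open>x\<^sub>1 \<otimes> x\<^sub>2 \<beta> S(x\<^sub>3) \<alpha> x\<^sub>4\<close> of
  \<open>(\<Delta> \<otimes> id \<otimes> id)(\<phi>) (\<psi> \<otimes> 1)\<close>, and \<open>\<theta> \<circ> \<theta>'\<close> through the contraction \<open>x\<^sub>1 \<otimes> S(x\<^sub>2) \<alpha> x\<^sub>3 \<beta> S(x\<^sub>4)\<close> of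
  \<open>(\<phi> \<otimes> 1) (\<Delta> \<otimes> id \<otimes> id)(\<psi>)\<close>.  The pentagon turns these elements into
  \<open>(id \<otimes> id \<otimes> \<Delta>)(\<psi>) (1 \<otimes> \<phi>) (id \<otimes> \<Delta> \<otimes> id)(\<phi>)\<close> and
  \<open>(id \<otimes> \<Delta> \<otimes> id)(\<psi>) (1 \<otimes> \<psi>) (id \<otimes> id \<otimes> \<Delta>)(\<phi>)\<close>.
  Here the contraction absorbs both comultiplied pairs, the middle factor contributes one of the
  normalisations \<open>\<phi>\<^sub>1 \<beta> S(\<phi>\<^sub>2) \<alpha> \<phi>\<^sub>3 = 1\<close> and \<open>S(\<psi>\<^sub>1) \<alpha> \<psi>\<^sub>2 \<beta> S(\<psi>\<^sub>3) = 1\<close>, and what is left are counits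
  applied to the middle or to the last component of \<open>\<phi>\<close> and \<open>\<psi>\<close>, which give \<open>1\<close> (\<open>T4_phi\<close>, \<open>U4_phi\<close>).
  For the middle component this is an axiom; for the last one it follows from the pentagon
  (\<open>counit_last_phi\<close>).

  All calculations with components are done in the same way: both sides depend linearly on each
  tensor that occurs, so it suffices to compare them on pure tensors (\<open>tensor_eqI\<close>, \<open>bilinear_eqI\<close>),
  where the two sides simplify to the same product.
\<close>

section \<open>Tensor products of modules\<close>

lemma foldr_add:
  fixes M (structure)
  assumes "abelian_monoid M" "f \<in> A \<rightarrow> carrier M"
  shows "l \<in> lists A \<Longrightarrow> foldr (\<lambda>p y. f p \<oplus> y) l \<zero> \<in> carrier M"
    and "l \<in> lists A \<Longrightarrow> m \<in> lists A \<Longrightarrow>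
      foldr (\<lambda>p y. f p \<oplus> y) (l @ m) \<zero> =
      foldr (\<lambda>p y. f p \<oplus> y) l \<zero> \<oplus> foldr (\<lambda>p y. f p \<oplus> y) m \<zero>"
proof -
  interpret abelian_monoid M by fact
  show *: "foldr (\<lambda>p y. f p \<oplus> y) l \<zero> \<in> carrier M" if "l \<in> lists A" for l
    using that assms(2) by induct auto
  show "foldr (\<lambda>p y. f p \<oplus> y) (l @ m) \<zero> =
      foldr (\<lambda>p y. f p \<oplus> y) l \<zero> \<oplus> foldr (\<lambda>p y. f p \<oplus> y) m \<zero>"
    if "l \<in> lists A" "m \<in> lists A" for l m
    using that assms(2) *[OF that(2)] 
  proof induct
    case (Cons a l)
    then show ?case using * by (auto simp: a_assoc Pi_iff)
  qed simp
qed

definition bilinear ::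
    "'k ring \<Rightarrow> ('k, 'v, 'm) module_scheme \<Rightarrow> ('k, 'w, 'n) module_scheme
      \<Rightarrow> ('k, 'x, 'p) module_scheme \<Rightarrow> ('v \<Rightarrow> 'w \<Rightarrow> 'x) \<Rightarrow> bool" where
  "bilinear k V W M f \<longleftrightarrow>
     (\<forall>v\<in>carrier V. linear_map k W M (f v)) \<and> (\<forall>w\<in>carrier W. linear_map k V M (\<lambda>v. f v w))"

text \<open>
  The additive extension of \<open>f\<close> on the level of representatives.  Once it is known to be invariant under
  \<open>tensor_eq\<close>, it computes \<open>tensor_lift\<close>, whose definition picks an arbitrary representative.
\<close>

definition formal_sum :: "('m, 'r) ring_scheme \<Rightarrow> ('a \<Rightarrow> 'b \<Rightarrow> 'm) \<Rightarrow> ('a \<times> 'b) list \<Rightarrow> 'm" where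
  "formal_sum M f l = foldr (\<lambda>p y. (case p of (v, w) \<Rightarrow> f v w) \<oplus>\<^bsub>M\<^esub> y) l \<zero>\<^bsub>M\<^esub>"

lemma linear_mapI:
  assumes "\<And>x. x \<in> carrier V \<Longrightarrow> f x \<in> carrier W"
    and "\<And>x y. x \<in> carrier V \<Longrightarrow> y \<in> carrier V \<Longrightarrow> f (x \<oplus>\<^bsub>V\<^esub> y) = f x \<oplus>\<^bsub>W\<^esub> f y"
    and "\<And>c x. c \<in> carrier k \<Longrightarrow> x \<in> carrier V \<Longrightarrow> f (c \<odot>\<^bsub>V\<^esub> x) = c \<odot>\<^bsub>W\<^esub> f x"
  shows "linear_map k V W f"
  using assms by (auto simp: linear_map_def)

lemma linear_mapD:
  assumes "linear_map k V W f"
  shows "x \<in> carrier V \<Longrightarrow> f x \<in> carrier W"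
    and "x \<in> carrier V \<Longrightarrow> y \<in> carrier V \<Longrightarrow> f (x \<oplus>\<^bsub>V\<^esub> y) = f x \<oplus>\<^bsub>W\<^esub> f y"
    and "c \<in> carrier k \<Longrightarrow> x \<in> carrier V \<Longrightarrow> f (c \<odot>\<^bsub>V\<^esub> x) = c \<odot>\<^bsub>W\<^esub> f x"
  using assms by (auto simp: linear_map_def)

lemma linear_map_zero:
  assumes "module k V" "module k W" "linear_map k V W f"
  shows "f \<zero>\<^bsub>V\<^esub> = \<zero>\<^bsub>W\<^esub>"
proof -
  interpret V: module k V by fact
  interpret W: module k W by fact
  have "f (\<zero>\<^bsub>k\<^esub> \<odot>\<^bsub>V\<^esub> \<zero>\<^bsub>V\<^esub>) = \<zero>\<^bsub>k\<^esub> \<odot>\<^bsub>W\<^esub> f \<zero>\<^bsub>V\<^esub>"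
    by (rule linear_mapD[OF assms(3)]) auto
  then show ?thesis using linear_mapD(1)[OF assms(3), of "\<zero>\<^bsub>V\<^esub>"] by simp
qed

lemma bilinearD:
  assumes "bilinear k V W M f"
  shows "v \<in> carrier V \<Longrightarrow> linear_map k W M (f v)"
    and "w \<in> carrier W \<Longrightarrow> linear_map k V M (\<lambda>v. f v w)"
    and "v \<in> carrier V \<Longrightarrow> w \<in> carrier W \<Longrightarrow> f v w \<in> carrier M"
    and "v \<in> carrier V \<Longrightarrow> v' \<in> carrier V \<Longrightarrow> w \<in> carrier W \<Longrightarrow>
      f (v \<oplus>\<^bsub>V\<^esub> v') w = f v w \<oplus>\<^bsub>M\<^esub> f v' w"
    and "v \<in> carrier V \<Longrightarrow> w' \<in> carrier W \<Longrightarrow> w \<in> carrier W \<Longrightarrow>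
      f v (w \<oplus>\<^bsub>W\<^esub> w') = f v w \<oplus>\<^bsub>M\<^esub> f v w'"
    and "c \<in> carrier k \<Longrightarrow> v \<in> carrier V \<Longrightarrow> w \<in> carrier W \<Longrightarrow>
      f (c \<odot>\<^bsub>V\<^esub> v) w = c \<odot>\<^bsub>M\<^esub> f v w"
    and "c \<in> carrier k \<Longrightarrow> v \<in> carrier V \<Longrightarrow> w \<in> carrier W \<Longrightarrow>
      f v (c \<odot>\<^bsub>W\<^esub> w) = c \<odot>\<^bsub>M\<^esub> f v w"
  using assms by (auto simp: linear_map_def bilinear_def)

lemma bilinearI:
  assumes "\<And>v. v \<in> carrier V \<Longrightarrow> linear_map k W M (\<lambda>w. f v w)"
    and "\<And>w. w \<in> carrier W \<Longrightarrow> linear_map k V M (\<lambda>v. f v w)"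
  shows "bilinear k V W M f"
  using assms by (auto simp: bilinear_def)

text \<open>
  Membership of a list in \<open>reps\<close> below is kept as one fact about the list; unfolding it to all elements
  would hide the closure rules for \<open>(@)\<close> and \<open>(#)\<close> from the simplifier.
\<close>

declare in_listsD [rule del] in_listsI [rule del]

locale two_modules = V: module k V + W: module k W
  for k :: "'k ring" and V :: "('k, 'v, 'm) module_scheme" and W :: "('k, 'w, 'n) module_scheme"
begin

abbreviation "T \<equiv> tensor k V W"
abbreviation "cls \<equiv> tensor_class k V W"
abbreviation simple (infix \<open>\<boxtimes>\<close> 75) where "v \<boxtimes> w \<equiv> simple_tensor k V W v w"
abbreviation "reps \<equiv> lists (carrier V \<times> carrier W)"

lemma tensor_eq_lists: "tensor_eq k V W l m \<Longrightarrow> l \<in> reps \<and> m \<in> reps"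
  by (induct rule: tensor_eq.induct) auto

lemma cls_eq_iff: "l \<in> reps \<Longrightarrow> m \<in> reps \<Longrightarrow> cls l = cls m \<longleftrightarrow> tensor_eq k V W l m"
  unfolding tensor_class_def using tensor_eq.sym tensor_eq.trans tensor_eq.refl by blast

lemma cls_eqI: "tensor_eq k V W l m \<Longrightarrow> cls l = cls m"
  using cls_eq_iff tensor_eq_lists by blast

lemma mem_cls: "l \<in> reps \<Longrightarrow> l \<in> cls l"
  by (simp add: tensor_class_def tensor_eq.refl)

lemma cls_carrier: "l \<in> reps \<Longrightarrow> cls l \<in> carrier T"
  by (simp add: tensor_def)

lemma carrierE: assumes "t \<in> carrier T" obtains l where "l \<in> reps" "t = cls l"
  using assms by (auto simp: tensor_def)

text \<open>
  The operations on classes are unions over all choices of representatives; such a union is a single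
  class as soon as the summand does not depend on the choice.
\<close>

lemma UN_cls:
  assumes "l \<in> reps" "\<And>l'. tensor_eq k V W l l' \<Longrightarrow> f l' = f l"
  shows "(\<Union>l'\<in>cls l. f l') = f l"
proof -
  have "f l' = f l" if "l' \<in> cls l" for l'
    using that assms(2) by (simp add: tensor_class_def)
  then show ?thesis using mem_cls[OF assms(1)] by blast
qed

lemma add_cls:
  assumes "l \<in> reps" "m \<in> reps"
  shows "cls l \<oplus>\<^bsub>T\<^esub> cls m = cls (l @ m)"
proof -
  have *: "cls (l' @ m') = cls (l @ m)" if "tensor_eq k V W l l'" "tensor_eq k V W m m'" for l' m'
    using cls_eqI[OF tensor_eq.append[OF that]] by (rule HOL.sym)
  have **: "(\<Union>m'\<in>cls m. cls (l' @ m')) = cls (l @ m)" if l': "tensor_eq k V W l l'" for l'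
  proof -
    have "(\<Union>m'\<in>cls m. cls (l' @ m')) = cls (l' @ m)"
      by (rule UN_cls[OF assms(2)]) (simp only: *[OF l'] *[OF l' tensor_eq.refl[OF assms(2)]])
    then show ?thesis by (simp only: *[OF l' tensor_eq.refl[OF assms(2)]])
  qed
  have "(\<Union>l'\<in>cls l. \<Union>m'\<in>cls m. cls (l' @ m')) = (\<Union>m'\<in>cls m. cls (l @ m'))"
    by (rule UN_cls[OF assms(1)]) (simp only: ** **[OF tensor_eq.refl[OF assms(1)]])
  then show ?thesis using **[OF tensor_eq.refl[OF assms(1)]] by (simp add: tensor_def)
qed

lemma zero_cls: "\<zero>\<^bsub>T\<^esub> = cls []"
  by (simp add: tensor_def)

text \<open>
  The scalar acts on the left entries, so the only generator that needs an argument is balancedness,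
  where two scalars meet on the left and have to be exchanged.
\<close>

lemma smult_eq:
  assumes c: "c \<in> carrier k"
  shows "tensor_eq k V W l m \<Longrightarrow>
    tensor_eq k V W (map (\<lambda>(v, w). (c \<odot>\<^bsub>V\<^esub> v, w)) l) (map (\<lambda>(v, w). (c \<odot>\<^bsub>V\<^esub> v, w)) m)"
proof (induct rule: tensor_eq.induct)
  case (refl l)
  then show ?case using c by (intro tensor_eq.refl) (auto simp: in_lists_conv_set)
next
  case (balance d v w)
  have "tensor_eq k V W [(d \<odot>\<^bsub>V\<^esub> (c \<odot>\<^bsub>V\<^esub> v), w)] [(c \<odot>\<^bsub>V\<^esub> v, d \<odot>\<^bsub>W\<^esub> w)]"
    by (rule tensor_eq.balance) (use balance c in auto)
  moreover have "d \<odot>\<^bsub>V\<^esub> (c \<odot>\<^bsub>V\<^esub> v) = c \<odot>\<^bsub>V\<^esub> (d \<odot>\<^bsub>V\<^esub> v)"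
    using balance c by (metis V.smult_assoc1 V.R.m_comm)
  ultimately show ?case by simp
next
  case (sym l l')
  then show ?case by (rule_tac tensor_eq.sym)
next
  case (trans l l' l'')
  then show ?case by (metis tensor_eq.trans)
qed (use c in \<open>auto simp: V.smult_r_distr intro: tensor_eq.swap tensor_eq.append tensor_eq.add_left tensor_eq.add_right tensor_eq.zero\<close>)

lemma map_smult_lists:
  "c \<in> carrier k \<Longrightarrow> l \<in> reps \<Longrightarrow> map (\<lambda>(v, w). (c \<odot>\<^bsub>V\<^esub> v, w)) l \<in> reps"
  by (auto simp: in_lists_conv_set)

lemma smult_cls:
  assumes "c \<in> carrier k" "l \<in> reps"
  shows "c \<odot>\<^bsub>T\<^esub> cls l = cls (map (\<lambda>(v, w). (c \<odot>\<^bsub>V\<^esub> v, w)) l)"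
proof -
  have "(\<Union>l\<in>cls l. cls (map (\<lambda>(v, w). (c \<odot>\<^bsub>V\<^esub> v, w)) l)) = cls (map (\<lambda>(v, w). (c \<odot>\<^bsub>V\<^esub> v, w)) l)"
    using cls_eqI[OF smult_eq[OF assms(1)]] assms(2) by (subst UN_cls) auto
  then show ?thesis by (simp add: tensor_def)
qed

text \<open>
  \<open>tensor_eq\<close> only swaps adjacent pairs; here a whole block is moved, one pair at a time.
\<close>

lemma append_comm: "l \<in> reps \<Longrightarrow> m \<in> reps \<Longrightarrow> cls (l @ m) = cls (m @ l)"
proof (induct l arbitrary: m)
  case (Cons p l)
  have p: "p \<in> carrier V \<times> carrier W" "l \<in> reps" using Cons(2) by auto
  have pm: "cls (p # m) = cls (m @ [p])" using Cons(3)
  proof (induct m)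
    case (Cons q m)
    have q: "q \<in> carrier V \<times> carrier W" "m \<in> reps" using Cons by auto
    have "tensor_eq k V W ([p, q] @ m) ([q, p] @ m)"
      using p q by (intro tensor_eq.append tensor_eq.swap tensor_eq.refl)
    from cls_eqI[OF this] have "cls (p # q # m) = cls [q] \<oplus>\<^bsub>T\<^esub> cls (p # m)"
      using p q by (simp add: add_cls)
    also have "\<dots> = cls [q] \<oplus>\<^bsub>T\<^esub> cls (m @ [p])" using Cons.hyps by (simp only:)
    also have "\<dots> = cls ((q # m) @ [p])" using p q by (simp add: add_cls)
    finally show ?case by simp
  qed simp
  have "cls ((p # l) @ m) = cls [p] \<oplus>\<^bsub>T\<^esub> cls (l @ m)" using p Cons.prems by (simp add: add_cls)
  also have "\<dots> = cls [p] \<oplus>\<^bsub>T\<^esub> cls (m @ l)" by (simp only: Cons.hyps[OF p(2) Cons.prems(2)])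
  also have "\<dots> = cls (p # m) \<oplus>\<^bsub>T\<^esub> cls l" using Cons.prems by (simp add: add_cls)
  also have "\<dots> = cls (m @ [p]) \<oplus>\<^bsub>T\<^esub> cls l" by (simp only: pm)
  also have "\<dots> = cls (m @ p # l)" using Cons.prems by (simp add: add_cls)
  finally show ?case .
qed simp

lemma simple_carrier: "v \<in> carrier V \<Longrightarrow> w \<in> carrier W \<Longrightarrow> v \<boxtimes> w \<in> carrier T"
  by (simp add: simple_tensor_def cls_carrier)

lemma zero_simple: "w \<in> carrier W \<Longrightarrow> \<zero>\<^bsub>V\<^esub> \<boxtimes> w = \<zero>\<^bsub>T\<^esub>"
  unfolding simple_tensor_def zero_cls by (intro cls_eqI tensor_eq.zero)

lemma simple_add_left: "v \<in> carrier V \<Longrightarrow> v' \<in> carrier V \<Longrightarrow> w \<in> carrier W \<Longrightarrow>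
    (v \<oplus>\<^bsub>V\<^esub> v') \<boxtimes> w = v \<boxtimes> w \<oplus>\<^bsub>T\<^esub> v' \<boxtimes> w"
  using cls_eqI[OF tensor_eq.add_left, of v v' w] by (simp add: simple_tensor_def add_cls)

lemma simple_add_right: "v \<in> carrier V \<Longrightarrow> w' \<in> carrier W \<Longrightarrow> w \<in> carrier W \<Longrightarrow>
    v \<boxtimes> (w \<oplus>\<^bsub>W\<^esub> w') = v \<boxtimes> w \<oplus>\<^bsub>T\<^esub> v \<boxtimes> w'"
  using cls_eqI[OF tensor_eq.add_right, of v w w'] by (simp add: simple_tensor_def add_cls)

lemma simple_smult_left: "c \<in> carrier k \<Longrightarrow> v \<in> carrier V \<Longrightarrow> w \<in> carrier W \<Longrightarrow>
    (c \<odot>\<^bsub>V\<^esub> v) \<boxtimes> w = c \<odot>\<^bsub>T\<^esub> (v \<boxtimes> w)"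
  by (auto simp add: simple_tensor_def smult_cls)

lemma simple_smult_right: "c \<in> carrier k \<Longrightarrow> v \<in> carrier V \<Longrightarrow> w \<in> carrier W \<Longrightarrow>
    v \<boxtimes> (c \<odot>\<^bsub>W\<^esub> w) = c \<odot>\<^bsub>T\<^esub> (v \<boxtimes> w)"
  using cls_eqI[OF tensor_eq.balance, of c v w] by (auto simp add: simple_tensor_def smult_cls)

lemma comm_monoid_tensor: "comm_monoid (add_monoid T)"
  by (rule comm_monoidI)
    (auto elim!: carrierE simp: add_cls zero_cls cls_carrier simp del: append_assoc,
     simp_all add: append_comm)

lemma abelian_monoid_tensor: "abelian_monoid T"
  by (rule abelian_monoid.intro, rule comm_monoid_tensor)

lemma tensor_induct [consumes 1, case_names zero simple add]:
  assumes "t \<in> carrier T"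
    and "P \<zero>\<^bsub>T\<^esub>" 
    and "\<And>v w. v \<in> carrier V \<Longrightarrow> w \<in> carrier W \<Longrightarrow> P (v \<boxtimes> w)"
    and "\<And>s t. s \<in> carrier T \<Longrightarrow> t \<in> carrier T \<Longrightarrow> P s \<Longrightarrow> P t \<Longrightarrow> P (s \<oplus>\<^bsub>T\<^esub> t)"
  shows "P t"
proof -
  have "P (cls l)" if "l \<in> reps" for l
    using that
  proof (induct l)
    case (Cons p l)
    obtain v w where p: "p = (v, w)" by force
    have "P (v \<boxtimes> w \<oplus>\<^bsub>T\<^esub> cls l)"
      using Cons p by (intro assms(3,4)) (auto intro: simple_carrier cls_carrier)
    then show ?case using Cons p by (simp add: simple_tensor_def add_cls)
  qed (use assms(2) zero_cls in simp)
  then show ?thesis using assms(1) by (auto elim: carrierE)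
qed

text \<open>
  Negatives exist since \<open>(-v) \<otimes> w\<close> is inverse to \<open>v \<otimes> w\<close> and sums of invertible elements are invertible.
\<close>

lemma abelian_group_tensor: "abelian_group T"
proof -
  interpret A: abelian_monoid T by (rule abelian_monoid_tensor)
  have "\<exists>s\<in>carrier T. s \<oplus>\<^bsub>T\<^esub> t = \<zero>\<^bsub>T\<^esub>" if "t \<in> carrier T" for t
    using that
  proof (induct rule: tensor_induct)
    case zero
    then show ?case using A.zero_closed A.l_zero by blast
  next
    case (simple v w)
    then have "(\<ominus>\<^bsub>V\<^esub> v) \<boxtimes> w \<oplus>\<^bsub>T\<^esub> v \<boxtimes> w = \<zero>\<^bsub>T\<^esub>"
      by (simp add: simple_add_left[symmetric] V.M.l_neg zero_simple)
    then show ?case using simple by (metis V.M.a_inv_closed simple_carrier)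
  next
    case (add s t)
    then obtain s' t' where "s' \<in> carrier T" "t' \<in> carrier T" "s' \<oplus>\<^bsub>T\<^esub> s = \<zero>\<^bsub>T\<^esub>" "t' \<oplus>\<^bsub>T\<^esub> t = \<zero>\<^bsub>T\<^esub>"
      by auto
    moreover have "(s' \<oplus>\<^bsub>T\<^esub> t') \<oplus>\<^bsub>T\<^esub> (s \<oplus>\<^bsub>T\<^esub> t) = (s' \<oplus>\<^bsub>T\<^esub> s) \<oplus>\<^bsub>T\<^esub> (t' \<oplus>\<^bsub>T\<^esub> t)"
      using add calculation(1,2) by (simp add: A.a_ac)
    ultimately show ?case by (intro bexI[of _ "s' \<oplus>\<^bsub>T\<^esub> t'"]) auto
  qed
  then show ?thesis
    by (intro abelian_groupI) (simp_all add: A.a_ac)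
qed

lemma module_tensor: "module k T"
proof (rule moduleI)
  show "cring k" by (rule V.R.is_cring)
  show "abelian_group T" by (rule abelian_group_tensor)
  interpret A: abelian_group T by (rule abelian_group_tensor)
  show cl: "a \<odot>\<^bsub>T\<^esub> x \<in> carrier T" if "a \<in> carrier k" "x \<in> carrier T" for a x
    using that by (auto elim!: carrierE simp: smult_cls intro!: cls_carrier map_smult_lists)
  show d: "a \<odot>\<^bsub>T\<^esub> (x \<oplus>\<^bsub>T\<^esub> y) = a \<odot>\<^bsub>T\<^esub> x \<oplus>\<^bsub>T\<^esub> a \<odot>\<^bsub>T\<^esub> y"
    if "a \<in> carrier k" "x \<in> carrier T" "y \<in> carrier T" for a x y
    using that by (auto elim!: carrierE simp: smult_cls add_cls map_smult_lists)
  have z: "a \<odot>\<^bsub>T\<^esub> \<zero>\<^bsub>T\<^esub> = \<zero>\<^bsub>T\<^esub>" if "a \<in> carrier k" for a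
    using that by (simp add: zero_cls smult_cls)
  show "(a \<oplus>\<^bsub>k\<^esub> b) \<odot>\<^bsub>T\<^esub> x = a \<odot>\<^bsub>T\<^esub> x \<oplus>\<^bsub>T\<^esub> b \<odot>\<^bsub>T\<^esub> x"
    if "a \<in> carrier k" "b \<in> carrier k" "x \<in> carrier T" for a b x
    using that(3,1,2)
  proof (induct rule: tensor_induct)
    case (simple v w)
    then show ?case
      by (simp add: simple_smult_left[symmetric] V.smult_l_distr simple_add_left)
  next
    case (add s t)
    then show ?case by (simp add: d A.a_ac cl)
  qed (simp add: z)
  show "(a \<otimes>\<^bsub>k\<^esub> b) \<odot>\<^bsub>T\<^esub> x = a \<odot>\<^bsub>T\<^esub> (b \<odot>\<^bsub>T\<^esub> x)"
    if "a \<in> carrier k" "b \<in> carrier k" "x \<in> carrier T" for a b x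
    using that(3,1,2)
  proof (induct rule: tensor_induct)
    case (simple v w)
    then show ?case
      by (simp add: simple_smult_left[symmetric] V.smult_assoc1)
  qed (simp_all add: z d cl)
  show "\<one>\<^bsub>k\<^esub> \<odot>\<^bsub>T\<^esub> x = x" if "x \<in> carrier T" for x
    using that
  proof (induct rule: tensor_induct)
    case (simple v w)
    then show ?case by (simp add: simple_smult_left[symmetric])
  qed (simp_all add: z d cl)
qed

lemma formal_sum_closed:
  assumes "module k M" "bilinear k V W M f" "l \<in> reps"
  shows "formal_sum M f l \<in> carrier M"
proof -
  interpret M: module k M by fact
  show ?thesis unfolding formal_sum_def
    by (rule foldr_add(1)[OF M.M.abelian_monoid_axioms _ assms(3)])
      (use bilinearD[OF assms(2)] in auto)
qed

lemma formal_sum_append: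
  assumes "module k M" "bilinear k V W M f" "l \<in> reps" "m \<in> reps"
  shows "formal_sum M f (l @ m) = formal_sum M f l \<oplus>\<^bsub>M\<^esub> formal_sum M f m"
proof -
  interpret M: module k M by fact
  show ?thesis unfolding formal_sum_def
    by (rule foldr_add(2)[OF M.M.abelian_monoid_axioms _ assms(3,4)])
      (use bilinearD[OF assms(2)] in auto)
qed

text \<open>
  The universal property on representatives: each generating relation of \<open>tensor_eq\<close> is respected by a
  bilinear map, and the congruence rules are respected because the target is an abelian group.
\<close>

lemma formal_sum_tensor_eq:
  assumes "module k M" and f: "bilinear k V W M f"
  shows "tensor_eq k V W l m \<Longrightarrow> formal_sum M f l = formal_sum M f m"
proof (induct rule: tensor_eq.induct)
  interpret M: module k M by fact
  note D = bilinearD[OF f]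
  have z: "f \<zero>\<^bsub>V\<^esub> w = \<zero>\<^bsub>M\<^esub>" if "w \<in> carrier W" for w
    using linear_map_zero[OF V.module_axioms M.module_axioms D(2)[OF that]] .
  {
    case (sym l l')
    then show ?case by simp
  next
    case (trans l l' l'')
    then show ?case by simp
  next
    case (append l l' m m')
    then show ?case using assms by (auto simp: formal_sum_append dest!: tensor_eq_lists)
  next
    case (swap p q)
    then show ?case using D by (auto simp: formal_sum_def M.M.a_ac)
  next
    case (zero w)
    then show ?case using z by (auto simp: formal_sum_def)
  next
    case (balance c v w)
    then show ?case using D by (simp add: formal_sum_def)
  next
    case (add_left v v' w)
    then show ?case using D by (simp add: formal_sum_def M.M.a_assoc)
  next
    case (add_right v w w')
    then show ?case using D by (simp add: formal_sum_def M.M.a_assoc)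
  }
qed simp

lemma tensor_lift_cls:
  assumes "module k M" "bilinear k V W M f" "l \<in> reps"
  shows "tensor_lift M f (cls l) = formal_sum M f l"
proof -
  have "(SOME m. m \<in> cls l) \<in> cls l" using mem_cls[OF assms(3)] by (rule someI)
  then have "formal_sum M f (SOME m. m \<in> cls l) = formal_sum M f l"
    using formal_sum_tensor_eq[OF assms(1,2)] by (simp add: tensor_class_def)
  then show ?thesis by (simp add: tensor_lift_def formal_sum_def split_def)
qed

lemma tensor_lift_simple:
  assumes "module k M" "bilinear k V W M f" "v \<in> carrier V" "w \<in> carrier W"
  shows "tensor_lift M f (v \<boxtimes> w) = f v w"
proof -
  interpret M: module k M by fact
  show ?thesis using bilinearD(3)[OF assms(2-4)] assms
    by (simp add: simple_tensor_def tensor_lift_cls) (simp add: formal_sum_def)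
qed

lemma tensor_lift_linear:
  assumes "module k M" "bilinear k V W M f"
  shows "linear_map k T M (tensor_lift M f)"
proof (rule linear_mapI)
  interpret M: module k M by fact
  interpret T: module k T by (rule module_tensor)
  show cl: "tensor_lift M f x \<in> carrier M" if "x \<in> carrier T" for x
    using that assms by (auto elim!: carrierE simp: tensor_lift_cls formal_sum_closed)
  show lift_add: "tensor_lift M f (x \<oplus>\<^bsub>T\<^esub> y) = tensor_lift M f x \<oplus>\<^bsub>M\<^esub> tensor_lift M f y"
    if "x \<in> carrier T" "y \<in> carrier T" for x y
    using that assms by (auto elim!: carrierE simp: add_cls tensor_lift_cls formal_sum_append)
  have z: "tensor_lift M f \<zero>\<^bsub>T\<^esub> = \<zero>\<^bsub>M\<^esub>" unfolding zero_cls
    using assms by (simp add: tensor_lift_cls) (simp add: formal_sum_def)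
  show "tensor_lift M f (c \<odot>\<^bsub>T\<^esub> x) = c \<odot>\<^bsub>M\<^esub> tensor_lift M f x"
    if "c \<in> carrier k" "x \<in> carrier T" for c x
    using that(2,1)
  proof (induct rule: tensor_induct)
    case (simple v w)
    then show ?case using assms
      by (simp add: simple_smult_left[symmetric] tensor_lift_simple bilinearD(6)[OF assms(2)])
  next
    case (add s t)
    then show ?case by (simp add: T.smult_r_distr lift_add cl M.smult_r_distr)
  qed (simp add: z)
qed

text \<open>
  Pure tensors generate, so linear maps are determined by them.  The conclusion is a bounded
  quantification rather than an equation in a free \<open>t\<close>: resolution then finds \<open>f\<close> and \<open>g\<close> by
  higher-order pattern matching, and the rule can be applied to nested tensor products in turn.
\<close>

lemma tensor_eqI_ball:
  assumes "linear_map k T M f" "linear_map k T M g" "module k M"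
    and "\<forall>v\<in>carrier V. \<forall>w\<in>carrier W. f (v \<boxtimes> w) = g (v \<boxtimes> w)"
  shows "\<forall>t\<in>carrier T. f t = g t"
proof
  fix t assume "t \<in> carrier T"
  then show "f t = g t"
  proof (induct rule: tensor_induct)
    case zero
    then show ?case by (simp only: linear_map_zero[OF module_tensor assms(3,1)] linear_map_zero[OF module_tensor assms(3,2)])
  next
    case (add s t)
    then show ?case using linear_mapD(2)[OF assms(1)] linear_mapD(2)[OF assms(2)] by simp
  qed (use assms(4) in auto)
qed

end

section \<open>Linear maps\<close>

text \<open>
  The rules collected here show that a term is linear in a variable by recursion on the term.  Their
  first premise is always linearity of the argument that contains the variable, so that resolution
  determines the intermediate modules before they are needed in the other premises.
\<close>

named_theorems lin

lemma lin_id [lin]: "linear_map k V V (\<lambda>x. x)"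
  by (simp add: linear_map_def)

lemma linear_id [simp]: "linear_map k V V id"
  by (simp add: linear_map_def)

lemma lin_comp: "linear_map k U V g \<Longrightarrow> linear_map k V W f \<Longrightarrow> linear_map k U W (\<lambda>x. f (g x))"
  by (rule linear_mapI) (simp_all add: linear_mapD)

lemma lin_add:
  assumes "module k W" "linear_map k U W f" "linear_map k U W g"
  shows "linear_map k U W (\<lambda>x. f x \<oplus>\<^bsub>W\<^esub> g x)"
proof -
  interpret W: module k W by fact
  note D = linear_mapD[OF assms(2)] linear_mapD[OF assms(3)]
  show ?thesis
    by (rule linear_mapI) (simp_all add: D W.smult_r_distr W.M.a_ac)
qed

lemma lin_smult [lin]:
  assumes "linear_map k U W f" "module k W" "c \<in> carrier k"
  shows "linear_map k U W (\<lambda>x. c \<odot>\<^bsub>W\<^esub> f x)"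
proof -
  interpret W: module k W by fact
  note D = linear_mapD[OF assms(1)]
  have "c \<odot>\<^bsub>W\<^esub> (d \<odot>\<^bsub>W\<^esub> f x) = d \<odot>\<^bsub>W\<^esub> (c \<odot>\<^bsub>W\<^esub> f x)" if "d \<in> carrier k" "x \<in> carrier U" for d x
    using that D assms(3) by (simp add: W.smult_assoc1[symmetric] W.R.m_comm)
  then show ?thesis
    by (intro linear_mapI) (simp_all add: D W.smult_r_distr assms(3))
qed

lemma base_algebra_sel [simp]:
  "carrier (base_algebra k) = carrier k" "mult (base_algebra k) = mult k" "one (base_algebra k) = one k"
  "zero (base_algebra k) = zero k" "add (base_algebra k) = add k" "smult (base_algebra k) = mult k"
  by (simp_all add: base_algebra_def)

lemma lin_smult_scalar [lin]:
  assumes "linear_map k U (base_algebra k) f" "module k W" "w \<in> carrier W"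
  shows "linear_map k U W (\<lambda>x. f x \<odot>\<^bsub>W\<^esub> w)"
proof -
  interpret W: module k W by fact
  show ?thesis using linear_mapD[OF assms(1)] assms(3)
    by (intro linear_mapI) (simp_all add: W.smult_l_distr W.smult_assoc1)
qed

lemma lin_mult_left [lin]:
  assumes "linear_map k U A f" "assoc_algebra k A" "a \<in> carrier A"
  shows "linear_map k U A (\<lambda>x. f x \<otimes>\<^bsub>A\<^esub> a)"
proof -
  interpret A: assoc_algebra k A by fact
  show ?thesis using linear_mapD[OF assms(1)] assms(3)
    by (intro linear_mapI) (simp_all add: A.l_distr A.smult_mult_left)
qed

lemma lin_mult_right [lin]:
  assumes "linear_map k U A f" "assoc_algebra k A" "a \<in> carrier A"
  shows "linear_map k U A (\<lambda>x. a \<otimes>\<^bsub>A\<^esub> f x)"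
proof -
  interpret A: assoc_algebra k A by fact
  show ?thesis using linear_mapD[OF assms(1)] assms(3)
    by (intro linear_mapI) (simp_all add: A.r_distr A.smult_mult_right)
qed

lemma assoc_algebra_module [simp]: "assoc_algebra k A \<Longrightarrow> module k A"
  by (simp add: assoc_algebra_def)

lemma two_modulesI: "module k V \<Longrightarrow> module k W \<Longrightarrow> two_modules k V W"
  by (rule two_modules.intro)

lemmas tensor_module [simp] = two_modules.module_tensor[OF two_modulesI]
lemmas tensor_simple_closed [simp] = two_modules.simple_carrier[OF two_modulesI]

lemma tensor_eqI:
  assumes "linear_map k (tensor k V W) M f" "linear_map k (tensor k V W) M g"
    "module k V" "module k W" "module k M"
    "\<forall>v\<in>carrier V. \<forall>w\<in>carrier W. f (simple_tensor k V W v w) = g (simple_tensor k V W v w)"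
  shows "\<forall>t\<in>carrier (tensor k V W). f t = g t"
  using two_modules.tensor_eqI_ball[OF two_modulesI, of k V W M f g] assms by blast

lemmas tensor_lift_simple = two_modules.tensor_lift_simple[OF two_modulesI]
lemmas tensor_lift_linear = two_modules.tensor_lift_linear[OF two_modulesI]

lemma simple_bilinear:
  assumes "module k V" "module k W"
  shows "bilinear k V W (tensor k V W) (simple_tensor k V W)"
proof -
  interpret two_modules k V W using assms by (rule two_modulesI)
  show ?thesis
    by (intro bilinearI linear_mapI)
      (simp_all add: simple_carrier simple_add_left simple_add_right simple_smult_left simple_smult_right)
qed

lemma lin_simple_left [lin]:
  "linear_map k U V g \<Longrightarrow> module k V \<Longrightarrow> module k W \<Longrightarrow> w \<in> carrier W \<Longrightarrow>
    linear_map k U (tensor k V W) (\<lambda>x. simple_tensor k V W (g x) w)"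
  by (rule lin_comp[OF _ bilinearD(2)[OF simple_bilinear]])

lemma lin_simple_right [lin]:
  "linear_map k U W g \<Longrightarrow> module k V \<Longrightarrow> module k W \<Longrightarrow> v \<in> carrier V \<Longrightarrow>
    linear_map k U (tensor k V W) (\<lambda>x. simple_tensor k V W v (g x))"
  by (rule lin_comp[OF _ bilinearD(1)[OF simple_bilinear]])

lemma lin_lift [lin]:
  assumes "linear_map k U (tensor k A B) g" "module k A" "module k B" "module k M" "bilinear k A B M f"
  shows "linear_map k U M (\<lambda>x. tensor_lift M f (g x))"
  using assms by (intro lin_comp[OF _ tensor_lift_linear]) auto

text \<open>
  A Sweedler sum over a fixed tensor \<open>t\<close> is linear in a parameter of its summand.  Linearity of \<open>F\<close> in
  the parameter lifts from pure tensors to \<open>t\<close> by extensionality in \<open>t\<close>.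
\<close>

lemma lin_lift_param:
  assumes t: "t \<in> carrier (tensor k A B)" and [simp]: "module k A" "module k B" "module k M"
    and F: "\<And>a b. a \<in> carrier A \<Longrightarrow> b \<in> carrier B \<Longrightarrow> linear_map k U M (\<lambda>x. F x a b)"
    and B: "\<And>x. x \<in> carrier U \<Longrightarrow> bilinear k A B M (F x)" and U: "module k U"
  shows "linear_map k U M (\<lambda>x. tensor_lift M (F x) t)"
proof -
  interpret U: module k U by fact
  note L = tensor_lift_linear[OF assms(2-4) B] 
  have 1: "\<forall>t\<in>carrier (tensor k A B). tensor_lift M (F (x \<oplus>\<^bsub>U\<^esub> y)) t =
     tensor_lift M (F x) t \<oplus>\<^bsub>M\<^esub> tensor_lift M (F y) t" if "x \<in> carrier U" "y \<in> carrier U" for x y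
    using that linear_mapD(2)[OF F]
    by (intro tensor_eqI[OF L lin_add[OF _ L L]]) (simp_all add: tensor_lift_simple B)
  have 2: "\<forall>t\<in>carrier (tensor k A B). tensor_lift M (F (c \<odot>\<^bsub>U\<^esub> x)) t =
     c \<odot>\<^bsub>M\<^esub> tensor_lift M (F x) t" if "x \<in> carrier U" "c \<in> carrier k" for x c
    using that linear_mapD(3)[OF F]
    by (intro tensor_eqI[OF L lin_smult[OF L]]) (simp_all add: tensor_lift_simple B)
  show ?thesis
    using 1 2 t linear_mapD(1)[OF L t] by (intro linear_mapI) auto
qed

section \<open>Tensor products of linear maps\<close>

lemma tensor_map_bilinear:
  assumes "module k V" "module k W" "linear_map k A V f" "linear_map k B W g"
  shows "bilinear k A B (tensor k V W) (\<lambda>a b. simple_tensor k V W (f a) (g b))"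
  using assms linear_mapD(1)[OF assms(3)] linear_mapD(1)[OF assms(4)]
  by (intro bilinearI lin) auto

lemma tensor_map_simple [simp]:
  assumes "module k A" "module k B" "module k V" "module k W" "linear_map k A V f" "linear_map k B W g"
    "a \<in> carrier A" "b \<in> carrier B"
  shows "tensor_map k V W f g (simple_tensor k A B a b) = simple_tensor k V W (f a) (g b)"
  unfolding tensor_map_def using assms
  by (intro tensor_lift_simple[OF _ _ _ tensor_map_bilinear]) auto

lemma tensor_map_linear [simp]:
  assumes "module k A" "module k B" "module k V" "module k W" "linear_map k A V f" "linear_map k B W g"
  shows "linear_map k (tensor k A B) (tensor k V W) (tensor_map k V W f g)"
  unfolding tensor_map_def using assms
  by (intro tensor_lift_linear tensor_map_bilinear) auto

lemma lin_tensor_map [lin]: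
  assumes "linear_map k U (tensor k A B) h" "linear_map k A V f" "linear_map k B W g"
    "module k A" "module k B" "module k V" "module k W"
  shows "linear_map k U (tensor k V W) (\<lambda>x. tensor_map k V W f g (h x))"
  using assms by (intro lin_comp[OF _ tensor_map_linear]) auto

lemma tensor_map_closed [simp]:
  assumes "t \<in> carrier (tensor k A B)" "linear_map k A V f" "linear_map k B W g"
    "module k A" "module k B" "module k V" "module k W"
  shows "tensor_map k V W f g t \<in> carrier (tensor k V W)"
  using linear_mapD(1)[OF tensor_map_linear] assms by blast

lemma linear_map_cong:
  assumes "linear_map k V W f" "\<And>x. x \<in> carrier V \<Longrightarrow> f x = g x" "module k V"
  shows "linear_map k V W g"
proof -
  interpret V: module k V by fact
  show ?thesis using linear_mapD[OF assms(1)] assms(2) by (intro linear_mapI) (metis V.M.a_closed V.smult_closed)+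
qed

lemma tensor_map_cong:
  assumes "t \<in> carrier (tensor k A B)" "linear_map k A V f" "linear_map k B W g"
    "module k A" "module k B" "module k V" "module k W"
    and f: "\<And>a. a \<in> carrier A \<Longrightarrow> f a = f' a" and g: "\<And>b. b \<in> carrier B \<Longrightarrow> g b = g' b"
  shows "tensor_map k V W f g t = tensor_map k V W f' g' t"
proof -
  have [simp]: "linear_map k A V f'" "linear_map k B W g'"
    using assms by (auto intro: linear_map_cong)
  have "\<forall>t\<in>carrier (tensor k A B). tensor_map k V W f g t = tensor_map k V W f' g' t"
    by (rule tensor_eqI, (rule lin | use assms in simp)+)
  then show ?thesis using assms by simp
qed

lemma tensor_map_comp:
  assumes "t \<in> carrier (tensor k A B)" "linear_map k A V f" "linear_map k B W g"
    "linear_map k V V' f'" "linear_map k W W' g'"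
    "module k A" "module k B" "module k V" "module k W" "module k V'" "module k W'"
  shows "tensor_map k V' W' f' g' (tensor_map k V W f g t) =
    tensor_map k V' W' (\<lambda>x. f' (f x)) (\<lambda>x. g' (g x)) t"
proof -
  note [simp] = lin_comp[OF assms(2,4)] lin_comp[OF assms(3,5)]
  note [simp] = linear_mapD(1)[OF assms(2)] linear_mapD(1)[OF assms(3)]
  have "\<forall>t\<in>carrier (tensor k A B). tensor_map k V' W' f' g' (tensor_map k V W f g t) =
    tensor_map k V' W' (\<lambda>x. f' (f x)) (\<lambda>x. g' (g x)) t"
    by (rule tensor_eqI, (rule lin | use assms in simp)+)
  then show ?thesis using assms by simp
qed

lemma tensor_map_ident:
  assumes "t \<in> carrier (tensor k V W)" "module k V" "module k W"
    and "\<And>v. v \<in> carrier V \<Longrightarrow> f v = v" "\<And>w. w \<in> carrier W \<Longrightarrow> g w = w"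
  shows "tensor_map k V W f g t = t"
proof -
  have [simp]: "linear_map k V V f" "linear_map k W W g"
    using assms by (auto intro: linear_map_cong[OF lin_id])
  have "\<forall>t\<in>carrier (tensor k V W). tensor_map k V W f g t = t"
    by (rule tensor_eqI, (rule lin | use assms in simp)+)
  then show ?thesis using assms by simp
qed

section \<open>Reassociation\<close>

definition tensor_unassoc ::
    "'k ring \<Rightarrow> ('k, 'u, 'l) module_scheme \<Rightarrow> ('k, 'v, 'm) module_scheme
      \<Rightarrow> ('k, 'w, 'n) module_scheme \<Rightarrow> ('u, ('v, 'w) tens) tens \<Rightarrow> (('u, 'v) tens, 'w) tens" where
  "tensor_unassoc k U V W =
    tensor_lift (tensor k (tensor k U V) W) (\<lambda>u.
      tensor_lift (tensor k (tensor k U V) W) (\<lambda>v w.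
        simple_tensor k (tensor k U V) W (simple_tensor k U V u v) w))"

context
  fixes k :: "'k ring" and U :: "('k, 'u, 'l) module_scheme" and V :: "('k, 'v, 'm) module_scheme"
    and W :: "('k, 'w, 'n) module_scheme"
  assumes m [simp]: "module k U" "module k V" "module k W"
begin

lemma reassoc_inner_bilinear:
  "w \<in> carrier W \<Longrightarrow> bilinear k U V (tensor k U (tensor k V W))
    (\<lambda>u v. simple_tensor k U (tensor k V W) u (simple_tensor k V W v w))"
  by (rule bilinearI, (rule lin | simp)+)

lemma reassoc_bilinear:
  "bilinear k (tensor k U V) W (tensor k U (tensor k V W)) (\<lambda>s w. tensor_lift (tensor k U (tensor k V W))
    (\<lambda>u v. simple_tensor k U (tensor k V W) u (simple_tensor k V W v w)) s)"
proof (rule bilinearI)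
  fix s assume s: "s \<in> carrier (tensor k U V)"
  show "linear_map k W (tensor k U (tensor k V W)) (\<lambda>w. tensor_lift (tensor k U (tensor k V W))
    (\<lambda>u v. simple_tensor k U (tensor k V W) u (simple_tensor k V W v w)) s)"
    by (rule lin_lift_param[OF s], (rule lin reassoc_inner_bilinear | assumption | simp)+)
next
  fix w assume "w \<in> carrier W"
  then show "linear_map k (tensor k U V) (tensor k U (tensor k V W)) (\<lambda>s. tensor_lift (tensor k U (tensor k V W))
    (\<lambda>u v. simple_tensor k U (tensor k V W) u (simple_tensor k V W v w)) s)"
    by (intro lin_lift[OF lin_id]) (simp_all add: reassoc_inner_bilinear)
qed

lemma reassoc_simple [simp]:
  "u \<in> carrier U \<Longrightarrow> v \<in> carrier V \<Longrightarrow> w \<in> carrier W \<Longrightarrow>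
   tensor_reassoc k U V W (simple_tensor k (tensor k U V) W (simple_tensor k U V u v) w) =
    simple_tensor k U (tensor k V W) u (simple_tensor k V W v w)"
  unfolding tensor_reassoc_def
  by (simp add: tensor_lift_simple[OF _ _ _ reassoc_bilinear] tensor_lift_simple[OF _ _ _ reassoc_inner_bilinear])

lemma reassoc_linear:
  "linear_map k (tensor k (tensor k U V) W) (tensor k U (tensor k V W)) (tensor_reassoc k U V W)"
  unfolding tensor_reassoc_def by (rule tensor_lift_linear) (simp_all add: reassoc_bilinear)

lemma unassoc_inner_bilinear:
  "u \<in> carrier U \<Longrightarrow> bilinear k V W (tensor k (tensor k U V) W)
    (\<lambda>v w. simple_tensor k (tensor k U V) W (simple_tensor k U V u v) w)"
  by (rule bilinearI, (rule lin | simp)+)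

lemma unassoc_bilinear:
  "bilinear k U (tensor k V W) (tensor k (tensor k U V) W) (\<lambda>u. tensor_lift (tensor k (tensor k U V) W)
    (\<lambda>v w. simple_tensor k (tensor k U V) W (simple_tensor k U V u v) w))"
proof (rule bilinearI)
  fix s assume s: "s \<in> carrier (tensor k V W)"
  show "linear_map k U (tensor k (tensor k U V) W) (\<lambda>u. tensor_lift (tensor k (tensor k U V) W)
    (\<lambda>v w. simple_tensor k (tensor k U V) W (simple_tensor k U V u v) w) s)"
    by (rule lin_lift_param[OF s], (rule lin unassoc_inner_bilinear | assumption | simp)+)
next
  fix u assume "u \<in> carrier U"
  then show "linear_map k (tensor k V W) (tensor k (tensor k U V) W) (\<lambda>s. tensor_lift (tensor k (tensor k U V) W)
    (\<lambda>v w. simple_tensor k (tensor k U V) W (simple_tensor k U V u v) w) s)"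
    by (intro lin_lift[OF lin_id]) (simp_all add: unassoc_inner_bilinear)
qed

lemma unassoc_simple [simp]:
  "u \<in> carrier U \<Longrightarrow> v \<in> carrier V \<Longrightarrow> w \<in> carrier W \<Longrightarrow>
   tensor_unassoc k U V W (simple_tensor k U (tensor k V W) u (simple_tensor k V W v w)) =
     simple_tensor k (tensor k U V) W (simple_tensor k U V u v) w"
  unfolding tensor_unassoc_def
  by (simp add: tensor_lift_simple[OF _ _ _ unassoc_bilinear] tensor_lift_simple[OF _ _ _ unassoc_inner_bilinear])

lemma unassoc_linear:
  "linear_map k (tensor k U (tensor k V W)) (tensor k (tensor k U V) W) (tensor_unassoc k U V W)"
  unfolding tensor_unassoc_def by (rule tensor_lift_linear) (simp_all add: unassoc_bilinear)

end

lemma lin_reassoc [lin]: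
  "linear_map k X (tensor k (tensor k U V) W) g \<Longrightarrow> module k U \<Longrightarrow> module k V \<Longrightarrow> module k W \<Longrightarrow>
   linear_map k X (tensor k U (tensor k V W)) (\<lambda>x. tensor_reassoc k U V W (g x))"
  by (rule lin_comp[OF _ reassoc_linear])

lemma lin_unassoc [lin]:
  "linear_map k X (tensor k U (tensor k V W)) g \<Longrightarrow> module k U \<Longrightarrow> module k V \<Longrightarrow> module k W \<Longrightarrow>
   linear_map k X (tensor k (tensor k U V) W) (\<lambda>x. tensor_unassoc k U V W (g x))"
  by (rule lin_comp[OF _ unassoc_linear])

lemma reassoc_closed [simp]:
  "t \<in> carrier (tensor k (tensor k U V) W) \<Longrightarrow> module k U \<Longrightarrow> module k V \<Longrightarrow> module k W \<Longrightarrow>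
   tensor_reassoc k U V W t \<in> carrier (tensor k U (tensor k V W))"
  by (rule linear_mapD[OF reassoc_linear])

lemma ball_swap: "(\<forall>y\<in>B. \<forall>x\<in>A. P x y) \<Longrightarrow> \<forall>x\<in>A. \<forall>y\<in>B. P x y"
  by blast

lemma tensor3_left_eqI:
  assumes "linear_map k (tensor k (tensor k U V) W) M f" "linear_map k (tensor k (tensor k U V) W) M g"
    "module k U" "module k V" "module k W" "module k M"
    and "\<And>u v w. u \<in> carrier U \<Longrightarrow> v \<in> carrier V \<Longrightarrow> w \<in> carrier W \<Longrightarrow>
      f (simple_tensor k (tensor k U V) W (simple_tensor k U V u v) w) =
      g (simple_tensor k (tensor k U V) W (simple_tensor k U V u v) w)"
  shows "\<forall>t\<in>carrier (tensor k (tensor k U V) W). f t = g t"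
proof (rule tensor_eqI[OF assms(1,2)], use assms in simp_all, rule ball_swap, rule ballI)
  fix w assume w: "w \<in> carrier W"
  show "\<forall>s\<in>carrier (tensor k U V). f (simple_tensor k (tensor k U V) W s w) =
     g (simple_tensor k (tensor k U V) W s w)"
    by (rule tensor_eqI, (rule lin_comp[OF _ assms(1)] lin_comp[OF _ assms(2)] lin | use assms w in simp)+)
qed

lemma tensor3_eqI:
  assumes "linear_map k (tensor k U (tensor k V W)) M f" "linear_map k (tensor k U (tensor k V W)) M g"
    "module k U" "module k V" "module k W" "module k M"
    and "\<And>u v w. u \<in> carrier U \<Longrightarrow> v \<in> carrier V \<Longrightarrow> w \<in> carrier W \<Longrightarrow>
      f (simple_tensor k U (tensor k V W) u (simple_tensor k V W v w)) =
      g (simple_tensor k U (tensor k V W) u (simple_tensor k V W v w))"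
  shows "\<forall>t\<in>carrier (tensor k U (tensor k V W)). f t = g t"
proof (rule tensor_eqI[OF assms(1,2)], use assms in simp_all, rule ballI)
  fix u assume w: "u \<in> carrier U"
  show "\<forall>s\<in>carrier (tensor k V W). f (simple_tensor k U (tensor k V W) u s) =
     g (simple_tensor k U (tensor k V W) u s)"
    by (rule tensor_eqI, (rule lin_comp[OF _ assms(1)] lin_comp[OF _ assms(2)] lin | use assms w in simp)+)
qed

lemma unassoc_reassoc [simp]:
  assumes "t \<in> carrier (tensor k (tensor k U V) W)" "module k U" "module k V" "module k W"
  shows "tensor_unassoc k U V W (tensor_reassoc k U V W t) = t"
proof -
  have "\<forall>t\<in>carrier (tensor k (tensor k U V) W). tensor_unassoc k U V W (tensor_reassoc k U V W t) = t"
    by (rule tensor3_left_eqI, (rule lin | use assms in simp)+)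
  then show ?thesis using assms by simp
qed

lemma reassoc_unassoc [simp]:
  assumes "t \<in> carrier (tensor k U (tensor k V W))" "module k U" "module k V" "module k W"
  shows "tensor_reassoc k U V W (tensor_unassoc k U V W t) = t"
proof -
  have "\<forall>t\<in>carrier (tensor k U (tensor k V W)). tensor_reassoc k U V W (tensor_unassoc k U V W t) = t"
    by (rule tensor3_eqI, (rule lin | use assms in simp)+)
  then show ?thesis using assms by simp
qed

section \<open>Componentwise actions on tensor products\<close>

text \<open>
  If \<open>p\<close> is an action of \<open>A\<close> on \<open>V\<close> and \<open>q\<close> an action of \<open>B\<close> on \<open>W\<close>, this is the action of \<open>A \<otimes> B\<close> on
  \<open>V \<otimes> W\<close>.  With left multiplications for \<open>p\<close> and \<open>q\<close> it is the product of \<open>A \<otimes> B\<close>, so facts about the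
  algebra \<open>A \<otimes> B\<close> are special cases of facts about modules.
\<close>

definition tensor_act ::
    "'k ring \<Rightarrow> ('k, 'v, 'm) module_scheme \<Rightarrow> ('k, 'w, 'n) module_scheme
      \<Rightarrow> ('a \<Rightarrow> 'v \<Rightarrow> 'v) \<Rightarrow> ('b \<Rightarrow> 'w \<Rightarrow> 'w) \<Rightarrow> ('a, 'b) tens \<Rightarrow> ('v, 'w) tens \<Rightarrow> ('v, 'w) tens" where
  "tensor_act k V W p q s t = tensor_lift (tensor k V W) (\<lambda>a b. tensor_map k V W (p a) (q b) t) s"

lemma lin_bilinear_left: "linear_map k U A g \<Longrightarrow> bilinear k A V M p \<Longrightarrow> v \<in> carrier V \<Longrightarrow>
    linear_map k U M (\<lambda>x. p (g x) v)"
  by (rule lin_comp[OF _ bilinearD(2)])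

lemma lin_bilinear_right: "linear_map k U V g \<Longrightarrow> bilinear k A V M p \<Longrightarrow> a \<in> carrier A \<Longrightarrow>
    linear_map k U M (\<lambda>x. p a (g x))"
  by (rule lin_comp[OF _ bilinearD(1)])

context
  fixes k :: "'k ring"
    and A :: "('k, 'a, 'm1) module_scheme" and B :: "('k, 'b, 'm2) module_scheme"
    and V :: "('k, 'v, 'm3) module_scheme" and W :: "('k, 'w, 'm4) module_scheme"
    and p q
  assumes m [simp]: "module k A" "module k B" "module k V" "module k W"
    and p: "bilinear k A V V p" and q: "bilinear k B W W q"
begin

lemma tensor_act_bilinear_inner:
  assumes t: "t \<in> carrier (tensor k V W)"
  shows "bilinear k A B (tensor k V W) (\<lambda>a b. tensor_map k V W (p a) (q b) t)"
proof -
  note [lin] = lin_bilinear_left[OF _ p] lin_bilinear_left[OF _ q] lin_bilinear_right[OF _ p] lin_bilinear_right[OF _ q]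
  note [simp] = bilinearD(3)[OF p] bilinearD(3)[OF q]
  show ?thesis unfolding tensor_map_def
    by (rule bilinearI; rule lin_lift_param[OF t], (rule bilinearI | rule lin | assumption | simp)+)
qed

lemma tensor_act_bilinear:
  "bilinear k (tensor k A B) (tensor k V W) (tensor k V W) (tensor_act k V W p q)"
proof -
  note [lin] = bilinearD(1)[OF p] bilinearD(1)[OF q]
  show ?thesis
  unfolding tensor_act_def
  by (rule bilinearI, rule lin_lift_param, (rule lin tensor_act_bilinear_inner bilinearI| assumption | simp)+)
qed

lemma tensor_act_simple_left:
  assumes "a \<in> carrier A" "b \<in> carrier B" "t \<in> carrier (tensor k V W)"
  shows "tensor_act k V W p q (simple_tensor k A B a b) t = tensor_map k V W (p a) (q b) t"
  unfolding tensor_act_def using assms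
  by (simp add: tensor_lift_simple[OF _ _ _ tensor_act_bilinear_inner])

lemma tensor_act_simple:
  assumes "a \<in> carrier A" "b \<in> carrier B" "v \<in> carrier V" "w \<in> carrier W"
  shows "tensor_act k V W p q (simple_tensor k A B a b) (simple_tensor k V W v w) =
    simple_tensor k V W (p a v) (q b w)"
  using assms bilinearD(1)[OF p] bilinearD(1)[OF q] by (simp add: tensor_act_simple_left)

end

lemma tensor_act_closed [simp]:
  "s \<in> carrier (tensor k A B) \<Longrightarrow> t \<in> carrier (tensor k V W) \<Longrightarrow>
   bilinear k A V V p \<Longrightarrow> bilinear k B W W q \<Longrightarrow>
   module k A \<Longrightarrow> module k B \<Longrightarrow> module k V \<Longrightarrow> module k W \<Longrightarrow>
   tensor_act k V W p q s t \<in> carrier (tensor k V W)"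
  by (rule bilinearD(3)[OF tensor_act_bilinear])

lemma lin_tensor_act_left [lin]:
  "linear_map k U (tensor k A B) g \<Longrightarrow> t \<in> carrier (tensor k V W) \<Longrightarrow>
   bilinear k A V V p \<Longrightarrow> bilinear k B W W q \<Longrightarrow>
   module k A \<Longrightarrow> module k B \<Longrightarrow> module k V \<Longrightarrow> module k W \<Longrightarrow>
   linear_map k U (tensor k V W) (\<lambda>x. tensor_act k V W p q (g x) t)"
  by (rule lin_bilinear_left[OF _ tensor_act_bilinear])

text \<open>
  Four components occur in an equation between actions, and all of them can be taken pure at once.
\<close>

lemma bilinear_eqI:
  assumes "bilinear k (tensor k A B) (tensor k V W) M f" "bilinear k (tensor k A B) (tensor k V W) M g"
    "module k A" "module k B" "module k V" "module k W" "module k M"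
    and "\<And>a b v w. a \<in> carrier A \<Longrightarrow> b \<in> carrier B \<Longrightarrow> v \<in> carrier V \<Longrightarrow> w \<in> carrier W \<Longrightarrow>
      f (simple_tensor k A B a b) (simple_tensor k V W v w) = g (simple_tensor k A B a b) (simple_tensor k V W v w)"
    and "s \<in> carrier (tensor k A B)" "t \<in> carrier (tensor k V W)"
  shows "f s t = g s t"
proof -
  have 1: "\<forall>t\<in>carrier (tensor k V W). f (simple_tensor k A B a b) t = g (simple_tensor k A B a b) t"
    if "a \<in> carrier A" "b \<in> carrier B" for a b
    by (rule tensor_eqI) (use that assms bilinearD(1)[OF assms(1)] bilinearD(1)[OF assms(2)] in auto)
  have "\<forall>s\<in>carrier (tensor k A B). f s t = g s t"
    by (rule tensor_eqI) (use 1 assms bilinearD(2)[OF assms(1)] bilinearD(2)[OF assms(2)] in auto)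
  then show ?thesis using assms by blast
qed

lemma bilinear_comp_lin:
  assumes "bilinear k A' V' M f" "linear_map k A A' F" "linear_map k V V' G"
  shows "bilinear k A V M (\<lambda>s t. f (F s) (G t))"
  using assms linear_mapD(1)[OF assms(2)] linear_mapD(1)[OF assms(3)]
  by (intro bilinearI lin_bilinear_left[OF _ assms(1)] lin_bilinear_right[OF _ assms(1)])

lemma bilinear_lin_comp:
  assumes "bilinear k A V M f" "linear_map k M M' F"
  shows "bilinear k A V M' (\<lambda>s t. F (f s t))"
  using assms bilinearD(1,2)[OF assms(1)] by (intro bilinearI lin_comp[OF _ assms(2)])

text \<open>
  Naturality of the componentwise action in the modules and in the algebras.  Nearly every later
  identity between actions is an instance: equivariance of \<open>f \<otimes> g\<close> (with identities for \<open>F\<close>, \<open>G\<close>),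
  restriction along algebra maps (with identities for \<open>f\<close>, \<open>g\<close>), and multiplicativity of \<open>F \<otimes> G\<close>
  (with multiplications for all four actions).
\<close>

lemma tensor_map_act:
  assumes m [simp]: "module k A" "module k B" "module k V" "module k W"
      "module k A'" "module k B'" "module k V'" "module k W'"
    and p: "bilinear k A V V p" "bilinear k B W W q" "bilinear k A' V' V' p'" "bilinear k B' W' W' q'"
    and l [simp]: "linear_map k A A' F" "linear_map k B B' G" "linear_map k V V' f" "linear_map k W W' g"
    and f: "\<And>a v. a \<in> carrier A \<Longrightarrow> v \<in> carrier V \<Longrightarrow> f (p a v) = p' (F a) (f v)"
    and g: "\<And>b w. b \<in> carrier B \<Longrightarrow> w \<in> carrier W \<Longrightarrow> g (q b w) = q' (G b) (g w)"
    and s: "s \<in> carrier (tensor k A B)" "t \<in> carrier (tensor k V W)"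
  shows "tensor_map k V' W' f g (tensor_act k V W p q s t) =
    tensor_act k V' W' p' q' (tensor_map k A' B' F G s) (tensor_map k V' W' f g t)"
proof (rule bilinear_eqI[OF _ _ _ _ _ _ _ _ s])
  show "bilinear k (tensor k A B) (tensor k V W) (tensor k V' W')
     (\<lambda>s t. tensor_map k V' W' f g (tensor_act k V W p q s t))"
    by (rule bilinear_lin_comp[OF tensor_act_bilinear]) (simp_all add: p)
  show "bilinear k (tensor k A B) (tensor k V W) (tensor k V' W')
     (\<lambda>s t. tensor_act k V' W' p' q' (tensor_map k A' B' F G s) (tensor_map k V' W' f g t))"
    by (rule bilinear_comp_lin[OF tensor_act_bilinear[where A=A' and B=B']]) (simp_all add: p)
qed (simp_all add: tensor_act_simple[where A=A and B=B] tensor_act_simple[where A=A' and B=B']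
   p f g bilinearD(3)[OF p(1)] bilinearD(3)[OF p(2)]
   linear_mapD(1)[OF l(1)] linear_mapD(1)[OF l(2)] linear_mapD(1)[OF l(3)] linear_mapD(1)[OF l(4)])

lemma tensor_act_cong:
  assumes m [simp]: "module k A" "module k B" "module k V" "module k W"
    and p: "bilinear k A V V p" "bilinear k B W W q" "bilinear k A V V p'" "bilinear k B W W q'"
    and f: "\<And>a v. a \<in> carrier A \<Longrightarrow> v \<in> carrier V \<Longrightarrow> p a v = p' a v"
    and g: "\<And>b w. b \<in> carrier B \<Longrightarrow> w \<in> carrier W \<Longrightarrow> q b w = q' b w"
    and s: "s \<in> carrier (tensor k A B)" "t \<in> carrier (tensor k V W)"
  shows "tensor_act k V W p q s t = tensor_act k V W p' q' s t"
  by (rule bilinear_eqI[OF tensor_act_bilinear tensor_act_bilinear _ _ _ _ _ _ s])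
    (simp_all add: tensor_act_simple[where A=A and B=B] p f g)

text \<open>
  Rebracketing the algebra element and the module element together changes nothing, since on pure
  tensors both sides are \<open>p a u \<otimes> (q b v \<otimes> r c w)\<close>.
\<close>

lemma tensor_reassoc_act:
  assumes m [simp]: "module k A" "module k B" "module k C" "module k U" "module k V" "module k W"
    and p: "bilinear k A U U p" "bilinear k B V V q" "bilinear k C W W r"
    and s: "s \<in> carrier (tensor k (tensor k A B) C)" "t \<in> carrier (tensor k (tensor k U V) W)"
  shows "tensor_reassoc k U V W (tensor_act k (tensor k U V) W (tensor_act k U V p q) r s t) =
    tensor_act k U (tensor k V W) p (tensor_act k V W q r) (tensor_reassoc k A B C s) (tensor_reassoc k U V W t)"
proof -
  note [simp] = p bilinearD(3)[OF p(1)] bilinearD(3)[OF p(2)] bilinearD(3)[OF p(3)]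
  have [simp]: "bilinear k (tensor k A B) (tensor k U V) (tensor k U V) (tensor_act k U V p q)"
    "bilinear k (tensor k B C) (tensor k V W) (tensor k V W) (tensor_act k V W q r)"
    by (rule tensor_act_bilinear; simp)+
  note TS [simp] = tensor_act_simple[where A=A and B=B and V=U and W=V] tensor_act_simple[where A=B and B=C and V=V and W=W]
    tensor_act_simple[where A="tensor k A B" and B=C and V="tensor k U V" and W=W]
    tensor_act_simple[where A=A and B="tensor k B C" and V=U and W="tensor k V W"]
  let ?L = "\<lambda>s t. tensor_reassoc k U V W (tensor_act k (tensor k U V) W (tensor_act k U V p q) r s t)"
  let ?R = "\<lambda>s t. tensor_act k U (tensor k V W) p (tensor_act k V W q r) (tensor_reassoc k A B C s) (tensor_reassoc k U V W t)"
  have L: "bilinear k (tensor k (tensor k A B) C) (tensor k (tensor k U V) W) (tensor k U (tensor k V W)) ?L"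
    by (rule bilinear_lin_comp[OF tensor_act_bilinear reassoc_linear]; simp)
  have R: "bilinear k (tensor k (tensor k A B) C) (tensor k (tensor k U V) W) (tensor k U (tensor k V W)) ?R"
    by (rule bilinear_comp_lin[OF tensor_act_bilinear reassoc_linear reassoc_linear]; simp)
  have 1: "\<forall>t\<in>carrier (tensor k (tensor k U V) W). ?L s t = ?R s t"
    if "s = simple_tensor k (tensor k A B) C (simple_tensor k A B a b) c" "a \<in> carrier A" "b \<in> carrier B" "c \<in> carrier C"
    for s a b c
    by (rule tensor3_left_eqI[OF bilinearD(1)[OF L] bilinearD(1)[OF R]]) (simp_all add: that)
  have "\<forall>s\<in>carrier (tensor k (tensor k A B) C). ?L s t = ?R s t"
    by (rule tensor3_left_eqI[OF bilinearD(2)[OF L] bilinearD(2)[OF R]]) (use s 1 in simp_all)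
  then show ?thesis using s by blast
qed

section \<open>Tensor products of algebras\<close>

lemma mult_bilinear [simp]: "assoc_algebra k A \<Longrightarrow> bilinear k A A A (mult A)"
  by (rule bilinearI) (rule lin | assumption)+

lemma assoc_algebra_closed:
  "assoc_algebra (k :: 'k ring) A \<Longrightarrow> a \<in> carrier A \<Longrightarrow> b \<in> carrier A \<Longrightarrow> a \<otimes>\<^bsub>A\<^esub> b \<in> carrier A"
  using bilinearD(3)[OF mult_bilinear[of k A]] .

lemma (in two_modules) tensor_map_cls:
  assumes "module k V'" "module k W'" "linear_map k V V' f" "linear_map k W W' g" "l \<in> reps"
  shows "tensor_map k V' W' f g (cls l) = tensor_class k V' W' (map (\<lambda>(v, w). (f v, g w)) l)"
  using assms(5)
proof (induct l)
  case Nil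
  show ?case
    using linear_map_zero[OF module_tensor _ tensor_map_linear[OF V.module_axioms W.module_axioms assms(1-4)]] assms
    by (simp add: zero_cls) (simp add: tensor_def)
next
  case (Cons x l)
  interpret T': two_modules k V' W' using assms by (intro two_modulesI)
  obtain v w where x: "x = (v, w)" "v \<in> carrier V" "w \<in> carrier W" "l \<in> reps" using Cons by auto
  have *: "map (\<lambda>(v, w). (f v, g w)) l \<in> T'.reps"
    using x(4) linear_mapD(1)[OF assms(3)] linear_mapD(1)[OF assms(4)] by (auto simp: in_lists_conv_set)
  have "cls (x # l) = v \<boxtimes> w \<oplus>\<^bsub>T\<^esub> cls l" using x by (simp add: simple_tensor_def add_cls)
  then have "tensor_map k V' W' f g (cls (x # l)) =
      T'.simple (f v) (g w) \<oplus>\<^bsub>T'.T\<^esub> tensor_map k V' W' f g (cls l)"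
    using linear_mapD(2)[OF tensor_map_linear[OF V.module_axioms W.module_axioms assms(1-4)]] x assms
      V.module_axioms W.module_axioms by (simp add: cls_carrier simple_carrier)
  also have "\<dots> = T'.simple (f v) (g w) \<oplus>\<^bsub>T'.T\<^esub> T'.cls (map (\<lambda>(v, w). (f v, g w)) l)"
    using Cons.hyps x by simp
  also have "\<dots> = T'.cls (map (\<lambda>(v, w). (f v, g w)) (x # l))"
    using x * linear_mapD(1)[OF assms(3)] linear_mapD(1)[OF assms(4)] T'.add_cls[of "[(f v, g w)]"]
    by (simp add: simple_tensor_def)
  finally show ?case .
qed

locale two_algebras = two_modules k A B + A: assoc_algebra k A + B: assoc_algebra k B
  for k :: "'k ring" and A :: "('k, 'v, 'm) module_scheme" and B :: "('k, 'w, 'n) module_scheme"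
begin

lemma algebras [simp]: "assoc_algebra k A" "assoc_algebra k B" "module k A" "module k B" "module k T"
  by (rule A.assoc_algebra_axioms B.assoc_algebra_axioms V.module_axioms W.module_axioms module_tensor)+

abbreviation "prod_cls l m \<equiv> cls [(a \<otimes>\<^bsub>A\<^esub> c, b \<otimes>\<^bsub>B\<^esub> d). (a, b) \<leftarrow> l, (c, d) \<leftarrow> m]"

lemma product_bilinear: "bilinear k T T T (tensor_act k A B (mult A) (mult B))"
  by (rule tensor_act_bilinear) simp_all

lemma prod_lists:
  "l \<in> reps \<Longrightarrow> m \<in> reps \<Longrightarrow> [(a \<otimes>\<^bsub>A\<^esub> c, b \<otimes>\<^bsub>B\<^esub> d). (a, b) \<leftarrow> l, (c, d) \<leftarrow> m] \<in> reps"
  by (force simp: in_lists_conv_set dest!: bspec)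

lemma tensor_act_cls:
  assumes "l \<in> reps" "m \<in> reps"
  shows "tensor_act k A B (mult A) (mult B) (cls l) (cls m) = prod_cls l m"
  using assms(1)
proof (induct l)
  case Nil
  show ?case
    using linear_map_zero[OF _ _ bilinearD(2)[OF product_bilinear], of "cls m"] assms cls_carrier
    by (simp add: zero_cls)
next
  case (Cons x l)
  obtain a b where x: "x = (a, b)" "a \<in> carrier A" "b \<in> carrier B" "l \<in> reps" using Cons by auto
  have "cls (x # l) = simple_tensor k A B a b \<oplus>\<^bsub>T\<^esub> cls l" using x by (simp add: simple_tensor_def add_cls)
  then have "tensor_act k A B (mult A) (mult B) (cls (x # l)) (cls m) =
      tensor_act k A B (mult A) (mult B) (simple_tensor k A B a b) (cls m) \<oplus>\<^bsub>T\<^esub> tensor_act k A B (mult A) (mult B) (cls l) (cls m)"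
    using bilinearD(4)[OF product_bilinear] x assms by (simp add: cls_carrier simple_carrier)
  also have "tensor_act k A B (mult A) (mult B) (simple_tensor k A B a b) (cls m) = cls (map (\<lambda>(c, d). (a \<otimes>\<^bsub>A\<^esub> c, b \<otimes>\<^bsub>B\<^esub> d)) m)"
    using x assms by (simp add: tensor_act_simple_left cls_carrier tensor_map_cls bilinearD(1)[OF mult_bilinear])
  also have "\<dots> \<oplus>\<^bsub>T\<^esub> tensor_act k A B (mult A) (mult B) (cls l) (cls m) = prod_cls (x # l) m"
    using x assms prod_lists[OF x(4) assms(2)] prod_lists[of "[(a, b)]" m] Cons.hyps by (simp add: add_cls)
  finally show ?case .
qed

text \<open>
  The product in \<open>tensor\<close> is a union over representatives.  Each of its members is the class computed
  by the componentwise action, which depends on the classes alone.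
\<close>

lemma tensor_mult:
  assumes "s \<in> carrier T" "t \<in> carrier T"
  shows "s \<otimes>\<^bsub>T\<^esub> t = tensor_act k A B (mult A) (mult B) s t"
proof -
  obtain l m where lm: "l \<in> reps" "m \<in> reps" "s = cls l" "t = cls m" using assms by (auto elim!: carrierE)
  have "prod_cls l' m' = tensor_act k A B (mult A) (mult B) s t" if "l' \<in> s" "m' \<in> t" for l' m'
  proof -
    have e: "tensor_eq k A B l l'" "tensor_eq k A B m m'" using that lm by (simp_all add: tensor_class_def)
    then have "l' \<in> reps" "m' \<in> reps" using tensor_eq_lists by blast+
    then show ?thesis using tensor_act_cls[of l' m'] cls_eqI[OF e(1)] cls_eqI[OF e(2)] lm by simp
  qed
  moreover have "s \<noteq> {}" "t \<noteq> {}" using mem_cls lm by blast+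
  ultimately have "(\<Union>l\<in>s. \<Union>m\<in>t. prod_cls l m) = tensor_act k A B (mult A) (mult B) s t"
    by simp
  then show ?thesis by (simp add: tensor_def)
qed

lemma tensor_mult_simple:
  assumes "a \<in> carrier A" "b \<in> carrier B" "c \<in> carrier A" "d \<in> carrier B"
  shows "(simple_tensor k A B a b) \<otimes>\<^bsub>T\<^esub> (simple_tensor k A B c d) = simple_tensor k A B (a \<otimes>\<^bsub>A\<^esub> c) (b \<otimes>\<^bsub>B\<^esub> d)"
  using assms by (simp add: tensor_mult simple_carrier tensor_act_simple[where A=A and B=B])

lemma tensor_mult_bilinear: "bilinear k T T T (mult T)"
proof (rule bilinearI)
  fix t assume "t \<in> carrier T"
  then show "linear_map k T T (\<lambda>s. t \<otimes>\<^bsub>T\<^esub> s)" "linear_map k T T (\<lambda>s. s \<otimes>\<^bsub>T\<^esub> t)"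
    using bilinearD(1,2)[OF product_bilinear, of t] by (auto intro!: linear_map_cong[OF _ tensor_mult[symmetric]])
qed

text \<open>
  Associativity of the action, reduced to associativity of \<open>p\<close> and \<open>q\<close> on pure tensors, one variable
  after the other.  For the regular actions this is associativity of \<open>A \<otimes> B\<close>.
\<close>

lemma tensor_act_mult:
  assumes [simp]: "module k V" "module k W" and p: "bilinear k A V V p" "bilinear k B W W q"
    and f: "\<And>a b v. a \<in> carrier A \<Longrightarrow> b \<in> carrier A \<Longrightarrow> v \<in> carrier V \<Longrightarrow> p (a \<otimes>\<^bsub>A\<^esub> b) v = p a (p b v)"
    and g: "\<And>a b v. a \<in> carrier B \<Longrightarrow> b \<in> carrier B \<Longrightarrow> v \<in> carrier W \<Longrightarrow> q (a \<otimes>\<^bsub>B\<^esub> b) v = q a (q b v)"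
    and s: "s \<in> carrier T" "s' \<in> carrier T" "t \<in> carrier (tensor k V W)"
  shows "tensor_act k V W p q (s \<otimes>\<^bsub>T\<^esub> s') t = tensor_act k V W p q s (tensor_act k V W p q s' t)"
proof -
  note [simp] = bilinearD(3)[OF p(1)] bilinearD(3)[OF p(2)] assoc_algebra_closed
  have P [simp]: "bilinear k T (tensor k V W) (tensor k V W) (tensor_act k V W p q)"
    by (rule tensor_act_bilinear; simp add: p)
  note [simp] = bilinearD(3)[OF P] bilinearD(3)[OF tensor_mult_bilinear]
  note [lin] = lin_bilinear_left[OF _ P] lin_bilinear_right[OF _ P]
    lin_bilinear_left[OF _ tensor_mult_bilinear] lin_bilinear_right[OF _ tensor_mult_bilinear]
  have 1: "\<forall>t\<in>carrier (tensor k V W). 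
     tensor_act k V W p q (simple_tensor k A B a b \<otimes>\<^bsub>T\<^esub> simple_tensor k A B c d) t =
     tensor_act k V W p q (simple_tensor k A B a b) (tensor_act k V W p q (simple_tensor k A B c d) t)"
    if [simp]: "a \<in> carrier A" "b \<in> carrier B" "c \<in> carrier A" "d \<in> carrier B" for a b c d
    by (rule tensor_eqI, (rule lin | simp add: tensor_mult_simple tensor_act_simple[where A=A and B=B] p f g)+)
  have 2: "\<forall>s'\<in>carrier T. 
     tensor_act k V W p q (simple_tensor k A B a b \<otimes>\<^bsub>T\<^esub> s') t =
     tensor_act k V W p q (simple_tensor k A B a b) (tensor_act k V W p q s' t)"
    if [simp]: "a \<in> carrier A" "b \<in> carrier B" for a b
    by (rule tensor_eqI, (rule lin | simp add: s 1)+)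
  have "\<forall>s\<in>carrier T. 
     tensor_act k V W p q (s \<otimes>\<^bsub>T\<^esub> s') t = tensor_act k V W p q s (tensor_act k V W p q s' t)"
    by (rule tensor_eqI, (rule lin | simp add: s 2)+)
  then show ?thesis using s by blast
qed

lemma tensor_act_one:
  assumes [simp]: "module k V" "module k W" and p: "bilinear k A V V p" "bilinear k B W W q"
    and f: "\<And>v. v \<in> carrier V \<Longrightarrow> p \<one>\<^bsub>A\<^esub> v = v"
    and g: "\<And>v. v \<in> carrier W \<Longrightarrow> q \<one>\<^bsub>B\<^esub> v = v"
    and s: "t \<in> carrier (tensor k V W)"
  shows "tensor_act k V W p q \<one>\<^bsub>T\<^esub> t = t"
proof -
  have "\<one>\<^bsub>T\<^esub> = simple_tensor k A B \<one>\<^bsub>A\<^esub> \<one>\<^bsub>B\<^esub>" by (simp add: tensor_def)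
  then show ?thesis using s
    by (simp add: tensor_act_simple_left[OF _ _ _ _ p] tensor_map_ident f g)
qed

lemma tensor_one: "\<one>\<^bsub>T\<^esub> = simple_tensor k A B \<one>\<^bsub>A\<^esub> \<one>\<^bsub>B\<^esub>" by (simp add: tensor_def)

lemma tensor_one_closed: "\<one>\<^bsub>T\<^esub> \<in> carrier T"
  by (simp add: tensor_one simple_carrier)

lemma tensor_ring: "ring T"
proof (rule ringI)
  show "abelian_group T" by (rule abelian_group_tensor)
  note D = bilinearD[OF tensor_mult_bilinear]
  show "Group.monoid T"
  proof (rule monoidI)
    show "s \<otimes>\<^bsub>T\<^esub> t \<in> carrier T" if "s \<in> carrier T" "t \<in> carrier T" for s t using D that by blast
    show "\<one>\<^bsub>T\<^esub> \<in> carrier T" by (rule tensor_one_closed)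
    show "(x \<otimes>\<^bsub>T\<^esub> y) \<otimes>\<^bsub>T\<^esub> z = x \<otimes>\<^bsub>T\<^esub> (y \<otimes>\<^bsub>T\<^esub> z)" if "x \<in> carrier T" "y \<in> carrier T" "z \<in> carrier T" for x y z
      using tensor_act_mult[of A B "mult A" "mult B" x y z] that D(3)
      by (simp add: A.m_assoc B.m_assoc tensor_mult)
    show "\<one>\<^bsub>T\<^esub> \<otimes>\<^bsub>T\<^esub> x = x" if "x \<in> carrier T" for x
      using that by (simp add: tensor_mult tensor_act_one tensor_one_closed)
    have "\<forall>x\<in>carrier T. x \<otimes>\<^bsub>T\<^esub> \<one>\<^bsub>T\<^esub> = x"
      by (rule tensor_eqI, (rule lin_bilinear_left[OF _ tensor_mult_bilinear] lin
          | simp add: tensor_one_closed | simp add: tensor_one tensor_mult_simple)+)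
    then show "x \<otimes>\<^bsub>T\<^esub> \<one>\<^bsub>T\<^esub> = x" if "x \<in> carrier T" for x using that by blast
  qed
  show "(x \<oplus>\<^bsub>T\<^esub> y) \<otimes>\<^bsub>T\<^esub> z = x \<otimes>\<^bsub>T\<^esub> z \<oplus>\<^bsub>T\<^esub> y \<otimes>\<^bsub>T\<^esub> z"
     "z \<otimes>\<^bsub>T\<^esub> (x \<oplus>\<^bsub>T\<^esub> y) = z \<otimes>\<^bsub>T\<^esub> x \<oplus>\<^bsub>T\<^esub> z \<otimes>\<^bsub>T\<^esub> y"
    if "x \<in> carrier T" "y \<in> carrier T" "z \<in> carrier T" for x y z
    using D that by simp_all
qed

lemma tensor_assoc_algebra: "assoc_algebra k T"
  using bilinearD(6,7)[OF tensor_mult_bilinear]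
  by (intro assoc_algebra.intro assoc_algebra_axioms.intro module_tensor tensor_ring) simp_all

end

lemma two_algebrasI: "assoc_algebra k A \<Longrightarrow> assoc_algebra k B \<Longrightarrow> two_algebras k A B"
  by (intro two_algebras.intro two_modulesI) simp_all

lemmas tensor_algebra [simp] = two_algebras.tensor_assoc_algebra[OF two_algebrasI]
lemmas tensor_mult_simple [simp] = two_algebras.tensor_mult_simple[OF two_algebrasI]
lemmas tensor_mult_act = two_algebras.tensor_mult[OF two_algebrasI]
lemmas tensor_act_mult = two_algebras.tensor_act_mult[OF two_algebrasI]
lemmas tensor_act_one = two_algebras.tensor_act_one[OF two_algebrasI]

lemma tensor_one [simp]: "\<one>\<^bsub>tensor k A B\<^esub> = simple_tensor k A B \<one>\<^bsub>A\<^esub> \<one>\<^bsub>B\<^esub>"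
  by (simp add: tensor_def)

section \<open>Algebra maps and actions\<close>

definition multiplicative :: "('a, 'm) ring_scheme \<Rightarrow> ('b, 'n) ring_scheme \<Rightarrow> ('a \<Rightarrow> 'b) \<Rightarrow> bool" where
  "multiplicative A B f \<longleftrightarrow> (\<forall>x\<in>carrier A. \<forall>y\<in>carrier A. f (x \<otimes>\<^bsub>A\<^esub> y) = f x \<otimes>\<^bsub>B\<^esub> f y)"

lemma multiplicativeD:
  "multiplicative A B f \<Longrightarrow> x \<in> carrier A \<Longrightarrow> y \<in> carrier A \<Longrightarrow> f (x \<otimes>\<^bsub>A\<^esub> y) = f x \<otimes>\<^bsub>B\<^esub> f y"
  by (simp add: multiplicative_def)

lemma algebra_homD:
  assumes "algebra_hom k A B f"
  shows "linear_map k A B f" "multiplicative A B f" "f \<one>\<^bsub>A\<^esub> = \<one>\<^bsub>B\<^esub>"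
  using assms by (auto simp: algebra_hom_def multiplicative_def ring_hom_def)

lemma algebra_homI:
  "linear_map k A B f \<Longrightarrow> multiplicative A B f \<Longrightarrow> f \<one>\<^bsub>A\<^esub> = \<one>\<^bsub>B\<^esub> \<Longrightarrow> algebra_hom k A B f"
  by (auto simp: algebra_hom_def multiplicative_def ring_hom_def linear_map_def)

lemma algebra_hom_id [simp]: "algebra_hom k A A id" "algebra_hom k A A (\<lambda>x. x)"
  by (auto intro!: algebra_homI simp: lin_id multiplicative_def)

lemma algebra_hom_comp:
  assumes "algebra_hom k A B f" "algebra_hom k B C g"
  shows "algebra_hom k A C (\<lambda>x. g (f x))"
  using algebra_homD[OF assms(1)] algebra_homD[OF assms(2)] linear_mapD(1)[OF algebra_homD(1)[OF assms(1)]]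
  by (auto intro!: algebra_homI intro: lin_comp simp: multiplicative_def)

lemma assoc_algebra_one_closed: "assoc_algebra (k :: 'k ring) A \<Longrightarrow> \<one>\<^bsub>A\<^esub> \<in> carrier A"
  by (simp add: assoc_algebra_def ring.ring_simprules(6))

lemma tensor_map_algebra_hom [simp]:
  assumes [simp]: "assoc_algebra k A" "assoc_algebra k B" "assoc_algebra k A'" "assoc_algebra k B'"
    and F: "algebra_hom k A A' F" and G: "algebra_hom k B B' G"
  shows "algebra_hom k (tensor k A B) (tensor k A' B') (tensor_map k A' B' F G)"
proof (rule algebra_homI)
  note [simp] = algebra_homD(1)[OF F] algebra_homD(1)[OF G]
  show "linear_map k (tensor k A B) (tensor k A' B') (tensor_map k A' B' F G)" by simp
  show "multiplicative (tensor k A B) (tensor k A' B') (tensor_map k A' B' F G)"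
    unfolding multiplicative_def
  proof (intro ballI)
    fix x y assume [simp]: "x \<in> carrier (tensor k A B)" "y \<in> carrier (tensor k A B)"
    have c [simp]: "tensor_map k A' B' F G z \<in> carrier (tensor k A' B')" if "z \<in> carrier (tensor k A B)" for z
      by (rule tensor_map_closed[OF that]) simp_all
    show "tensor_map k A' B' F G (x \<otimes>\<^bsub>tensor k A B\<^esub> y) =
      tensor_map k A' B' F G x \<otimes>\<^bsub>tensor k A' B'\<^esub> tensor_map k A' B' F G y"
      unfolding tensor_mult_act[OF \<open>assoc_algebra k A\<close> \<open>assoc_algebra k B\<close> \<open>x \<in> _\<close> \<open>y \<in> _\<close>]
        tensor_mult_act[OF \<open>assoc_algebra k A'\<close> \<open>assoc_algebra k B'\<close> c[OF \<open>x \<in> _\<close>] c[OF \<open>y \<in> _\<close>]]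
      by (rule tensor_map_act[where A=A and B=B and A'=A' and B'=B']) (simp_all add: multiplicativeD[OF algebra_homD(2)[OF F]] multiplicativeD[OF algebra_homD(2)[OF G]])
  qed
  show "tensor_map k A' B' F G \<one>\<^bsub>tensor k A B\<^esub> = \<one>\<^bsub>tensor k A' B'\<^esub>"
    using algebra_homD(3)[OF F] algebra_homD(3)[OF G] by (simp add: assoc_algebra_one_closed[of k])
qed

lemma reassoc_algebra_hom [simp]:
  assumes [simp]: "assoc_algebra k A" "assoc_algebra k B" "assoc_algebra k C"
  shows "algebra_hom k (tensor k (tensor k A B) C) (tensor k A (tensor k B C)) (tensor_reassoc k A B C)"
proof (rule algebra_homI)
  show "linear_map k (tensor k (tensor k A B) C) (tensor k A (tensor k B C)) (tensor_reassoc k A B C)"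
    by (rule reassoc_linear) simp_all
  have b: "bilinear k (tensor k A B) (tensor k A B) (tensor k A B) (tensor_act k A B (mult A) (mult B))"
     "bilinear k (tensor k B C) (tensor k B C) (tensor k B C) (tensor_act k B C (mult B) (mult C))"
    by (rule tensor_act_bilinear; simp)+
  show "multiplicative (tensor k (tensor k A B) C) (tensor k A (tensor k B C)) (tensor_reassoc k A B C)"
    unfolding multiplicative_def
  proof (intro ballI)
    fix x y assume [simp]: "x \<in> carrier (tensor k (tensor k A B) C)" "y \<in> carrier (tensor k (tensor k A B) C)"
    have "x \<otimes>\<^bsub>tensor k (tensor k A B) C\<^esub> y = tensor_act k (tensor k A B) C (mult (tensor k A B)) (mult C) x y"
      by (rule tensor_mult_act) simp_all
    also have "\<dots> = tensor_act k (tensor k A B) C (tensor_act k A B (mult A) (mult B)) (mult C) x y"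
      by (rule tensor_act_cong[where A="tensor k A B" and B=C]) (simp_all add: b tensor_mult_act)
    also have "tensor_reassoc k A B C \<dots> = tensor_act k A (tensor k B C) (mult A) (tensor_act k B C (mult B) (mult C))
       (tensor_reassoc k A B C x) (tensor_reassoc k A B C y)"
      by (rule tensor_reassoc_act) simp_all
    also have "\<dots> = tensor_act k A (tensor k B C) (mult A) (mult (tensor k B C))
       (tensor_reassoc k A B C x) (tensor_reassoc k A B C y)"
      by (rule tensor_act_cong[where A=A and B="tensor k B C"]) (simp_all add: b tensor_mult_act)
    also have "\<dots> = tensor_reassoc k A B C x \<otimes>\<^bsub>tensor k A (tensor k B C)\<^esub> tensor_reassoc k A B C y"
      by (rule tensor_mult_act[symmetric]) simp_all
    finally show "tensor_reassoc k A B C (x \<otimes>\<^bsub>tensor k (tensor k A B) C\<^esub> y) =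
      tensor_reassoc k A B C x \<otimes>\<^bsub>tensor k A (tensor k B C)\<^esub> tensor_reassoc k A B C y" .
  qed
qed (simp add: assoc_algebra_one_closed[of k])

text \<open>
  Actions are separated from the record of a module, because the same underlying \<open>k\<close>-module is acted on
  by \<open>H\<close>, by tensor powers of \<open>H\<close> and through algebra maps between them.
\<close>

definition is_action ::
    "'k ring \<Rightarrow> ('k, 'a, 'm) module_scheme \<Rightarrow> ('k, 'v, 'n) module_scheme \<Rightarrow> ('a \<Rightarrow> 'v \<Rightarrow> 'v) \<Rightarrow> bool" where
  "is_action k A V p \<longleftrightarrow> bilinear k A V V p \<and> (\<forall>v\<in>carrier V. p \<one>\<^bsub>A\<^esub> v = v) \<and>
     (\<forall>a\<in>carrier A. \<forall>b\<in>carrier A. \<forall>v\<in>carrier V. p (a \<otimes>\<^bsub>A\<^esub> b) v = p a (p b v))"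

lemma is_actionD:
  assumes "is_action k A V p"
  shows "bilinear k A V V p" "v \<in> carrier V \<Longrightarrow> p \<one>\<^bsub>A\<^esub> v = v"
    "a \<in> carrier A \<Longrightarrow> b \<in> carrier A \<Longrightarrow> v \<in> carrier V \<Longrightarrow> p (a \<otimes>\<^bsub>A\<^esub> b) v = p a (p b v)"
  using assms by (auto simp: is_action_def)

lemma is_action_bilinear [simp]: "is_action k A V p \<Longrightarrow> bilinear k A V V p"
  by (simp add: is_action_def)

lemma is_action_tensor [simp]:
  assumes [simp]: "assoc_algebra k A" "assoc_algebra k B" "module k V" "module k W"
    and p: "is_action k A V p" "is_action k B W q"
  shows "is_action k (tensor k A B) (tensor k V W) (tensor_act k V W p q)"
  unfolding is_action_def
proof (intro conjI ballI)
  note [simp] = p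
  show "bilinear k (tensor k A B) (tensor k V W) (tensor k V W) (tensor_act k V W p q)"
    by (rule tensor_act_bilinear) simp_all
  show "tensor_act k V W p q \<one>\<^bsub>tensor k A B\<^esub> v = v" if "v \<in> carrier (tensor k V W)" for v
    by (rule tensor_act_one) (simp_all add: that is_actionD(2)[OF p(1)] is_actionD(2)[OF p(2)])
  show "tensor_act k V W p q (a \<otimes>\<^bsub>tensor k A B\<^esub> b) v = tensor_act k V W p q a (tensor_act k V W p q b v)"
    if "a \<in> carrier (tensor k A B)" "b \<in> carrier (tensor k A B)" "v \<in> carrier (tensor k V W)" for a b v
    by (rule tensor_act_mult) (simp_all add: that is_actionD(3)[OF p(1)] is_actionD(3)[OF p(2)])
qed

lemma is_action_pullback:
  assumes p: "is_action k A V p" and F: "algebra_hom k B A F" 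
  shows "is_action k B V (\<lambda>b. p (F b))"
  using bilinear_comp_lin[OF is_actionD(1)[OF p] algebra_homD(1)[OF F] lin_id]
    is_actionD(2,3)[OF p] linear_mapD(1)[OF algebra_homD(1)[OF F]]
    algebra_homD(3)[OF F] multiplicativeD[OF algebra_homD(2)[OF F]]
  unfolding is_action_def by simp

lemma left_module_iff: "left_module (k :: 'k ring) A V \<longleftrightarrow> module k V \<and> is_action k A V (act V)"
  by (auto simp: left_module_def left_module_axioms_def is_action_def bilinear_def linear_map_def)

lemma tensor_lift_cong:
  assumes "bilinear k A B M f" "t \<in> carrier (tensor k A B)" "module k A" "module k B" "module k M"
    and eq: "\<And>a b. a \<in> carrier A \<Longrightarrow> b \<in> carrier B \<Longrightarrow> f a b = g a b"
  shows "tensor_lift M f t = tensor_lift M g t"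
proof -
  have g: "bilinear k A B M g"
    by (intro bilinearI)
      (auto intro: linear_map_cong[OF bilinearD(1)[OF assms(1)]] linear_map_cong[OF bilinearD(2)[OF assms(1)]]
        simp: eq assms(3,4))
  have "\<forall>t\<in>carrier (tensor k A B). tensor_lift M f t = tensor_lift M g t"
    by (rule tensor_eqI) (use g assms in \<open>simp_all add: tensor_lift_linear tensor_lift_simple\<close>)
  then show ?thesis using assms by blast
qed

text \<open>
  The associator is defined by a Sweedler sum over the three components of \<open>\<phi>\<close>.  That sum is the nested
  componentwise action of \<open>\<phi>\<close>, since \<open>(q b) \<otimes> (r c)\<close> is the action of the pure tensor \<open>b \<otimes> c\<close>.
\<close>

lemma iterated_lift_act:
  assumes [simp]: "module k A" "module k B" "module k C" "module k V" "module k W" "module k X"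
    and p [simp]: "bilinear k A V V p" "bilinear k B W W q" "bilinear k C X X r"
    and s: "s \<in> carrier (tensor k A (tensor k B C))" and u: "u \<in> carrier (tensor k V (tensor k W X))"
  shows "tensor_lift (tensor k V (tensor k W X)) (\<lambda>a. tensor_lift (tensor k V (tensor k W X)) (\<lambda>b c.
      tensor_map k V (tensor k W X) (p a) (tensor_map k W X (q b) (r c)) u)) s =
    tensor_act k V (tensor k W X) p (tensor_act k W X q r) s u" (is "tensor_lift ?P _ _ = _")
proof -
  let ?f = "\<lambda>a b c. tensor_map k V (tensor k W X) (p a) (tensor_map k W X (q b) (r c)) u"
  note [simp] = bilinearD(1)[OF p(1)] bilinearD(1)[OF p(2)] bilinearD(1)[OF p(3)]
    bilinearD(3)[OF p(1)] bilinearD(3)[OF p(2)] bilinearD(3)[OF p(3)]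
  have qr [simp]: "bilinear k (tensor k B C) (tensor k W X) (tensor k W X) (tensor_act k W X q r)"
    by (rule tensor_act_bilinear) simp_all
  have bi: "bilinear k B C ?P (?f a)"
    if [simp]: "a \<in> carrier A" for a
  proof -
    note [lin] = lin_bilinear_left[OF _ p(1)] lin_bilinear_left[OF _ p(2)] lin_bilinear_left[OF _ p(3)]
      lin_bilinear_right[OF _ p(1)] lin_bilinear_right[OF _ p(2)] lin_bilinear_right[OF _ p(3)]
    have *: "linear_map k B (tensor k W X) (\<lambda>b. tensor_map k W X (q b) (r c) t)"
      if "c \<in> carrier C" "t \<in> carrier (tensor k W X)" for c t
      using bilinearD(2)[OF tensor_act_bilinear_inner[where A=B and B=C and p=q and q=r], of k W X t c] that by simp
    have **: "linear_map k C (tensor k W X) (\<lambda>c. tensor_map k W X (q b) (r c) t)"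
      if "b \<in> carrier B" "t \<in> carrier (tensor k W X)" for b t
      using bilinearD(1)[OF tensor_act_bilinear_inner[where A=B and B=C and p=q and q=r], of k W X t b] that by simp
    have [simp]: "linear_map k (tensor k W X) (tensor k W X) (tensor_map k W X (q b) (r c))" 
      if "b \<in> carrier B" "c \<in> carrier C" for b c using that by simp
    have [simp]: "tensor_map k W X (q b) (r c) t \<in> carrier (tensor k W X)" 
      if "b \<in> carrier B" "c \<in> carrier C" "t \<in> carrier (tensor k W X)" for b c t
      by (rule tensor_map_closed[OF that(3)]) (use that in simp_all)
    show ?thesis
    proof (rule bilinearI)
      fix b assume [simp]: "b \<in> carrier B"
      show "linear_map k C ?P (\<lambda>c. tensor_map k V (tensor k W X) (p a) (tensor_map k W X (q b) (r c)) u)"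
        unfolding tensor_map_def[of k V "tensor k W X"]
        by (rule lin_lift_param[OF u], (rule lin_simple_right ** bilinearI | rule lin | assumption | simp)+)
    next
      fix b assume [simp]: "b \<in> carrier C"
      show "linear_map k B ?P (\<lambda>c. tensor_map k V (tensor k W X) (p a) (tensor_map k W X (q c) (r b)) u)"
        unfolding tensor_map_def[of k V "tensor k W X"]
        by (rule lin_lift_param[OF u], (rule lin_simple_right * bilinearI | rule lin | assumption | simp)+)
    qed
  qed
  have in_eq: "\<forall>s\<in>carrier (tensor k B C). tensor_map k V (tensor k W X) (p a) (tensor_act k W X q r s) u =
     tensor_lift ?P (?f a) s"
    if [simp]: "a \<in> carrier A" for a
  proof (rule tensor_eqI)
    show "linear_map k (tensor k B C) ?P (\<lambda>s. tensor_map k V (tensor k W X) (p a) (tensor_act k W X q r s) u)"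
      by (rule bilinearD(1)[OF tensor_act_bilinear_inner[where A=A and B="tensor k B C" and q="tensor_act k W X q r"]])
        (simp_all add: u)
    show "linear_map k (tensor k B C) ?P (tensor_lift ?P (?f a))"
      by (rule tensor_lift_linear) (simp_all add: bi)
    show "\<forall>v\<in>carrier B. \<forall>w\<in>carrier C. tensor_map k V (tensor k W X) (p a) (tensor_act k W X q r (simple_tensor k B C v w)) u =
       tensor_lift ?P (?f a) (simple_tensor k B C v w)"
    proof (intro ballI)
      fix v w assume [simp]: "v \<in> carrier B" "w \<in> carrier C"
      have "tensor_map k V (tensor k W X) (p a) (tensor_act k W X q r (simple_tensor k B C v w)) u =
         tensor_map k V (tensor k W X) (p a) (tensor_map k W X (q v) (r w)) u"
        by (rule tensor_map_cong[OF u]) (simp_all add: tensor_act_simple_left[where A=B and B=C] bilinearD(1)[OF qr])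
      then show "tensor_map k V (tensor k W X) (p a) (tensor_act k W X q r (simple_tensor k B C v w)) u =
         tensor_lift ?P (?f a) (simple_tensor k B C v w)"
        by (simp add: tensor_lift_simple[OF _ _ _ bi])
    qed
  qed simp_all
  show ?thesis
    unfolding tensor_act_def[of k V "tensor k W X"]
    by (rule tensor_lift_cong[symmetric, OF _ s])
      (simp_all add: in_eq tensor_act_bilinear_inner[where A=A and B="tensor k B C"] u)
qed

section \<open>Modules with additional structure\<close>

lemma extend_sel [simp]:
  "carrier (module.extend M r) = carrier M" "mult (module.extend M r) = mult M"
  "one (module.extend M r) = one M" "zero (module.extend M r) = zero M"
  "add (module.extend M r) = add M" "smult (module.extend M r) = smult M"
  by (simp_all add: module.defs)

lemma act_extend [simp]: "act (module.extend M (lmod.fields p)) = p"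
  by (simp add: module.defs lmod.defs)

text \<open>
  Neither the multiplication nor additional record fields enter \<open>tensor_eq\<close>.  This makes it possible to
  replace an \<open>H\<close>-module by its underlying \<open>k\<close>-module inside tensor products, which the equations
  up to \<open>module_extend\<close> do.
\<close>

lemma tensor_eq_transfer:
  assumes "tensor_eq k V W l m"
    and "carrier V = carrier V'" "add V = add V'" "zero V = zero V'" "smult V = smult V'"
    and "carrier W = carrier W'" "add W = add W'" "zero W = zero W'" "smult W = smult W'"
  shows "tensor_eq k V' W' l m"
  using assms(1)
proof induct
  case (sym l l')
  then show ?case by (rule_tac tensor_eq.sym)
next
  case (trans l l' l'')
  then show ?case by (metis tensor_eq.trans)
next
  case (append l l' m m')
  then show ?case by (intro tensor_eq.append)
next
  case (add_left v v' w)
  then show ?case using tensor_eq.add_left[of v V' v' w W'] assms(2-) by simp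
next
  case (add_right v w w')
  then show ?case using tensor_eq.add_right[of v V' w W' w'] assms(2-) by simp
next
  case (balance c v w)
  then show ?case using tensor_eq.balance[of c k v V' w W'] assms(2-) by simp
next
  case (zero w)
  then show ?case using tensor_eq.zero[of w W' k V'] assms(2-) by simp
qed (use assms(2-) in \<open>auto intro: tensor_eq.refl tensor_eq.swap\<close>)

lemma tensor_eq_cong:
  assumes "carrier V = carrier V'" "add V = add V'" "zero V = zero V'" "smult V = smult V'"
    and "carrier W = carrier W'" "add W = add W'" "zero W = zero W'" "smult W = smult W'"
  shows "tensor_eq k V W = tensor_eq k V' W'"
  using tensor_eq_transfer[of k V W _ _ V' W'] tensor_eq_transfer[of k V' W' _ _ V W] assms
  by (intro ext iffI) auto

lemma tensor_eq_extend [simp]: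
  "tensor_eq k (module.extend M r) W = tensor_eq k M W"
  "tensor_eq k V (module.extend M r) = tensor_eq k V M"
  by (rule tensor_eq_cong; simp)+

lemma tensor_class_extend [simp]:
  "tensor_class k (module.extend M r) W = tensor_class k M W"
  "tensor_class k V (module.extend M r) = tensor_class k V M"
  by (simp_all add: tensor_class_def fun_eq_iff)

lemma simple_tensor_extend [simp]:
  "simple_tensor k (module.extend M r) W = simple_tensor k M W"
  "simple_tensor k V (module.extend M r) = simple_tensor k V M"
  by (simp_all add: simple_tensor_def fun_eq_iff)

lemma tensor_extend [simp]:
  "tensor k (module.extend M r) W = tensor k M W"
  "tensor k V (module.extend M r) = tensor k V M"
  by (simp_all add: tensor_def)

lemma tensor_lift_extend [simp]: "tensor_lift (module.extend M r) = tensor_lift M"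
  by (simp add: tensor_lift_def fun_eq_iff)

lemma tensor_map_extend [simp]:
  "tensor_map k (module.extend M r) W = tensor_map k M W"
  "tensor_map k V (module.extend M r) = tensor_map k V M"
  by (simp_all add: tensor_map_def fun_eq_iff)

lemma tensor_act_extend [simp]:
  "tensor_act k (module.extend M r) W = tensor_act k M W"
  "tensor_act k V (module.extend M r) = tensor_act k V M"
  by (simp_all add: tensor_act_def fun_eq_iff)

lemma tensor_reassoc_extend [simp]:
  "tensor_reassoc k (module.extend M r) V W = tensor_reassoc k M V W"
  "tensor_reassoc k U (module.extend M r) W = tensor_reassoc k U M W"
  "tensor_reassoc k U V (module.extend M r) = tensor_reassoc k U V M"
  by (simp_all add: tensor_reassoc_def fun_eq_iff)

lemma linear_map_extend [simp]:
  "linear_map k (module.extend M r) W = linear_map k M W"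
  "linear_map k V (module.extend M r) = linear_map k V M"
  by (simp_all add: linear_map_def fun_eq_iff)

lemma bilinear_extend [simp]:
  "bilinear k (module.extend M r) W X = bilinear k M W X"
  "bilinear k V (module.extend M r) X = bilinear k V M X"
  "bilinear k V W (module.extend M r) = bilinear k V W M"
  by (simp_all add: bilinear_def fun_eq_iff)

lemma is_action_extend [simp]: "is_action k A (module.extend M r) = is_action k A M"
  by (simp add: is_action_def fun_eq_iff)

lemma module_cong:
  assumes "module (k :: 'k ring) V"
    and [symmetric, simp]: "carrier V = carrier V'" "add V = add V'" "zero V = zero V'" "smult V = smult V'"
  shows "module k V'"
proof -
  interpret V: module k V by fact
  have "\<exists>y\<in>carrier V. y \<oplus>\<^bsub>V\<^esub> x = \<zero>\<^bsub>V\<^esub>" if "x \<in> carrier V" for x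
    using that V.M.l_neg V.M.a_inv_closed by blast
  then have "abelian_group V'"
    by (intro abelian_groupI) (simp_all add: V.M.a_ac)
  then show ?thesis
    by (intro moduleI V.R.is_cring) (simp_all add: V.smult_l_distr V.smult_r_distr V.smult_assoc1)
qed

lemma module_extend [simp]: "module k (module.extend M r) = module (k :: 'k ring) M"
  using module_cong[of k M "module.extend M r"] module_cong[of k "module.extend M r" M] by auto

section \<open>The category of modules\<close>

lemma LMod_sel [simp]:
  "Ob (LMod k H) = {V. left_module k H V}" "Hom (LMod k H) = lmod_hom k H"
  "Ident (LMod k H) V = (\<lambda>v\<in>carrier V. v)" "Comp (LMod k H) U V W g f = compose (carrier U) g f"
  by (simp_all add: LMod_def)

lemma lmod_homD:
  assumes "f \<in> lmod_hom k H V W"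
  shows "f \<in> extensional (carrier V)" "linear_map k V W f"
    "h \<in> carrier H \<Longrightarrow> v \<in> carrier V \<Longrightarrow> f (act V h v) = act W h (f v)"
    "v \<in> carrier V \<Longrightarrow> f v \<in> carrier W"
  using assms linear_mapD(1)[of k V W f] by (auto simp: lmod_hom_def)

lemma left_moduleD:
  assumes "left_module (k :: 'k ring) H V"
  shows "module k V" "is_action k H V (act V)" "bilinear k H V V (act V)"
    "h \<in> carrier H \<Longrightarrow> v \<in> carrier V \<Longrightarrow> act V h v \<in> carrier V"
  using assms bilinearD(3) unfolding left_module_iff is_action_def by metis+

lemma restrict_lmod_hom:
  assumes V: "left_module (k :: 'k ring) H V" and f: "linear_map k V W f"
    and e: "\<And>h v. h \<in> carrier H \<Longrightarrow> v \<in> carrier V \<Longrightarrow> f (act V h v) = act W h (f v)"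
  shows "restrict f (carrier V) \<in> lmod_hom k H V W"
proof -
  have "linear_map k V W (restrict f (carrier V))"
    by (rule linear_map_cong[OF f]) (simp_all add: left_moduleD[OF V])
  then show ?thesis using left_moduleD(4)[OF V] e by (auto simp: lmod_hom_def)
qed

lemma lmod_hom_ident: "left_module (k :: 'k ring) H V \<Longrightarrow> (\<lambda>v\<in>carrier V. v) \<in> lmod_hom k H V V"
  by (rule restrict_lmod_hom) (simp_all add: lin_id)

lemma lmod_hom_compose:
  assumes "left_module (k :: 'k ring) H U" "f \<in> lmod_hom k H U V" "g \<in> lmod_hom k H V W"
  shows "compose (carrier U) g f \<in> lmod_hom k H U W"
  unfolding compose_def
  by (rule restrict_lmod_hom[OF assms(1)])
    (use lmod_homD[OF assms(2)] lmod_homD[OF assms(3)] in \<open>auto intro: lin_comp\<close>)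

lemma lmod_hom_eqI:
  assumes "f \<in> lmod_hom k H V W" "g \<in> lmod_hom k H V W'" "\<And>v. v \<in> carrier V \<Longrightarrow> f v = g v"
  shows "f = g"
  using assms lmod_homD(1) by (metis extensionalityI)

lemma is_category_LMod: "is_category (LMod (k :: 'k ring) H)"
  unfolding is_category_def
proof (intro conjI ballI)
  fix a b f assume "a \<in> Ob (LMod k H)" "b \<in> Ob (LMod k H)" "f \<in> Hom (LMod k H) a b"
  then have *: "f \<in> lmod_hom k H a b" "left_module k H a" by auto
  show "Comp (LMod k H) a a b f (Ident (LMod k H) a) = f" "Comp (LMod k H) a b b (Ident (LMod k H) b) f = f"
    using lmod_homD(1,4)[OF *(1)] by (auto simp: fun_eq_iff compose_def extensional_def)
next
  fix a b c d f g h assume "a \<in> Ob (LMod k H)" "f \<in> Hom (LMod k H) a b" "g \<in> Hom (LMod k H) b c" "h \<in> Hom (LMod k H) c d"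
  then show "Comp (LMod k H) a c d h (Comp (LMod k H) a b c g f) = Comp (LMod k H) a b d (Comp (LMod k H) b c d h g) f"
    by (auto simp: fun_eq_iff compose_def dest: lmod_homD(4))
qed (auto intro: lmod_hom_ident lmod_hom_compose)

text \<open>
  The inverse of a bijective \<open>H\<close>-linear map is \<open>H\<close>-linear, so equivariance is asked of one direction only.
\<close>

lemma lmod_isoI:
  assumes V: "left_module (k :: 'k ring) H V" and W: "left_module k H W"
    and f: "linear_map k V W f" and g: "linear_map k W V g"
    and e: "\<And>h v. h \<in> carrier H \<Longrightarrow> v \<in> carrier V \<Longrightarrow> f (act V h v) = act W h (f v)"
    and gf: "\<And>v. v \<in> carrier V \<Longrightarrow> g (f v) = v" and fg: "\<And>w. w \<in> carrier W \<Longrightarrow> f (g w) = w"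
  shows "lmod_iso k H V W (restrict f (carrier V))"
proof -
  note fc = linear_mapD(1)[OF f] and gc = linear_mapD(1)[OF g]
  have "g (act W h w) = act V h (g w)" if "h \<in> carrier H" "w \<in> carrier W" for h w
    using e[of h "g w"] gf[of "act V h (g w)"] fg[of w] that gc left_moduleD(4)[OF V] by metis
  then have "restrict g (carrier W) \<in> lmod_hom k H W V"
    by (rule restrict_lmod_hom[OF W g])
  moreover have "restrict f (carrier V) \<in> lmod_hom k H V W"
    using e by (rule restrict_lmod_hom[OF V f])
  moreover have "compose (carrier V) (restrict g (carrier W)) (restrict f (carrier V)) = (\<lambda>v\<in>carrier V. v)"
    "compose (carrier W) (restrict f (carrier V)) (restrict g (carrier W)) = (\<lambda>w\<in>carrier W. w)"
    using fc gc gf fg by (auto simp: compose_def fun_eq_iff)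
  ultimately show ?thesis unfolding lmod_iso_def by blast
qed

section \<open>Tensor products of modules over a quasi-bialgebra\<close>

lemma tensor_ob_alt:
  "tensor_ob k H V W = module.extend (tensor k V W)
     (lmod.fields (\<lambda>h. tensor_act k V W (act V) (act W) (\<Delta>\<^bsub>H\<^esub> h)))"
  by (simp add: tensor_ob_def tensor_act_def fun_eq_iff)

lemma act_tensor_ob [simp]: "act (tensor_ob k H V W) h t = tensor_act k V W (act V) (act W) (\<Delta>\<^bsub>H\<^esub> h) t"
  by (simp add: tensor_ob_alt)

lemma tensor_ob_simps [simp]:
  "carrier (tensor_ob k H V W) = carrier (tensor k V W)"
  "zero (tensor_ob k H V W) = zero (tensor k V W)"
  "add (tensor_ob k H V W) = add (tensor k V W)"
  "smult (tensor_ob k H V W) = smult (tensor k V W)"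
  "tensor k (tensor_ob k H V W) X = tensor k (tensor k V W) X"
  "tensor k X (tensor_ob k H V W) = tensor k X (tensor k V W)"
  "simple_tensor k (tensor_ob k H V W) X = simple_tensor k (tensor k V W) X"
  "simple_tensor k X (tensor_ob k H V W) = simple_tensor k X (tensor k V W)"
  "tensor_lift (tensor_ob k H V W) = tensor_lift (tensor k V W)"
  "tensor_map k (tensor_ob k H V W) X = tensor_map k (tensor k V W) X"
  "tensor_map k X (tensor_ob k H V W) = tensor_map k X (tensor k V W)"
  "tensor_act k (tensor_ob k H V W) X = tensor_act k (tensor k V W) X"
  "tensor_act k X (tensor_ob k H V W) = tensor_act k X (tensor k V W)"
  "tensor_reassoc k (tensor_ob k H V W) X Y = tensor_reassoc k (tensor k V W) X Y"
  "tensor_reassoc k X (tensor_ob k H V W) Y = tensor_reassoc k X (tensor k V W) Y"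
  "tensor_reassoc k X Y (tensor_ob k H V W) = tensor_reassoc k X Y (tensor k V W)"
  "linear_map k (tensor_ob k H V W) X = linear_map k (tensor k V W) X"
  "linear_map k X (tensor_ob k H V W) = linear_map k X (tensor k V W)"
  "module k (tensor_ob k H V W) = module (k :: 'k ring) (tensor k V W)"
  "bilinear k X (tensor_ob k H V W) (tensor_ob k H V W) = bilinear k X (tensor k V W) (tensor k V W)"
  "is_action k X (tensor_ob k H V W) = is_action k X (tensor k V W)"
  by (simp_all add: tensor_ob_alt)

context quasi_bialgebra
begin

abbreviation "H2 \<equiv> tensor k H H"
abbreviation "H3 \<equiv> tensor k H H2"
abbreviation "H4 \<equiv> tensor k H H3"
abbreviation "pure2 \<equiv> simple_tensor k H H"
abbreviation "pure3 \<equiv> simple_tensor k H H2"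
abbreviation "pure4 \<equiv> simple_tensor k H H3"
abbreviation "reassoc3 \<equiv> tensor_reassoc k H H H"
abbreviation "reassoc4 \<equiv> tensor_reassoc k H H H2"
abbreviation "phi \<equiv> \<phi>\<^bsub>H\<^esub>"
abbreviation mult1 (infixl \<open>\<cdot>\<close> 70) where "a \<cdot> b \<equiv> a \<otimes>\<^bsub>H\<^esub> b"
abbreviation mult2 (infixl \<open>\<cdot>\<^sub>2\<close> 70) where "s \<cdot>\<^sub>2 t \<equiv> s \<otimes>\<^bsub>H2\<^esub> t"
abbreviation mult3 (infixl \<open>\<cdot>\<^sub>3\<close> 70) where "s \<cdot>\<^sub>3 t \<equiv> s \<otimes>\<^bsub>H3\<^esub> t"
abbreviation mult4 (infixl \<open>\<cdot>\<^sub>4\<close> 70) where "s \<cdot>\<^sub>4 t \<equiv> s \<otimes>\<^bsub>H4\<^esub> t"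

lemma H_algebra [simp]: "assoc_algebra k H" "module k H"
  by (rule assoc_algebra_axioms module_axioms)+

lemma comult_closed [simp]: "h \<in> carrier H \<Longrightarrow> \<Delta>\<^bsub>H\<^esub> h \<in> carrier H2"
  using linear_mapD(1)[OF algebra_homD(1)[OF comult_hom]] by simp

lemma comult_linear [simp]: "linear_map k H H2 \<Delta>\<^bsub>H\<^esub>"
  by (rule algebra_homD(1)[OF comult_hom])

lemma left_module_tensor_ob [simp]:
  assumes V: "left_module k H V" and W: "left_module k H W"
  shows "left_module k H (tensor_ob k H V W)"
  unfolding left_module_iff
  using is_action_pullback[OF is_action_tensor[OF _ _ _ _ left_moduleD(2)[OF V] left_moduleD(2)[OF W]] comult_hom]
    left_moduleD(1)[OF V] left_moduleD(1)[OF W]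
  by (simp add: act_tensor_ob[abs_def])

text \<open>
  \<open>f \<otimes> g\<close> commutes with the action of all of \<open>H \<otimes> H\<close>, in particular with that of \<open>\<Delta>(h)\<close>.
\<close>

lemma tensor_mor_hom:
  assumes V: "left_module k H V" and W: "left_module k H W" and V': "left_module k H V'" and W': "left_module k H W'"
    and f: "f \<in> lmod_hom k H V V'" and g: "g \<in> lmod_hom k H W W'"
  shows "tensor_mor k V W V' W' f g \<in> lmod_hom k H (tensor_ob k H V W) (tensor_ob k H V' W')"
proof -
  note [simp] = left_moduleD(1,3)[OF V] left_moduleD(1,3)[OF W] left_moduleD(1,3)[OF V'] left_moduleD(1,3)[OF W']
    lmod_homD(2)[OF f] lmod_homD(2)[OF g]
  have "restrict (tensor_map k V' W' f g) (carrier (tensor_ob k H V W)) \<in>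
     lmod_hom k H (tensor_ob k H V W) (tensor_ob k H V' W')"
  proof (rule restrict_lmod_hom)
    fix h v assume [simp]: "h \<in> carrier H" and "v \<in> carrier (tensor_ob k H V W)"
    then have v [simp]: "v \<in> carrier (tensor k V W)" by simp
    have "tensor_map k V' W' f g (tensor_act k V W (act V) (act W) (\<Delta>\<^bsub>H\<^esub> h) v) =
      tensor_act k V' W' (act V') (act W') (tensor_map k H H (\<lambda>x. x) (\<lambda>x. x) (\<Delta>\<^bsub>H\<^esub> h)) (tensor_map k V' W' f g v)"
      by (rule tensor_map_act[where A=H and B=H]) (simp_all add: lin_id lmod_homD(3)[OF f] lmod_homD(3)[OF g])
    then show "tensor_map k V' W' f g (act (tensor_ob k H V W) h v) =
      act (tensor_ob k H V' W') h (tensor_map k V' W' f g v)"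
      by (simp add: tensor_map_ident)
  qed (simp_all add: V W)
  then show ?thesis by (simp add: tensor_mor_def)
qed

lemma tensor_mor_ident:
  assumes V: "left_module k H V" and W: "left_module k H W"
  shows "tensor_mor k V W V W (\<lambda>v\<in>carrier V. v) (\<lambda>v\<in>carrier W. v) = (\<lambda>t\<in>carrier (tensor k V W). t)"
  unfolding tensor_mor_def using left_moduleD(1)[OF V] left_moduleD(1)[OF W]
  by (intro restrict_ext tensor_map_ident) simp_all

lemma tensor_mor_compose:
  assumes V: "left_module k H V" and W: "left_module k H W" and V': "left_module k H V'" and W': "left_module k H W'"
    and V'': "left_module k H V''" and W'': "left_module k H W''"
    and f: "f \<in> lmod_hom k H V V'" and g: "g \<in> lmod_hom k H W W'"
    and f': "f' \<in> lmod_hom k H V' V''" and g': "g' \<in> lmod_hom k H W' W''"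
  shows "tensor_mor k V W V'' W'' (compose (carrier V) f' f) (compose (carrier W) g' g) =
    compose (carrier (tensor k V W)) (tensor_mor k V' W' V'' W'' f' g') (tensor_mor k V W V' W' f g)"
proof -
  note [simp] = left_moduleD(1)[OF V] left_moduleD(1)[OF W] left_moduleD(1)[OF V'] left_moduleD(1)[OF W']
    left_moduleD(1)[OF V''] left_moduleD(1)[OF W''] lmod_homD(2)[OF f] lmod_homD(2)[OF g] lmod_homD(2)[OF f'] lmod_homD(2)[OF g']
  have "tensor_map k V'' W'' (compose (carrier V) f' f) (compose (carrier W) g' g) t =
    tensor_map k V'' W'' f' g' (tensor_map k V' W' f g t)" if t: "t \<in> carrier (tensor k V W)" for t
  proof -
    have "tensor_map k V'' W'' f' g' (tensor_map k V' W' f g t) =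
      tensor_map k V'' W'' (\<lambda>x. f' (f x)) (\<lambda>x. g' (g x)) t"
      by (rule tensor_map_comp[OF t]) simp_all
    also have "\<dots> = tensor_map k V'' W'' (compose (carrier V) f' f) (compose (carrier W) g' g) t"
      by (rule tensor_map_cong[OF t]) (simp_all add: compose_def lin_comp[where V=V'] lin_comp[where V=W'])
    finally show ?thesis by simp
  qed
  moreover have "tensor_map k V' W' f g t \<in> carrier (tensor k V' W')" if t: "t \<in> carrier (tensor k V W)" for t
    by (rule tensor_map_closed[OF t]) simp_all
  ultimately show ?thesis by (auto simp: tensor_mor_def compose_def fun_eq_iff)
qed

end

section \<open>Functoriality of tensor products\<close>

lemma prod_cat_sel [simp]:
  "Ob (prod_cat C D) = Ob C \<times> Ob D"
  "Hom (prod_cat C D) (a, a') (b, b') = Hom C a b \<times> Hom D a' b'"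
  "Ident (prod_cat C D) (a, a') = (Ident C a, Ident D a')"
  "Comp (prod_cat C D) (a, a') (b, b') (c, c') (g, g') (f, f') = (Comp C a b c g f, Comp D a' b' c' g' f')"
  by (simp_all add: prod_cat_def)

lemma op_cat_sel [simp]:
  "Ob (op_cat C) = Ob C" "Hom (op_cat C) a b = Hom C b a" "Ident (op_cat C) = Ident C"
  "Comp (op_cat C) a b c g f = Comp C c b a f g"
  by (simp_all add: op_cat_def)

lemma is_functorI:
  assumes "\<And>a. a \<in> Ob C \<Longrightarrow> on_ob F a \<in> Ob D"
    and "\<And>a b f. a \<in> Ob C \<Longrightarrow> b \<in> Ob C \<Longrightarrow> f \<in> Hom C a b \<Longrightarrow> on_mor F a b f \<in> Hom D (on_ob F a) (on_ob F b)"
    and "\<And>a. a \<in> Ob C \<Longrightarrow> on_mor F a a (Ident C a) = Ident D (on_ob F a)"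
    and "\<And>a b c f g. a \<in> Ob C \<Longrightarrow> b \<in> Ob C \<Longrightarrow> c \<in> Ob C \<Longrightarrow> f \<in> Hom C a b \<Longrightarrow> g \<in> Hom C b c \<Longrightarrow>
      on_mor F a c (Comp C a b c g f) =
      Comp D (on_ob F a) (on_ob F b) (on_ob F c) (on_mor F b c g) (on_mor F a b f)"
  shows "is_functor C D F"
  using assms by (simp add: is_functor_def)

lemma is_functor_prod3I:
  assumes "\<And>V W X. V \<in> Ob C \<Longrightarrow> W \<in> Ob C' \<Longrightarrow> X \<in> Ob C'' \<Longrightarrow> on_ob F (V, W, X) \<in> Ob D"
    and "\<And>V W X V' W' X' f g l. V \<in> Ob C \<Longrightarrow> W \<in> Ob C' \<Longrightarrow> X \<in> Ob C'' \<Longrightarrow>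
      V' \<in> Ob C \<Longrightarrow> W' \<in> Ob C' \<Longrightarrow> X' \<in> Ob C'' \<Longrightarrow>
      f \<in> Hom C V V' \<Longrightarrow> g \<in> Hom C' W W' \<Longrightarrow> l \<in> Hom C'' X X' \<Longrightarrow>
      on_mor F (V, W, X) (V', W', X') (f, g, l) \<in> Hom D (on_ob F (V, W, X)) (on_ob F (V', W', X'))"
    and "\<And>V W X. V \<in> Ob C \<Longrightarrow> W \<in> Ob C' \<Longrightarrow> X \<in> Ob C'' \<Longrightarrow>
      on_mor F (V, W, X) (V, W, X) (Ident C V, Ident C' W, Ident C'' X) = Ident D (on_ob F (V, W, X))"
    and "\<And>V W X V' W' X' V'' W'' X'' f g l f' g' l'. V \<in> Ob C \<Longrightarrow> W \<in> Ob C' \<Longrightarrow> X \<in> Ob C'' \<Longrightarrow>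
      V' \<in> Ob C \<Longrightarrow> W' \<in> Ob C' \<Longrightarrow> X' \<in> Ob C'' \<Longrightarrow>
      V'' \<in> Ob C \<Longrightarrow> W'' \<in> Ob C' \<Longrightarrow> X'' \<in> Ob C'' \<Longrightarrow>
      f \<in> Hom C V V' \<Longrightarrow> g \<in> Hom C' W W' \<Longrightarrow> l \<in> Hom C'' X X' \<Longrightarrow>
      f' \<in> Hom C V' V'' \<Longrightarrow> g' \<in> Hom C' W' W'' \<Longrightarrow> l' \<in> Hom C'' X' X'' \<Longrightarrow>
      on_mor F (V, W, X) (V'', W'', X'') (Comp C V V' V'' f' f, Comp C' W W' W'' g' g, Comp C'' X X' X'' l' l) =
      Comp D (on_ob F (V, W, X)) (on_ob F (V', W', X')) (on_ob F (V'', W'', X''))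
        (on_mor F (V', W', X') (V'', W'', X'') (f', g', l')) (on_mor F (V, W, X) (V', W', X') (f, g, l))"
  shows "is_functor (prod_cat C (prod_cat C' C'')) D F"
  using assms by (intro is_functorI) auto

lemma smult_left_comm: "module k V \<Longrightarrow> v \<in> carrier V \<Longrightarrow> a \<in> carrier k \<Longrightarrow> b \<in> carrier k \<Longrightarrow>
   a \<odot>\<^bsub>V\<^esub> (b \<odot>\<^bsub>V\<^esub> v) = b \<odot>\<^bsub>V\<^esub> (a \<odot>\<^bsub>V\<^esub> v)"
  by (metis module.smult_assoc1 module.axioms(1) cring.cring_simprules(14))

text \<open>
  Acting through \<open>F\<close> and \<open>G\<close> is acting with \<open>(F \<otimes> G)(s)\<close>.  With \<open>\<Delta>\<close> for \<open>F\<close> or \<open>G\<close> this rewrites the action on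
  an iterated tensor product as an action of a higher tensor power of \<open>H\<close>.
\<close>

lemma tensor_act_pullback:
  assumes [simp]: "module k A" "module k B" "module k V" "module k W" "module k A'" "module k B'"
    and [simp]: "bilinear k A' V V p" "bilinear k B' W W q"
    and [simp]: "linear_map k A A' F" "linear_map k B B' G"
    and s: "s \<in> carrier (tensor k A B)" "t \<in> carrier (tensor k V W)"
  shows "tensor_act k V W (\<lambda>a. p (F a)) (\<lambda>b. q (G b)) s t =
    tensor_act k V W p q (tensor_map k A' B' F G s) t"
proof -
  have "tensor_map k V W (\<lambda>x. x) (\<lambda>x. x) (tensor_act k V W (\<lambda>a. p (F a)) (\<lambda>b. q (G b)) s t) =
    tensor_act k V W p q (tensor_map k A' B' F G s) (tensor_map k V W (\<lambda>x. x) (\<lambda>x. x) t)"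
    by (rule tensor_map_act[where A=A and B=B and A'=A' and B'=B'])
      (use s in \<open>simp_all add: lin_id bilinear_comp_lin[of k A' V V p A F V "\<lambda>x. x"] bilinear_comp_lin[of k B' W W q B G W "\<lambda>x. x"]\<close>)
  moreover have "tensor_act k V W (\<lambda>a. p (F a)) (\<lambda>b. q (G b)) s t \<in> carrier (tensor k V W)"
    by (rule tensor_act_closed[OF s])
      (simp_all add: lin_id bilinear_comp_lin[of k A' V V p A F V "\<lambda>x. x"] bilinear_comp_lin[of k B' W W q B G W "\<lambda>x. x"])
  ultimately show ?thesis using s by (simp add: tensor_map_ident)
qed

lemma base_algebra_assoc:
  assumes "cring (k :: 'k ring)"
  shows "assoc_algebra k (base_algebra k)"
proof -
  interpret cring k by fact
  have m: "module k (base_algebra k)"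
    by (rule moduleI, rule assms, rule abelian_groupI)
      (auto simp: a_ac l_distr r_distr m_assoc intro: l_neg)
  have r: "ring (base_algebra k)"
    by (rule ringI, rule module.axioms(2)[OF m], rule monoidI) (auto simp: m_assoc l_distr r_distr)
  show ?thesis by (intro assoc_algebra.intro m r assoc_algebra_axioms.intro) (auto simp: m_ac)
qed

context quasi_bialgebra
begin

lemma is_functor_tensor:
  "is_functor (prod_cat (LMod k H) (LMod k H)) (LMod k H) (tensor_func k H)"
  unfolding is_functor_def tensor_func_def
  by (auto simp: tensor_mor_ident intro: tensor_mor_hom tensor_mor_compose)

lemma is_functor_tensor_left:
  "is_functor (prod_cat (LMod k H) (prod_cat (LMod k H) (LMod k H))) (LMod k H) (tensor_left_func k H)"
proof (rule is_functor_prod3I, goal_cases)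
  case 1
  then show ?case by (simp add: tensor_left_func_def)
next
  case 2
  then show ?case by (simp add: tensor_left_func_def tensor_mor_hom)
next
  case (3 V W X)
  then show ?case
    using tensor_mor_ident[of "tensor_ob k H V W" X] by (simp add: tensor_left_func_def tensor_mor_ident)
next
  case (4 V W X V' W' X' V'' W'' X'' f g l f' g' l')
  then show ?case
    using tensor_mor_compose[where V="tensor_ob k H V W" and W=X
        and V'="tensor_ob k H V' W'" and W'=X'
        and V''="tensor_ob k H V'' W''" and W''=X''
        and f="tensor_mor k V W V' W' f g" and g=l
        and f'="tensor_mor k V' W' V'' W'' f' g'" and g'=l']
      tensor_mor_compose[where V=V and W=W and V'=V' and W'=W' and V''=V'' and W''=W''
        and f=f and f'=f' and g=g and g'=g']
    by (simp add: tensor_left_func_def tensor_mor_hom)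
qed

lemma is_functor_tensor_right:
  "is_functor (prod_cat (LMod k H) (prod_cat (LMod k H) (LMod k H))) (LMod k H) (tensor_right_func k H)"
proof (rule is_functor_prod3I, goal_cases)
  case 1
  then show ?case by (simp add: tensor_right_func_def)
next
  case 2
  then show ?case by (simp add: tensor_right_func_def tensor_mor_hom)
next
  case (3 V W X)
  then show ?case
    using tensor_mor_ident[of V "tensor_ob k H W X"] by (simp add: tensor_right_func_def tensor_mor_ident)
next
  case (4 V W X V' W' X' V'' W'' X'' f g l f' g' l')
  then show ?case
    using tensor_mor_compose[where V=V and W="tensor_ob k H W X"
        and V'=V' and W'="tensor_ob k H W' X'"
        and V''=V'' and W''="tensor_ob k H W'' X''"
        and f=f and g="tensor_mor k W X W' X' g l"
        and f'=f' and g'="tensor_mor k W' X' W'' X'' g' l'"]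
      tensor_mor_compose[where V=W and W=X and V'=W' and W'=X' and V''=W'' and W''=X''
        and f=g and f'=g' and g=l and g'=l']
    by (simp add: tensor_right_func_def tensor_mor_hom)
qed

section \<open>Unitors\<close>

lemma base_algebra [simp]: "assoc_algebra k (base_algebra k)" "module k (base_algebra k)"
  using base_algebra_assoc[OF R.is_cring] by simp_all

lemma counit_linear [simp]: "linear_map k H (base_algebra k) \<epsilon>\<^bsub>H\<^esub>"
  by (rule algebra_homD(1)[OF counit_hom])

lemma counit_closed [simp]: "h \<in> carrier H \<Longrightarrow> \<epsilon>\<^bsub>H\<^esub> h \<in> carrier k"
  using linear_mapD(1)[OF counit_linear] by simp

lemma unit_ob_simps [simp]:
  "carrier (unit_ob k H) = carrier k"
  "tensor k (unit_ob k H) X = tensor k (base_algebra k) X"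
  "tensor k X (unit_ob k H) = tensor k X (base_algebra k)"
  "simple_tensor k (unit_ob k H) X = simple_tensor k (base_algebra k) X"
  "simple_tensor k X (unit_ob k H) = simple_tensor k X (base_algebra k)"
  "tensor_map k (unit_ob k H) X = tensor_map k (base_algebra k) X"
  "tensor_map k X (unit_ob k H) = tensor_map k X (base_algebra k)"
  "tensor_act k (unit_ob k H) X = tensor_act k (base_algebra k) X"
  "tensor_act k X (unit_ob k H) = tensor_act k X (base_algebra k)"
  "tensor_reassoc k X (unit_ob k H) Y = tensor_reassoc k X (base_algebra k) Y"
  "linear_map k (unit_ob k H) X = linear_map k (base_algebra k) X"
  "linear_map k X (unit_ob k H) = linear_map k X (base_algebra k)"
  "module k (unit_ob k H) = module k (base_algebra k)"
  "is_action k X (unit_ob k H) = is_action k X (base_algebra k)"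
  "bilinear k H (unit_ob k H) (unit_ob k H) = bilinear k H (base_algebra k) (base_algebra k)"
  "act (unit_ob k H) h c = \<epsilon>\<^bsub>H\<^esub> h \<otimes>\<^bsub>k\<^esub> c"
  by (simp_all add: unit_ob_def)

lemma mult_is_action: "assoc_algebra (k :: 'k ring) A \<Longrightarrow> is_action k A A (mult A)"
  by (simp add: is_action_def assoc_algebra_def ring.ring_simprules)

lemma left_module_unit_ob [simp]: "left_module k H (unit_ob k H)"
  unfolding left_module_iff
  using is_action_pullback[OF mult_is_action counit_hom] by (simp add: unit_ob_def)

abbreviation "scale_left V \<equiv> tensor_lift V (\<lambda>c v. c \<odot>\<^bsub>V\<^esub> v)"
abbreviation "scale_right V \<equiv> tensor_lift V (\<lambda>v c. c \<odot>\<^bsub>V\<^esub> v)"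

lemma left_unitor_bilinear: "module k V \<Longrightarrow> bilinear k (base_algebra k) V V (\<lambda>c v. c \<odot>\<^bsub>V\<^esub> v)"
  by (rule bilinearI) (rule lin | simp)+

lemma right_unitor_bilinear: "module k V \<Longrightarrow> bilinear k V (base_algebra k) V (\<lambda>v c. c \<odot>\<^bsub>V\<^esub> v)"
  by (rule bilinearI) (rule lin | simp)+

text \<open>
  The maps \<open>\<epsilon> \<otimes> id\<close> and \<open>id \<otimes> \<epsilon>\<close> from \<open>H \<otimes> H\<close> to \<open>H\<close>, in the form in which they occur in the counit axioms.
\<close>

definition counit_l :: "('h, 'h) tens \<Rightarrow> 'h" where
  "counit_l t = tensor_lift H (\<lambda>c x. c \<odot>\<^bsub>H\<^esub> x) (tensor_map k (base_algebra k) H \<epsilon>\<^bsub>H\<^esub> id t)"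

definition counit_r :: "('h, 'h) tens \<Rightarrow> 'h" where
  "counit_r t = tensor_lift H (\<lambda>x c. c \<odot>\<^bsub>H\<^esub> x) (tensor_map k H (base_algebra k) id \<epsilon>\<^bsub>H\<^esub> t)"

lemma counit_l_linear [simp]: "linear_map k H2 H counit_l"
  unfolding counit_l_def[abs_def] by (rule lin left_unitor_bilinear | simp)+

lemma counit_r_linear [simp]: "linear_map k H2 H counit_r"
  unfolding counit_r_def[abs_def] by (rule lin right_unitor_bilinear | simp)+

lemma counit_l_simple [simp]: "a \<in> carrier H \<Longrightarrow> b \<in> carrier H \<Longrightarrow>
    counit_l (pure2 a b) = \<epsilon>\<^bsub>H\<^esub> a \<odot>\<^bsub>H\<^esub> b"
  unfolding counit_l_def by (simp add: tensor_lift_simple[OF _ _ _ left_unitor_bilinear])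

lemma counit_r_simple [simp]: "a \<in> carrier H \<Longrightarrow> b \<in> carrier H \<Longrightarrow>
    counit_r (pure2 a b) = \<epsilon>\<^bsub>H\<^esub> b \<odot>\<^bsub>H\<^esub> a"
  unfolding counit_r_def by (simp add: tensor_lift_simple[OF _ _ _ right_unitor_bilinear])

lemma counit_l_comult [simp]: "h \<in> carrier H \<Longrightarrow> counit_l (\<Delta>\<^bsub>H\<^esub> h) = h"
  unfolding counit_l_def by (rule counit_left)

lemma counit_r_comult [simp]: "h \<in> carrier H \<Longrightarrow> counit_r (\<Delta>\<^bsub>H\<^esub> h) = h"
  unfolding counit_r_def by (rule counit_right)

lemma smult_mult_base: "module k V \<Longrightarrow> v \<in> carrier V \<Longrightarrow> a \<in> carrier k \<Longrightarrow> b \<in> carrier k \<Longrightarrow>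
   (a \<otimes>\<^bsub>k\<^esub> b) \<odot>\<^bsub>V\<^esub> v = a \<odot>\<^bsub>V\<^esub> (b \<odot>\<^bsub>V\<^esub> v)"
  by (rule module.smult_assoc1)

text \<open>
  The unitor intertwines the action of \<open>s \<in> H \<otimes> H\<close> with that of \<open>(\<epsilon> \<otimes> id)(s)\<close>.  For \<open>s = \<Delta>(h)\<close> this is
  equivariance, and for \<open>s\<close> inside \<open>\<phi>\<close> it is the step that evaluates the triangle.
\<close>

lemma left_unitor_act:
  assumes V: "left_module k H V"
    and s: "s \<in> carrier H2" and t: "t \<in> carrier (tensor k (base_algebra k) V)"
  shows "scale_left V (tensor_act k (base_algebra k) V (act (unit_ob k H)) (act V) s t) =
    act V (counit_l s) (scale_left V t)"
proof (rule bilinear_eqI[OF _ _ _ _ _ _ _ _ s t])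
  note V' [simp] = left_moduleD[OF V]
  have u [simp]: "bilinear k H (base_algebra k) (base_algebra k) (act (unit_ob k H))"
    using left_moduleD(3)[OF left_module_unit_ob] by simp
  note ul = tensor_lift_linear[OF _ _ _ left_unitor_bilinear]
  show "bilinear k H2 (tensor k (base_algebra k) V) V (\<lambda>s t. scale_left V
    (tensor_act k (base_algebra k) V (act (unit_ob k H)) (act V) s t))"
    by (rule bilinear_lin_comp[OF tensor_act_bilinear ul]) simp_all
  show "bilinear k H2 (tensor k (base_algebra k) V) V
    (\<lambda>s t. act V (counit_l s) (scale_left V t))"
    by (rule bilinear_comp_lin[OF left_moduleD(3)[OF V] counit_l_linear ul]) simp_all
  show "scale_left V (tensor_act k (base_algebra k) V (act (unit_ob k H)) (act V)
        (pure2 a b) (simple_tensor k (base_algebra k) V c v)) =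
     act V (counit_l (pure2 a b)) (scale_left V (simple_tensor k (base_algebra k) V c v))"
    if "a \<in> carrier H" "b \<in> carrier H" "c \<in> carrier (base_algebra k)" "v \<in> carrier V" for a b c v
    using that by (simp add: tensor_act_simple[where A=H and B=H] tensor_lift_simple[OF _ _ _ left_unitor_bilinear]
      smult_mult_base smult_left_comm[where k=k] left_module.act_smult_left[OF V] left_module.act_smult_right[OF V] module.smult_closed[where R=k])
qed (use left_moduleD[OF V] in simp_all)

lemma right_unitor_act:
  assumes V: "left_module k H V"
    and s: "s \<in> carrier H2" and t: "t \<in> carrier (tensor k V (base_algebra k))"
  shows "scale_right V (tensor_act k V (base_algebra k) (act V) (act (unit_ob k H)) s t) =
    act V (counit_r s) (scale_right V t)"
proof (rule bilinear_eqI[OF _ _ _ _ _ _ _ _ s t])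
  note V' [simp] = left_moduleD[OF V]
  have u [simp]: "bilinear k H (base_algebra k) (base_algebra k) (act (unit_ob k H))"
    using left_moduleD(3)[OF left_module_unit_ob] by simp
  note ul = tensor_lift_linear[OF _ _ _ right_unitor_bilinear]
  show "bilinear k H2 (tensor k V (base_algebra k)) V (\<lambda>s t. scale_right V
    (tensor_act k V (base_algebra k) (act V) (act (unit_ob k H)) s t))"
    by (rule bilinear_lin_comp[OF tensor_act_bilinear ul]) simp_all
  show "bilinear k H2 (tensor k V (base_algebra k)) V
    (\<lambda>s t. act V (counit_r s) (scale_right V t))"
    by (rule bilinear_comp_lin[OF left_moduleD(3)[OF V] counit_r_linear ul]) simp_all
  show "scale_right V (tensor_act k V (base_algebra k) (act V) (act (unit_ob k H))
        (pure2 a b) (simple_tensor k V (base_algebra k) v c)) =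
     act V (counit_r (pure2 a b)) (scale_right V (simple_tensor k V (base_algebra k) v c))"
    if "a \<in> carrier H" "b \<in> carrier H" "c \<in> carrier (base_algebra k)" "v \<in> carrier V" for a b c v
    using that by (simp add: tensor_act_simple[where A=H and B=H] tensor_lift_simple[OF _ _ _ right_unitor_bilinear]
      smult_mult_base smult_left_comm[where k=k] left_module.act_smult_left[OF V] left_module.act_smult_right[OF V] module.smult_closed[where R=k])
qed (use left_moduleD[OF V] in simp_all)

text \<open>
  The inverse is \<open>v \<mapsto> 1 \<otimes> v\<close>.
\<close>

lemma left_unitor_natural_iso:
  "lmod_natural_iso k H (LMod k H) (tensor_unit_left_func k H) id_func (left_unitor k H)"
  unfolding lmod_natural_iso_def
proof (intro conjI ballI)
  show "is_functor (LMod k H) (LMod k H) (tensor_unit_left_func k H)"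
  proof (rule is_functorI, goal_cases)
    case 1
    then show ?case by (simp add: tensor_unit_left_func_def)
  next
    case (2 V W f)
    then show ?case
      using tensor_mor_hom[OF _ _ _ _ lmod_hom_ident[OF left_module_unit_ob], of V W f]
      by (simp add: tensor_unit_left_func_def)
  next
    case (3 V)
    then show ?case
      using tensor_mor_ident[of "unit_ob k H" V] by (simp add: tensor_unit_left_func_def)
  next
    case (4 U V W f g)
    have "compose (carrier k) (\<lambda>v\<in>carrier k. v) (\<lambda>v\<in>carrier k. v) = (\<lambda>v\<in>carrier k. v)"
      by (auto simp: compose_def)
    then show ?case
      using 4 tensor_mor_compose[OF left_module_unit_ob _ left_module_unit_ob _ left_module_unit_ob _
         lmod_hom_ident[OF left_module_unit_ob] 4(4)[simplified] lmod_hom_ident[OF left_module_unit_ob] 4(5)[simplified]]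
      by (simp add: tensor_unit_left_func_def)
  qed
  show "is_functor (LMod k H) (LMod k H) id_func"
    by (auto simp: is_functor_def id_func_def lmod_hom_ident intro: lmod_hom_compose)
next
  fix V assume "V \<in> Ob (LMod k H)"
  then have V: "left_module k H V" by simp
  note [simp] = left_moduleD[OF V]
  have "lmod_iso k H (tensor_ob k H (unit_ob k H) V) V
     (restrict (scale_left V) (carrier (tensor_ob k H (unit_ob k H) V)))"
  proof (rule lmod_isoI[where g="\<lambda>v. simple_tensor k (base_algebra k) V \<one>\<^bsub>k\<^esub> v"])
    show "linear_map k (tensor_ob k H (unit_ob k H) V) V (scale_left V)"
      by (simp add: tensor_lift_linear left_unitor_bilinear)
    show "linear_map k V (tensor_ob k H (unit_ob k H) V) (\<lambda>v. simple_tensor k (base_algebra k) V \<one>\<^bsub>k\<^esub> v)"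
      using bilinearD(1)[OF simple_bilinear, of k "base_algebra k" V "\<one>\<^bsub>k\<^esub>"] by simp
    show "scale_left V (act (tensor_ob k H (unit_ob k H) V) h t) =
         act V h (scale_left V t)"
      if "h \<in> carrier H" "t \<in> carrier (tensor_ob k H (unit_ob k H) V)" for h t
      using that by (simp add: left_unitor_act[OF V])
    show "scale_left V (simple_tensor k (base_algebra k) V \<one>\<^bsub>k\<^esub> v) = v"
      if "v \<in> carrier V" for v
      using that by (simp add: tensor_lift_simple[OF _ _ _ left_unitor_bilinear] module.smult_one[where R=k])
    have "\<forall>t\<in>carrier (tensor k (base_algebra k) V).
       simple_tensor k (base_algebra k) V \<one>\<^bsub>k\<^esub> (scale_left V t) = t"
    proof (rule tensor_eqI)
      show "\<forall>c\<in>carrier (base_algebra k). \<forall>v\<in>carrier V.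
         simple_tensor k (base_algebra k) V \<one>\<^bsub>k\<^esub>
           (scale_left V (simple_tensor k (base_algebra k) V c v)) =
         simple_tensor k (base_algebra k) V c v"
      proof (intro ballI)
        fix c v assume c: "c \<in> carrier (base_algebra k)" and v: "v \<in> carrier V"
        have "simple_tensor k (base_algebra k) V (c \<odot>\<^bsub>base_algebra k\<^esub> \<one>\<^bsub>k\<^esub>) v =
          simple_tensor k (base_algebra k) V \<one>\<^bsub>k\<^esub> (c \<odot>\<^bsub>V\<^esub> v)"
          using c v bilinearD(6,7)[OF simple_bilinear, of k "base_algebra k" V c "\<one>\<^bsub>k\<^esub>" v] by simp
        then show "simple_tensor k (base_algebra k) V \<one>\<^bsub>k\<^esub>
           (scale_left V (simple_tensor k (base_algebra k) V c v)) =
          simple_tensor k (base_algebra k) V c v"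
          using c v by (subst tensor_lift_simple[OF _ _ _ left_unitor_bilinear]) simp_all
      qed
    qed (rule lin left_unitor_bilinear | simp)+
    then show "simple_tensor k (base_algebra k) V \<one>\<^bsub>k\<^esub> (scale_left V t) = t"
      if "t \<in> carrier (tensor_ob k H (unit_ob k H) V)" for t
      using that by simp
  qed (simp_all add: V)
  then show "lmod_iso k H (on_ob (tensor_unit_left_func k H) V) (on_ob id_func V) (left_unitor k H V)"
    by (simp add: tensor_unit_left_func_def id_func_def left_unitor_def)
next
  fix V W f assume "V \<in> Ob (LMod k H)" "W \<in> Ob (LMod k H)" "f \<in> Hom (LMod k H) V W"
  then have V: "left_module k H V" and W: "left_module k H W" and f: "f \<in> lmod_hom k H V W" by simp_all
  note [simp] = left_moduleD[OF V] left_moduleD[OF W] lmod_homD(2,4)[OF f]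
  have [simp]: "linear_map k (base_algebra k) (base_algebra k) (\<lambda>v\<in>carrier k. v)"
    using lmod_homD(2)[OF lmod_hom_ident[OF left_module_unit_ob]] by simp
  have "\<forall>t\<in>carrier (tensor k (base_algebra k) V).
    scale_left W (tensor_map k (base_algebra k) W (\<lambda>v\<in>carrier k. v) f t) =
    f (scale_left V t)"
    by (rule tensor_eqI, (rule lin left_unitor_bilinear lin_comp[OF _ lmod_homD(2)[OF f]]
       | simp add: tensor_lift_simple[OF _ _ _ left_unitor_bilinear] linear_mapD(3)[OF lmod_homD(2)[OF f]])+)
  moreover have "tensor_map k (base_algebra k) W (\<lambda>v\<in>carrier k. v) f t \<in> carrier (tensor k (base_algebra k) W)"
    if "t \<in> carrier (tensor k (base_algebra k) V)" for t
    by (rule tensor_map_closed[OF that]) simp_all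
  ultimately show "compose (carrier (on_ob (tensor_unit_left_func k H) V)) (left_unitor k H W)
      (on_mor (tensor_unit_left_func k H) V W f) =
    compose (carrier (on_ob (tensor_unit_left_func k H) V)) (on_mor id_func V W f) (left_unitor k H V)"
    by (auto simp: tensor_unit_left_func_def id_func_def left_unitor_def tensor_mor_def compose_def fun_eq_iff)
qed

lemma right_unitor_natural_iso:
  "lmod_natural_iso k H (LMod k H) (tensor_unit_right_func k H) id_func (right_unitor k H)"
  unfolding lmod_natural_iso_def
proof (intro conjI ballI)
  show "is_functor (LMod k H) (LMod k H) (tensor_unit_right_func k H)"
  proof (rule is_functorI, goal_cases)
    case 1
    then show ?case by (simp add: tensor_unit_right_func_def)
  next
    case (2 V W f)
    then show ?case
      using tensor_mor_hom[OF _ _ _ _ _ lmod_hom_ident[OF left_module_unit_ob], of V W f]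
      by (simp add: tensor_unit_right_func_def)
  next
    case (3 V)
    then show ?case
      using tensor_mor_ident[of V "unit_ob k H"] by (simp add: tensor_unit_right_func_def)
  next
    case (4 U V W f g)
    have "compose (carrier k) (\<lambda>v\<in>carrier k. v) (\<lambda>v\<in>carrier k. v) = (\<lambda>v\<in>carrier k. v)"
      by (auto simp: compose_def)
    then show ?case
      using 4 tensor_mor_compose[OF _ left_module_unit_ob _ left_module_unit_ob _ left_module_unit_ob
         4(4)[simplified] lmod_hom_ident[OF left_module_unit_ob] 4(5)[simplified] lmod_hom_ident[OF left_module_unit_ob]]
      by (simp add: tensor_unit_right_func_def)
  qed
  show "is_functor (LMod k H) (LMod k H) id_func"
    by (auto simp: is_functor_def id_func_def lmod_hom_ident intro: lmod_hom_compose)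
next
  fix V assume "V \<in> Ob (LMod k H)"
  then have V: "left_module k H V" by simp
  note [simp] = left_moduleD[OF V]
  have "lmod_iso k H (tensor_ob k H V (unit_ob k H)) V
     (restrict (scale_right V) (carrier (tensor_ob k H V (unit_ob k H))))"
  proof (rule lmod_isoI[where g="\<lambda>v. simple_tensor k V (base_algebra k) v \<one>\<^bsub>k\<^esub>"])
    show "linear_map k (tensor_ob k H V (unit_ob k H)) V (scale_right V)"
      by (simp add: tensor_lift_linear right_unitor_bilinear)
    show "linear_map k V (tensor_ob k H V (unit_ob k H)) (\<lambda>v. simple_tensor k V (base_algebra k) v \<one>\<^bsub>k\<^esub>)"
      using bilinearD(2)[OF simple_bilinear, of k V "base_algebra k" "\<one>\<^bsub>k\<^esub>"] by simp
    show "scale_right V (act (tensor_ob k H V (unit_ob k H)) h t) =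
         act V h (scale_right V t)"
      if "h \<in> carrier H" "t \<in> carrier (tensor_ob k H V (unit_ob k H))" for h t
      using that by (simp add: right_unitor_act[OF V])
    show "scale_right V (simple_tensor k V (base_algebra k) v \<one>\<^bsub>k\<^esub>) = v"
      if "v \<in> carrier V" for v
      using that by (simp add: tensor_lift_simple[OF _ _ _ right_unitor_bilinear] module.smult_one[where R=k])
    have "\<forall>t\<in>carrier (tensor k V (base_algebra k)).
       simple_tensor k V (base_algebra k) (scale_right V t) \<one>\<^bsub>k\<^esub> = t"
    proof (rule tensor_eqI)
      show "\<forall>v\<in>carrier V. \<forall>c\<in>carrier (base_algebra k).
         simple_tensor k V (base_algebra k)
           (scale_right V (simple_tensor k V (base_algebra k) v c)) \<one>\<^bsub>k\<^esub> =
         simple_tensor k V (base_algebra k) v c"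
      proof (intro ballI)
        fix c v assume c: "c \<in> carrier (base_algebra k)" and v: "v \<in> carrier V"
        have "simple_tensor k V (base_algebra k) v (c \<odot>\<^bsub>base_algebra k\<^esub> \<one>\<^bsub>k\<^esub>) =
          simple_tensor k V (base_algebra k) (c \<odot>\<^bsub>V\<^esub> v) \<one>\<^bsub>k\<^esub>"
          using c v bilinearD(6,7)[OF simple_bilinear, of k V "base_algebra k" c v "\<one>\<^bsub>k\<^esub>"] by simp
        then show "simple_tensor k V (base_algebra k)
           (scale_right V (simple_tensor k V (base_algebra k) v c)) \<one>\<^bsub>k\<^esub> =
          simple_tensor k V (base_algebra k) v c"
          using c v by (subst tensor_lift_simple[OF _ _ _ right_unitor_bilinear]) simp_all
      qed
    qed (rule lin right_unitor_bilinear | simp)+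
    then show "simple_tensor k V (base_algebra k) (scale_right V t) \<one>\<^bsub>k\<^esub> = t"
      if "t \<in> carrier (tensor_ob k H V (unit_ob k H))" for t
      using that by simp
  qed (simp_all add: V)
  then show "lmod_iso k H (on_ob (tensor_unit_right_func k H) V) (on_ob id_func V) (right_unitor k H V)"
    by (simp add: tensor_unit_right_func_def id_func_def right_unitor_def)
next
  fix V W f assume "V \<in> Ob (LMod k H)" "W \<in> Ob (LMod k H)" "f \<in> Hom (LMod k H) V W"
  then have V: "left_module k H V" and W: "left_module k H W" and f: "f \<in> lmod_hom k H V W" by simp_all
  note [simp] = left_moduleD[OF V] left_moduleD[OF W] lmod_homD(2,4)[OF f]
  have [simp]: "linear_map k (base_algebra k) (base_algebra k) (\<lambda>v\<in>carrier k. v)"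
    using lmod_homD(2)[OF lmod_hom_ident[OF left_module_unit_ob]] by simp
  have "\<forall>t\<in>carrier (tensor k V (base_algebra k)).
    scale_right W (tensor_map k W (base_algebra k) f (\<lambda>v\<in>carrier k. v) t) =
    f (scale_right V t)"
    by (rule tensor_eqI, (rule lin right_unitor_bilinear lin_comp[OF _ lmod_homD(2)[OF f]]
       | simp add: tensor_lift_simple[OF _ _ _ right_unitor_bilinear] linear_mapD(3)[OF lmod_homD(2)[OF f]])+)
  moreover have "tensor_map k W (base_algebra k) f (\<lambda>v\<in>carrier k. v) t \<in> carrier (tensor k W (base_algebra k))"
    if "t \<in> carrier (tensor k V (base_algebra k))" for t
    by (rule tensor_map_closed[OF that]) simp_all
  ultimately show "compose (carrier (on_ob (tensor_unit_right_func k H) V)) (right_unitor k H W)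
      (on_mor (tensor_unit_right_func k H) V W f) =
    compose (carrier (on_ob (tensor_unit_right_func k H) V)) (on_mor id_func V W f) (right_unitor k H V)"
    by (auto simp: tensor_unit_right_func_def id_func_def right_unitor_def tensor_mor_def compose_def fun_eq_iff)
qed

end

section \<open>The associator and the triangle\<close>

declare lin_id [simp]

lemma linear_map_restrict_id [simp]: "module k V \<Longrightarrow> linear_map k V V (\<lambda>v\<in>carrier V. v)"
  by (rule linear_map_cong[OF lin_id]) simp_all

lemma reassoc_tensor_map:
  assumes [simp]: "module k U" "module k V" "module k W" "module k U'" "module k V'" "module k W'"
    and l: "linear_map k U U' f" "linear_map k V V' g" "linear_map k W W' h"
    and t: "t \<in> carrier (tensor k (tensor k U V) W)"
  shows "tensor_reassoc k U' V' W' (tensor_map k (tensor k U' V') W' (tensor_map k U' V' f g) h t) =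
    tensor_map k U' (tensor k V' W') f (tensor_map k V' W' g h) (tensor_reassoc k U V W t)"
proof -
  note [simp] = l linear_mapD(1)[OF l(1)] linear_mapD(1)[OF l(2)] linear_mapD(1)[OF l(3)]
  have "\<forall>t\<in>carrier (tensor k (tensor k U V) W).
    tensor_reassoc k U' V' W' (tensor_map k (tensor k U' V') W' (tensor_map k U' V' f g) h t) =
    tensor_map k U' (tensor k V' W') f (tensor_map k V' W' g h) (tensor_reassoc k U V W t)"
    by (rule tensor3_left_eqI, (rule lin tensor_map_linear | simp)+)
  then show ?thesis using t by blast
qed

lemma tensor4_left_eqI:
  assumes f: "linear_map k (tensor k (tensor k (tensor k U V) W) X) M f"
    and g: "linear_map k (tensor k (tensor k (tensor k U V) W) X) M g"
    and [simp]: "module k U" "module k V" "module k W" "module k X" "module k M"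
    and e: "\<And>u v w x. u \<in> carrier U \<Longrightarrow> v \<in> carrier V \<Longrightarrow> w \<in> carrier W \<Longrightarrow> x \<in> carrier X \<Longrightarrow>
      f (simple_tensor k (tensor k (tensor k U V) W) X (simple_tensor k (tensor k U V) W (simple_tensor k U V u v) w) x) =
      g (simple_tensor k (tensor k (tensor k U V) W) X (simple_tensor k (tensor k U V) W (simple_tensor k U V u v) w) x)"
  shows "\<forall>t\<in>carrier (tensor k (tensor k (tensor k U V) W) X). f t = g t"
proof (rule tensor_eqI[OF f g], simp_all, rule ball_swap, rule ballI)
  fix x assume [simp]: "x \<in> carrier X"
  show "\<forall>s\<in>carrier (tensor k (tensor k U V) W). f (simple_tensor k (tensor k (tensor k U V) W) X s x) =
     g (simple_tensor k (tensor k (tensor k U V) W) X s x)"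
    by (rule tensor3_left_eqI, (rule lin_comp[OF _ f] lin_comp[OF _ g] lin | simp add: e)+)
qed

text \<open>
  The pentagon of the underlying \<open>k\<close>-modules, where all associators are plain rebracketings.
\<close>

lemma reassoc_pentagon:
  assumes [simp]: "module k U" "module k V" "module k W" "module k X"
    and t: "t \<in> carrier (tensor k (tensor k (tensor k U V) W) X)"
  shows "tensor_map k U (tensor k V (tensor k W X)) (\<lambda>x. x) (tensor_reassoc k V W X)
      (tensor_reassoc k U (tensor k V W) X (tensor_map k (tensor k U (tensor k V W)) X (tensor_reassoc k U V W) (\<lambda>x. x) t)) =
    tensor_reassoc k U V (tensor k W X) (tensor_reassoc k (tensor k U V) W X t)"
proof -
  note [simp] = reassoc_linear
  have "\<forall>t\<in>carrier (tensor k (tensor k (tensor k U V) W) X).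
    tensor_map k U (tensor k V (tensor k W X)) (\<lambda>x. x) (tensor_reassoc k V W X)
      (tensor_reassoc k U (tensor k V W) X (tensor_map k (tensor k U (tensor k V W)) X (tensor_reassoc k U V W) (\<lambda>x. x) t)) =
    tensor_reassoc k U V (tensor k W X) (tensor_reassoc k (tensor k U V) W X t)"
    by (rule tensor4_left_eqI, (rule lin reassoc_linear | simp)+)
  then show ?thesis using t by blast
qed

context quasi_bialgebra
begin

lemma tensor3_monoid: "Group.monoid H3"
  using assoc_algebra.axioms(2)[of k "H3"] by (simp add: ring_def)

definition phi_inv :: "('h, ('h, 'h) tens) tens" where
  "phi_inv = inv\<^bsub>H3\<^esub> phi"

lemma phi_closed [simp]: "phi \<in> carrier H3"
  using Group.monoid.Units_closed[OF tensor3_monoid reassociator_Units] .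

lemma phi_inv_closed [simp]: "phi_inv \<in> carrier H3"
  unfolding phi_inv_def by (rule Group.monoid.Units_inv_closed[OF tensor3_monoid reassociator_Units])

lemma phi_inv_left: "phi_inv \<cdot>\<^sub>3 phi = \<one>\<^bsub>H3\<^esub>"
  unfolding phi_inv_def by (rule Group.monoid.Units_l_inv[OF tensor3_monoid reassociator_Units])

lemma phi_inv_right: "phi \<cdot>\<^sub>3 phi_inv = \<one>\<^bsub>H3\<^esub>"
  unfolding phi_inv_def by (rule Group.monoid.Units_r_inv[OF tensor3_monoid reassociator_Units])

abbreviation "act3 U V W \<equiv> tensor_act k U (tensor k V W) (act U) (tensor_act k V W (act V) (act W))"

text \<open>
  \<open>\<Delta> \<otimes> id\<close> and \<open>id \<otimes> \<Delta>\<close> with values in the right-bracketed \<open>H3\<close>; these are the maps that occur in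
  quasi-coassociativity.
\<close>

abbreviation "comult_left s \<equiv> reassoc3 (tensor_map k H2 H \<Delta>\<^bsub>H\<^esub> id s)"
abbreviation "comult_right s \<equiv> tensor_map k H H2 id \<Delta>\<^bsub>H\<^esub> s"

lemma comult_left_hom: "algebra_hom k H2 H3 (\<lambda>s. comult_left s)"
  by (rule algebra_hom_comp[OF tensor_map_algebra_hom reassoc_algebra_hom]) (simp_all add: comult_hom)

lemma comult_right_hom: "algebra_hom k H2 H3 (\<lambda>s. comult_right s)"
  by (rule tensor_map_algebra_hom) (simp_all add: comult_hom)

lemma comult_left_closed [simp]: "s \<in> carrier H2 \<Longrightarrow> comult_left s \<in> carrier H3"
  by (rule linear_mapD(1)[OF algebra_homD(1)[OF comult_left_hom]])

lemma comult_right_closed [simp]: "s \<in> carrier H2 \<Longrightarrow> comult_right s \<in> carrier H3"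
  by (rule linear_mapD(1)[OF algebra_homD(1)[OF comult_right_hom]])

context
  fixes U :: "('k, 'h, 'u) lmod" and V :: "('k, 'h, 'v) lmod" and W :: "('k, 'h, 'w) lmod"
  assumes U: "left_module k H U" and V: "left_module k H V" and W: "left_module k H W"
begin

lemma act3_modules [simp]: "module k U" "module k V" "module k W"
  "is_action k H U (act U)" "is_action k H V (act V)" "is_action k H W (act W)"
  using U V W by (auto dest: left_moduleD)

lemma associator_eq:
  assumes t: "t \<in> carrier (tensor k (tensor k U V) W)"
  shows "associator k H (U, V, W) t = act3 U V W phi (tensor_reassoc k U V W t)"
  using t by (simp add: associator_def Let_def iterated_lift_act[where A=H and B=H and C=H])

lemma is_action_act3: "is_action k H3 (tensor k U (tensor k V W)) (act3 U V W)"
  by simp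

lemma act3_closed [simp]: "s \<in> carrier H3 \<Longrightarrow> t \<in> carrier (tensor k U (tensor k V W)) \<Longrightarrow>
    act3 U V W s t \<in> carrier (tensor k U (tensor k V W))"
  by (rule bilinearD(3)[OF is_action_bilinear[OF is_action_act3]])

text \<open>
  After rebracketing, \<open>h\<close> acts on \<open>(U \<otimes> V) \<otimes> W\<close> as \<open>(\<Delta> \<otimes> id) \<Delta>(h)\<close> and on \<open>U \<otimes> (V \<otimes> W)\<close> as
  \<open>(id \<otimes> \<Delta>) \<Delta>(h)\<close>.  Conjugation by \<open>\<phi>\<close> exchanges the two.
\<close>

lemma act_tensor_left:
  assumes h: "h \<in> carrier H" and t: "t \<in> carrier (tensor k (tensor k U V) W)"
  shows "tensor_reassoc k U V W (act (tensor_ob k H (tensor_ob k H U V) W) h t) =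
    act3 U V W (comult_left (\<Delta>\<^bsub>H\<^esub> h)) (tensor_reassoc k U V W t)"
proof -
  have "tensor_act k (tensor k U V) W (\<lambda>a. tensor_act k U V (act U) (act V) (\<Delta>\<^bsub>H\<^esub> a)) (\<lambda>b. act W (id b)) (\<Delta>\<^bsub>H\<^esub> h) t =
    tensor_act k (tensor k U V) W (tensor_act k U V (act U) (act V)) (act W) (tensor_map k H2 H \<Delta>\<^bsub>H\<^esub> id (\<Delta>\<^bsub>H\<^esub> h)) t"
    by (rule tensor_act_pullback[where A=H and B=H]) (simp_all add: h t)
  then have "act (tensor_ob k H (tensor_ob k H U V) W) h t =
    tensor_act k (tensor k U V) W (tensor_act k U V (act U) (act V)) (act W) (tensor_map k H2 H \<Delta>\<^bsub>H\<^esub> id (\<Delta>\<^bsub>H\<^esub> h)) t"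
    by (simp add: act_tensor_ob[abs_def])
  also have "tensor_reassoc k U V W \<dots> = act3 U V W (comult_left (\<Delta>\<^bsub>H\<^esub> h)) (tensor_reassoc k U V W t)"
    by (rule tensor_reassoc_act[where A=H and B=H and C=H]) (simp_all add: t tensor_map_closed[where A=H and B=H] h)
  finally show ?thesis .
qed

lemma act_tensor_right:
  assumes h: "h \<in> carrier H" and t: "t \<in> carrier (tensor k U (tensor k V W))"
  shows "act (tensor_ob k H U (tensor_ob k H V W)) h t = act3 U V W (comult_right (\<Delta>\<^bsub>H\<^esub> h)) t"
proof -
  have "tensor_act k U (tensor k V W) (\<lambda>a. act U (id a)) (\<lambda>b. tensor_act k V W (act V) (act W) (\<Delta>\<^bsub>H\<^esub> b)) (\<Delta>\<^bsub>H\<^esub> h) t =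
    act3 U V W (comult_right (\<Delta>\<^bsub>H\<^esub> h)) t"
    by (rule tensor_act_pullback[where A=H and B=H]) (simp_all add: h t)
  then show ?thesis by (simp add: act_tensor_ob[abs_def])
qed

text \<open>
  Equivariance is quasi-coassociativity, applied to a rebracketed tensor.  The inverse acts with
  \<open>\<phi>\<^sup>-\<^sup>1\<close> and brackets back.
\<close>

lemma associator_iso:
  "lmod_iso k H (tensor_ob k H (tensor_ob k H U V) W) (tensor_ob k H U (tensor_ob k H V W)) (associator k H (U, V, W))"
proof -
  let ?f = "\<lambda>t. act3 U V W phi (tensor_reassoc k U V W t)"
  let ?g = "\<lambda>t. tensor_unassoc k U V W (act3 U V W phi_inv t)"
  note B = is_action_bilinear[OF is_action_act3]
  have "lmod_iso k H (tensor_ob k H (tensor_ob k H U V) W) (tensor_ob k H U (tensor_ob k H V W))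
     (restrict ?f (carrier (tensor_ob k H (tensor_ob k H U V) W)))"
  proof (rule lmod_isoI[where g="?g"])
    show "linear_map k (tensor_ob k H (tensor_ob k H U V) W) (tensor_ob k H U (tensor_ob k H V W)) ?f"
      unfolding tensor_ob_simps by (rule lin_bilinear_right[OF reassoc_linear B]) simp_all
    show "linear_map k (tensor_ob k H U (tensor_ob k H V W)) (tensor_ob k H (tensor_ob k H U V) W) ?g"
      unfolding tensor_ob_simps by (rule lin_comp[OF bilinearD(1)[OF B] unassoc_linear]) simp_all
    show "?f (act (tensor_ob k H (tensor_ob k H U V) W) h t) = act (tensor_ob k H U (tensor_ob k H V W)) h (?f t)"
      if h: "h \<in> carrier H" and "t \<in> carrier (tensor_ob k H (tensor_ob k H U V) W)" for h t
    proof -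
      have t: "t \<in> carrier (tensor k (tensor k U V) W)" using that by simp
      have "?f (act (tensor_ob k H (tensor_ob k H U V) W) h t) =
        act3 U V W phi (act3 U V W (comult_left (\<Delta>\<^bsub>H\<^esub> h)) (tensor_reassoc k U V W t))"
        by (simp only: act_tensor_left[OF h t])
      also have "\<dots> = act3 U V W (phi \<cdot>\<^sub>3 comult_left (\<Delta>\<^bsub>H\<^esub> h)) (tensor_reassoc k U V W t)"
        by (rule is_actionD(3)[OF is_action_act3, symmetric]) (simp_all add: h t)
      also have "\<dots> = act3 U V W (comult_right (\<Delta>\<^bsub>H\<^esub> h) \<cdot>\<^sub>3 phi) (tensor_reassoc k U V W t)"
        by (simp only: quasi_coassoc[OF h])
      also have "\<dots> = act3 U V W (comult_right (\<Delta>\<^bsub>H\<^esub> h)) (?f t)"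
        by (rule is_actionD(3)[OF is_action_act3]) (simp_all add: h t)
      also have "\<dots> = act (tensor_ob k H U (tensor_ob k H V W)) h (?f t)"
        by (rule act_tensor_right[symmetric]) (simp_all add: h t)
      finally show ?thesis .
    qed
    show "?g (?f t) = t" if "t \<in> carrier (tensor_ob k H (tensor_ob k H U V) W)" for t
      using that is_actionD(2,3)[OF is_action_act3] phi_inv_left
      by (simp add: is_actionD(3)[OF is_action_act3, symmetric] del: tensor_one)
    show "?f (?g t) = t" if "t \<in> carrier (tensor_ob k H U (tensor_ob k H V W))" for t
      using that is_actionD(2,3)[OF is_action_act3] phi_inv_right
      by (simp add: is_actionD(3)[OF is_action_act3, symmetric] del: tensor_one)
  qed (simp_all add: U V W)
  also have "restrict ?f (carrier (tensor_ob k H (tensor_ob k H U V) W)) = associator k H (U, V, W)"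
    using associator_eq by (auto simp: fun_eq_iff associator_def)
  finally show ?thesis .
qed

end

lemma associator_natural_iso:
  "lmod_natural_iso k H (prod_cat (LMod k H) (prod_cat (LMod k H) (LMod k H)))
     (tensor_left_func k H) (tensor_right_func k H) (associator k H)"
  unfolding lmod_natural_iso_def
proof (intro conjI ballI)
  fix a assume "a \<in> Ob (prod_cat (LMod k H) (prod_cat (LMod k H) (LMod k H)))"
  then show "lmod_iso k H (on_ob (tensor_left_func k H) a) (on_ob (tensor_right_func k H) a) (associator k H a)"
    by (auto simp: tensor_left_func_def tensor_right_func_def intro: associator_iso)
next
  fix a b m assume *: "a \<in> Ob (prod_cat (LMod k H) (prod_cat (LMod k H) (LMod k H)))"
    "b \<in> Ob (prod_cat (LMod k H) (prod_cat (LMod k H) (LMod k H)))"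
    "m \<in> Hom (prod_cat (LMod k H) (prod_cat (LMod k H) (LMod k H))) a b"
  obtain U V W where a: "a = (U, V, W)" by (cases a)
  obtain U' V' W' where b: "b = (U', V', W')" by (cases b)
  obtain f g h where m: "m = (f, g, h)" by (cases m)
  have L: "left_module k H U" "left_module k H V" "left_module k H W"
    "left_module k H U'" "left_module k H V'" "left_module k H W'"
    and f: "f \<in> lmod_hom k H U U'" and g: "g \<in> lmod_hom k H V V'" and h: "h \<in> lmod_hom k H W W'"
    using * by (auto simp: a b m)
  note [simp] = L[THEN left_moduleD(1)] L[THEN left_moduleD(2)] lmod_homD(2)[OF f] lmod_homD(2)[OF g] lmod_homD(2)[OF h]
  have fg: "tensor_mor k U V U' V' f g \<in> lmod_hom k H (tensor_ob k H U V) (tensor_ob k H U' V')"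
    and gh: "tensor_mor k V W V' W' g h \<in> lmod_hom k H (tensor_ob k H V W) (tensor_ob k H V' W')"
    by (rule tensor_mor_hom, (rule L f g h)+)+
  have "associator k H (U', V', W') (tensor_mor k (tensor_ob k H U V) W (tensor_ob k H U' V') W' (tensor_mor k U V U' V' f g) h t) =
     tensor_mor k U (tensor_ob k H V W) U' (tensor_ob k H V' W') f (tensor_mor k V W V' W' g h) (associator k H (U, V, W) t)"
    if t: "t \<in> carrier (tensor k (tensor k U V) W)" for t
  proof -
    have m1: "linear_map k (tensor k U V) (tensor k U' V') (tensor_map k U' V' f g)"
      and m2: "linear_map k (tensor k V W) (tensor k V' W') (tensor_map k V' W' g h)" by simp_all
    have c: "tensor_map k (tensor k U' V') W' (tensor_map k U' V' f g) h t \<in> carrier (tensor k (tensor k U' V') W')"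
      by (rule tensor_map_closed[OF t]) simp_all
    have "tensor_mor k (tensor_ob k H U V) W (tensor_ob k H U' V') W' (tensor_mor k U V U' V' f g) h t =
      tensor_map k (tensor k U' V') W' (tensor_map k U' V' f g) h t"
      using t by (simp add: tensor_mor_def) (rule tensor_map_cong[OF t, symmetric], simp_all)
    then have "associator k H (U', V', W') (tensor_mor k (tensor_ob k H U V) W (tensor_ob k H U' V') W' (tensor_mor k U V U' V' f g) h t) =
      act3 U' V' W' phi (tensor_reassoc k U' V' W' (tensor_map k (tensor k U' V') W' (tensor_map k U' V' f g) h t))"
      using associator_eq[OF L(4-6) c] by simp
    also have "\<dots> = act3 U' V' W' phi (tensor_map k U' (tensor k V' W') f (tensor_map k V' W' g h) (tensor_reassoc k U V W t))"
      using reassoc_tensor_map[OF _ _ _ _ _ _ _ _ _ t, of U' V' W' f g h] by simp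
    also have "\<dots> = tensor_map k U' (tensor k V' W') f (tensor_map k V' W' g h) (act3 U V W phi (tensor_reassoc k U V W t))"
    proof -
      have "tensor_map k V' W' g h (tensor_act k V W (act V) (act W) s u) =
        tensor_act k V' W' (act V') (act W') s (tensor_map k V' W' g h u)"
        if "s \<in> carrier H2" "u \<in> carrier (tensor k V W)" for s u
        using tensor_map_act[where A=H and B=H and A'=H and B'=H and F="\<lambda>x. x" and G="\<lambda>x. x" and V=V and W=W and V'=V' and W'=W'
            and p="act V" and q="act W" and p'="act V'" and q'="act W'" and f=g and g=h and s=s and t=u] that
          lmod_homD(3)[OF g] lmod_homD(3)[OF h]
        by (simp add: lin_id tensor_map_ident)
      then have "tensor_map k U' (tensor k V' W') f (tensor_map k V' W' g h) (act3 U V W phi (tensor_reassoc k U V W t)) =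
        act3 U' V' W' (tensor_map k H H2 (\<lambda>x. x) (\<lambda>x. x) phi)
          (tensor_map k U' (tensor k V' W') f (tensor_map k V' W' g h) (tensor_reassoc k U V W t))"
        by (intro tensor_map_act[where A=H and B="H2"]) (simp_all add: t lin_id lmod_homD(3)[OF f])
      then show ?thesis by (simp add: tensor_map_ident)
    qed
    also have "\<dots> = tensor_mor k U (tensor_ob k H V W) U' (tensor_ob k H V' W') f (tensor_mor k V W V' W' g h) (associator k H (U, V, W) t)"
      using t act3_closed[OF L(1-3) phi_closed, of "tensor_reassoc k U V W t"]
      by (simp add: tensor_mor_def associator_eq[OF L(1-3)]) (rule tensor_map_cong[where A=U and B="tensor k V W"], simp_all)
    finally show ?thesis .
  qed
  then show "compose (carrier (on_ob (tensor_left_func k H) a)) (associator k H b) (on_mor (tensor_left_func k H) a b m) =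
    compose (carrier (on_ob (tensor_left_func k H) a)) (on_mor (tensor_right_func k H) a b m) (associator k H a)"
    by (auto simp: a b m tensor_left_func_def tensor_right_func_def compose_def fun_eq_iff)
qed (rule is_functor_tensor_left is_functor_tensor_right)+

text \<open>
  The left unitor turns the action of \<open>\<phi>\<close> into that of \<open>(id \<otimes> \<epsilon> \<otimes> id)(\<phi>) = 1 \<otimes> 1\<close>, so only the triangle for
  plain rebracketing remains, which is balancedness of the tensor product over \<open>k\<close>.
\<close>

lemma triangle:
  assumes V: "left_module k H V" and W: "left_module k H W"
    and t: "t \<in> carrier (tensor_ob k H (tensor_ob k H V (unit_ob k H)) W)"
  shows "tensor_mor k V (tensor_ob k H (unit_ob k H) W) V W (Ident (LMod k H) V) (left_unitor k H W)
      (associator k H (V, unit_ob k H, W) t) =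
    tensor_mor k (tensor_ob k H V (unit_ob k H)) W V W (right_unitor k H V) (Ident (LMod k H) W) t"
proof -
  let ?k = "base_algebra k"
  note [simp] = left_moduleD(1,2)[OF V] left_moduleD(1,2)[OF W]
  have u [simp]: "is_action k H ?k (act (unit_ob k H))"
    using left_moduleD(2)[OF left_module_unit_ob] by simp
  let ?l = "scale_left W" and ?r = "scale_right V"
  have l [simp]: "linear_map k (tensor k ?k W) W ?l" and r [simp]: "linear_map k (tensor k V ?k) V ?r"
    by (rule tensor_lift_linear; simp add: left_unitor_bilinear right_unitor_bilinear)+
  have t: "t \<in> carrier (tensor k (tensor k V ?k) W)" using t by simp
  have c: "act3 V (unit_ob k H) W phi (tensor_reassoc k V ?k W t) \<in> carrier (tensor k V (tensor k ?k W))"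
    using act3_closed[OF V left_module_unit_ob W phi_closed, of "tensor_reassoc k V ?k W t"] t by simp
  have "tensor_mor k V (tensor_ob k H (unit_ob k H) W) V W (Ident (LMod k H) V) (left_unitor k H W)
      (associator k H (V, unit_ob k H, W) t) =
    tensor_map k V W (\<lambda>v. v) ?l (act3 V (unit_ob k H) W phi (tensor_reassoc k V ?k W t))"
    using associator_eq[OF V left_module_unit_ob W, of t] t c
    by (simp add: tensor_mor_def left_unitor_def) (rule tensor_map_cong[symmetric, where A=V and B="tensor k ?k W"], simp_all)
  also have "\<dots> = tensor_act k V W (act V) (act W) (tensor_map k H H (\<lambda>x. x) counit_l phi)
      (tensor_map k V W (\<lambda>v. v) ?l (tensor_reassoc k V ?k W t))"
    by (simp, rule tensor_map_act[where A=H and B="H2"])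
      (simp_all add: t lin_id left_unitor_act[OF W])
  also have "tensor_map k H H (\<lambda>x. x) counit_l phi = \<one>\<^bsub>H2\<^esub>"
    using counit_reassociator by (simp add: counit_l_def[abs_def] id_def)
  also have "tensor_act k V W (act V) (act W) \<one>\<^bsub>H2\<^esub> (tensor_map k V W (\<lambda>v. v) ?l (tensor_reassoc k V ?k W t)) =
    tensor_map k V W (\<lambda>v. v) ?l (tensor_reassoc k V ?k W t)"
    by (rule is_actionD(2)[OF is_action_tensor])
      (simp_all add: tensor_map_closed[where A=V and B="tensor k ?k W"] t lin_id)
  also have "\<dots> = tensor_map k V W ?r (\<lambda>v. v) t"
  proof -
    have "\<forall>t\<in>carrier (tensor k (tensor k V ?k) W). tensor_map k V W (\<lambda>v. v) ?l (tensor_reassoc k V ?k W t) =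
      tensor_map k V W ?r (\<lambda>v. v) t"
    proof (rule tensor3_left_eqI)
      show "linear_map k (tensor k (tensor k V ?k) W) (tensor k V W)
         (\<lambda>t. tensor_map k V W (\<lambda>v. v) ?l (tensor_reassoc k V ?k W t))"
        by (rule lin l | simp)+
      show "linear_map k (tensor k (tensor k V ?k) W) (tensor k V W) (tensor_map k V W ?r (\<lambda>v. v))"
        by (simp add: lin_id)
      fix v c w assume "v \<in> carrier V" "c \<in> carrier ?k" "w \<in> carrier W"
      then show "tensor_map k V W (\<lambda>v. v) ?l (tensor_reassoc k V ?k W (simple_tensor k (tensor k V ?k) W (simple_tensor k V ?k v c) w)) =
        tensor_map k V W ?r (\<lambda>v. v) (simple_tensor k (tensor k V ?k) W (simple_tensor k V ?k v c) w)"
        using bilinearD(6,7)[OF simple_bilinear, of k V W c v w]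
        by (simp add: lin_id tensor_lift_simple[OF _ _ _ left_unitor_bilinear] tensor_lift_simple[OF _ _ _ right_unitor_bilinear])
    qed simp_all
    then show ?thesis using t by blast
  qed
  also have "\<dots> = tensor_mor k (tensor_ob k H V (unit_ob k H)) W V W (right_unitor k H V) (Ident (LMod k H) W) t"
    using t by (simp add: tensor_mor_def right_unitor_def) (rule tensor_map_cong[OF t], simp_all)
  finally show ?thesis .
qed


section \<open>The pentagon\<close>

lemma is_action_tensor_ob:
  assumes "left_module k H V" "left_module k H W"
  shows "is_action k H (tensor k V W) (\<lambda>h. tensor_act k V W (act V) (act W) (\<Delta>\<^bsub>H\<^esub> h))"
  by (rule is_action_pullback[OF is_action_tensor comult_hom]) (use assms in \<open>simp_all add: left_moduleD\<close>)

lemma act_tensor_ob_fun: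
  "act (tensor_ob k H V W) = (\<lambda>h. tensor_act k V W (act V) (act W) (\<Delta>\<^bsub>H\<^esub> h))"
  by (simp add: fun_eq_iff)

text \<open>
  On both sides all actions of \<open>\<phi>\<close> are moved to the outside, past the rebracketing maps.  Acting on a
  tensor product of \<open>H\<close>-modules introduces a \<open>\<Delta>\<close> in the corresponding component of \<open>\<phi>\<close>, and rebracketing
  the module rebrackets the acting element.  What acts in the end are the two sides of the pentagon
  for \<open>\<phi>\<close>, on the same element of \<open>V \<otimes> (W \<otimes> (X \<otimes> Y))\<close> by the pentagon for rebracketing.
\<close>

lemma pentagon_identity:
  assumes V: "left_module k H V" and W: "left_module k H W" and X: "left_module k H X" and Y: "left_module k H Y"
    and t: "t \<in> carrier (tensor_ob k H (tensor_ob k H (tensor_ob k H V W) X) Y)"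
  shows "associator k H (V, W, tensor_ob k H X Y) (associator k H (tensor_ob k H V W, X, Y) t) =
        tensor_mor k V (tensor_ob k H (tensor_ob k H W X) Y) V (tensor_ob k H W (tensor_ob k H X Y))
          (Ident (LMod k H) V) (associator k H (W, X, Y))
          (associator k H (V, tensor_ob k H W X, Y)
            (tensor_mor k (tensor_ob k H (tensor_ob k H V W) X) Y
               (tensor_ob k H V (tensor_ob k H W X)) Y
               (associator k H (V, W, X)) (Ident (LMod k H) Y) t))" (is "?lhs = ?rhs")
proof -
  note m [simp] = left_moduleD(1,2)[OF V] left_moduleD(1,2)[OF W] left_moduleD(1,2)[OF X] left_moduleD(1,2)[OF Y]
  note [simp] = is_action_tensor_ob[OF V W] is_action_tensor_ob[OF W X] is_action_tensor_ob[OF X Y]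
  have t [simp]: "t \<in> carrier (tensor k (tensor k (tensor k V W) X) Y)" using t by simp
  let ?a = "\<lambda>V. act V" and ?\<phi> = "phi"
  let ?XY = "tensor k X Y" and ?WX = "tensor k W X"
  let ?aXY = "tensor_act k X Y (act X) (act Y)" and ?aWX = "tensor_act k W X (act W) (act X)"
  let ?aWXY = "tensor_act k W ?XY (act W) ?aXY"
  let ?M = "tensor k V (tensor k W ?XY)"
  let ?a4 = "tensor_act k V (tensor k W ?XY) (act V) ?aWXY"
  have a4: "is_action k H4 ?M ?a4" by simp
  let ?R = "tensor_reassoc k V W ?XY (tensor_reassoc k (tensor k V W) X Y t)"
  have R [simp]: "?R \<in> carrier ?M" by simp
  have rl: "linear_map k (tensor k (tensor k A B) C) (tensor k A (tensor k B C)) (tensor_reassoc k A B C)"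
    if "module k A" "module k B" "module k C" for A B C using that by (rule reassoc_linear)
  let ?p1 = "reassoc4 (tensor_map k H2 H2 \<Delta>\<^bsub>H\<^esub> id ?\<phi>)"
  let ?p2 = "tensor_map k H H3 id (tensor_map k H H2 id \<Delta>\<^bsub>H\<^esub>) ?\<phi>"
  let ?q1 = "tensor_map k H H3 id reassoc3
         (tensor_reassoc k H H2 H (simple_tensor k H3 H ?\<phi> \<one>\<^bsub>H\<^esub>))"
  let ?q2 = "tensor_map k H H3 id (\<lambda>t. comult_left t) ?\<phi>"
  let ?q3 = "pure4 \<one>\<^bsub>H\<^esub> ?\<phi>"
  have one [simp]: "\<one>\<^bsub>H\<^esub> \<in> carrier H" by simp
  have c1 [simp]: "tensor_map k H2 H2 \<Delta>\<^bsub>H\<^esub> id ?\<phi> \<in> carrier (tensor k H2 H2)"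
    by (rule tensor_map_closed[OF phi_closed]) simp_all
  have p1 [simp]: "?p1 \<in> carrier H4" by simp
  have p2 [simp]: "?p2 \<in> carrier H4" by (rule tensor_map_closed[OF phi_closed]) simp_all
  have q1 [simp]: "?q1 \<in> carrier H4"
    by (rule tensor_map_closed[where A=H and B="tensor k H2 H"]) (simp_all add: rl)
  have q2 [simp]: "?q2 \<in> carrier H4"
    by (rule tensor_map_closed[OF phi_closed]) (simp_all add: algebra_homD(1)[OF comult_left_hom])
  have q3 [simp]: "?q3 \<in> carrier H4" by simp
  \<comment> \<open>the first associator on the left acts with \<open>(\<Delta> \<otimes> id \<otimes> id)(\<phi>)\<close>, before the final rebracketing\<close>
  have L1: "associator k H (tensor_ob k H V W, X, Y) t =
     tensor_act k (tensor k V W) ?XY (tensor_act k V W (act V) (act W)) ?aXY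
       (tensor_map k H2 H2 \<Delta>\<^bsub>H\<^esub> id ?\<phi>) (tensor_reassoc k (tensor k V W) X Y t)" (is "_ = ?u")
  proof -
    have "associator k H (tensor_ob k H V W, X, Y) t = 
      tensor_act k (tensor k V W) ?XY (\<lambda>h. tensor_act k V W (act V) (act W) (\<Delta>\<^bsub>H\<^esub> h)) (\<lambda>s. ?aXY (id s))
        ?\<phi> (tensor_reassoc k (tensor k V W) X Y t)"
      using associator_eq[of "tensor_ob k H V W" X Y t] V W X Y by (simp add: act_tensor_ob_fun)
    also have "\<dots> = ?u"
      by (rule tensor_act_pullback[where A=H and B="H2"]) simp_all
    finally show ?thesis .
  qed
  have u: "?u \<in> carrier (tensor k (tensor k V W) ?XY)"
    by (rule tensor_act_closed[OF c1]) simp_all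
  have "?lhs = tensor_act k V (tensor k W ?XY) (\<lambda>a. act V (id a)) (\<lambda>s. tensor_act k W ?XY (act W)
      (\<lambda>h. ?aXY (\<Delta>\<^bsub>H\<^esub> h)) s) ?\<phi> (tensor_reassoc k V W ?XY ?u)"
    using associator_eq[OF V W, of "tensor_ob k H X Y" ?u] X Y u L1 by (simp add: act_tensor_ob_fun)
  also have "\<dots> = tensor_act k V (tensor k W ?XY) (\<lambda>a. act V (id a)) (\<lambda>s. ?aWXY (comult_right s)) ?\<phi> (tensor_reassoc k V W ?XY ?u)"
  proof (rule tensor_act_cong[where A=H and B="H2"])
    show "tensor_act k W ?XY (act W) (\<lambda>h. ?aXY (\<Delta>\<^bsub>H\<^esub> h)) b w = ?aWXY (comult_right b) w"
      if "b \<in> carrier H2" "w \<in> carrier (tensor k W ?XY)" for b w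
      using tensor_act_pullback[where A=H and B=H and A'=H and B'="H2" and V=W and W="?XY" and p="act W" and q="?aXY"
        and F=id and G="\<Delta>\<^bsub>H\<^esub>" and s=b and t=w] that by simp
    show "bilinear k H2 (tensor k W ?XY) (tensor k W ?XY) (\<lambda>s. ?aWXY (comult_right s))"
      by (rule bilinear_comp_lin[where G="\<lambda>x. x" and V'="tensor k W ?XY" and A'="H3"]) (simp_all add: algebra_homD(1)[OF comult_right_hom])
  qed (use u in simp_all)
  also have "\<dots> = ?a4 ?p2 (tensor_reassoc k V W ?XY ?u)"
    by (rule tensor_act_pullback[where A=H and B="H2"]) (use u in \<open>simp_all add: algebra_homD(1)[OF comult_right_hom]\<close>)
  also have "tensor_reassoc k V W ?XY ?u = ?a4 ?p1 ?R"
    by (rule tensor_reassoc_act[where A=H and B=H and C="H2"]) simp_all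
  also have "?a4 ?p2 (?a4 ?p1 ?R) = ?a4 (?p2 \<cdot>\<^sub>4 ?p1) ?R"
    by (rule is_actionD(3)[OF a4, symmetric]) simp_all
  also have "\<dots> = ?a4 (?q3 \<cdot>\<^sub>4 ?q2 \<cdot>\<^sub>4 ?q1) ?R"
    by (simp only: pentagon)
  also have "\<dots> = ?a4 (?q3 \<cdot>\<^sub>4 ?q2) (?a4 ?q1 ?R)"
    by (rule is_actionD(3)[OF a4]) (simp_all add: assoc_algebra_closed[of k])
  also have "\<dots> = ?a4 ?q3 (?a4 ?q2 (?a4 ?q1 ?R))"
    by (rule is_actionD(3)[OF a4]) (simp_all add: bilinearD(3)[OF is_action_bilinear[OF a4]])
  finally have lhs: "?lhs = ?a4 ?q3 (?a4 ?q2 (?a4 ?q1 ?R))" .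

  let ?r1 = "tensor_map k (tensor k V ?WX) Y (tensor_reassoc k V W X) (\<lambda>y. y) t"
  let ?aVWX = "tensor_act k V ?WX (act V) ?aWX"
  have rVWX: "linear_map k (tensor k (tensor k V W) X) (tensor k V ?WX) (tensor_reassoc k V W X)" by (simp add: rl)
  have r1 [simp]: "?r1 \<in> carrier (tensor k (tensor k V ?WX) Y)"
    by (rule tensor_map_closed[OF t]) (simp_all add: rl)
  let ?s1 = "tensor_act k (tensor k V ?WX) Y ?aVWX (act Y) (simple_tensor k H3 H ?\<phi> \<one>\<^bsub>H\<^esub>) ?r1"
  have assocl: "linear_map k (tensor k (tensor k A B) C) (tensor k A (tensor k B C)) (associator k H (A, B, C))"
    if "left_module k H A" "left_module k H B" "left_module k H C" for A B C
    using associator_iso[OF that] by (auto simp: lmod_iso_def dest: lmod_homD(2))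
  \<comment> \<open>\<open>associator \<otimes> id\<close> acts with \<open>\<phi> \<otimes> 1\<close>\<close>
  have S1: "tensor_mor k (tensor_ob k H (tensor_ob k H V W) X) Y (tensor_ob k H V (tensor_ob k H W X)) Y
               (associator k H (V, W, X)) (Ident (LMod k H) Y) t = ?s1"
  proof -
    have "tensor_mor k (tensor_ob k H (tensor_ob k H V W) X) Y (tensor_ob k H V (tensor_ob k H W X)) Y
               (associator k H (V, W, X)) (Ident (LMod k H) Y) t =
      tensor_map k (tensor k V ?WX) Y (associator k H (V, W, X)) (\<lambda>y\<in>carrier Y. y) t"
      by (simp add: tensor_mor_def)
    also have "\<dots> = tensor_map k (tensor k V ?WX) Y (\<lambda>s. ?aVWX ?\<phi> (tensor_reassoc k V W X s)) (\<lambda>y. act Y \<one>\<^bsub>H\<^esub> y) t"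
      by (rule tensor_map_cong[OF t]) (simp_all add: assocl V W X associator_eq is_actionD(2)[OF m(8)])
    also have "\<dots> = tensor_map k (tensor k V ?WX) Y (\<lambda>s. ?aVWX ?\<phi> s) (\<lambda>y. act Y \<one>\<^bsub>H\<^esub> y) ?r1"
      by (rule tensor_map_comp[OF t, symmetric])
       (simp_all add: rl bilinearD(1)[OF is_action_bilinear[OF is_action_act3[OF V W X]]] bilinearD(1)[OF is_action_bilinear[OF m(8)]])
    also have "\<dots> = ?s1"
      by (rule tensor_act_simple_left[symmetric, where A="H3" and B=H]) simp_all
    finally show ?thesis .
  qed
  have s1 [simp]: "?s1 \<in> carrier (tensor k (tensor k V ?WX) Y)"
    by (rule tensor_act_closed[where A="H3" and B=H]) simp_all
  let ?aWXYl = "tensor_act k ?WX Y ?aWX (act Y)"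
  let ?MM = "tensor k V (tensor k ?WX Y)"
  let ?b4 = "tensor_act k V (tensor k ?WX Y) (act V) ?aWXYl"
  let ?q2' = "tensor_map k H (tensor k H2 H) id (tensor_map k H2 H \<Delta>\<^bsub>H\<^esub> id) ?\<phi>"
  let ?q1' = "tensor_reassoc k H H2 H (simple_tensor k H3 H ?\<phi> \<one>\<^bsub>H\<^esub>)"
  let ?r2 = "tensor_reassoc k V ?WX Y ?r1"
  have q2' [simp]: "?q2' \<in> carrier (tensor k H (tensor k H2 H))"
    by (rule tensor_map_closed[OF phi_closed]) simp_all
  \<comment> \<open>the second associator on the right adds \<open>(id \<otimes> \<Delta> \<otimes> id)(\<phi>)\<close>\<close>
  have S2: "associator k H (V, tensor_ob k H W X, Y) ?s1 = ?b4 ?q2' (?b4 ?q1' ?r2)"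
  proof -
    have "associator k H (V, tensor_ob k H W X, Y) ?s1 =
      tensor_act k V (tensor k ?WX Y) (\<lambda>a. act V (id a)) (\<lambda>s. tensor_act k ?WX Y (\<lambda>h. ?aWX (\<Delta>\<^bsub>H\<^esub> h)) (act Y) s)
        ?\<phi> (tensor_reassoc k V ?WX Y ?s1)"
      using associator_eq[OF V _ Y, of "tensor_ob k H W X" ?s1] W X s1 by (simp add: act_tensor_ob_fun)
    also have "\<dots> = tensor_act k V (tensor k ?WX Y) (\<lambda>a. act V (id a)) (\<lambda>s. ?aWXYl (tensor_map k H2 H \<Delta>\<^bsub>H\<^esub> id s))
        ?\<phi> (tensor_reassoc k V ?WX Y ?s1)"
    proof (rule tensor_act_cong[where A=H and B="H2"])
      show "tensor_act k ?WX Y (\<lambda>h. ?aWX (\<Delta>\<^bsub>H\<^esub> h)) (act Y) b w = ?aWXYl (tensor_map k H2 H \<Delta>\<^bsub>H\<^esub> id b) w"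
        if "b \<in> carrier H2" "w \<in> carrier (tensor k ?WX Y)" for b w
        using tensor_act_pullback[where A=H and B=H and B'=H and A'="H2" and V="?WX" and W=Y and p="?aWX" and q="act Y"
          and F="\<Delta>\<^bsub>H\<^esub>" and G=id and s=b and t=w] that by simp
      show "bilinear k H2 (tensor k ?WX Y) (tensor k ?WX Y) (\<lambda>s. ?aWXYl (tensor_map k H2 H \<Delta>\<^bsub>H\<^esub> id s))"
        by (rule bilinear_comp_lin[where G="\<lambda>x. x" and V'="tensor k ?WX Y" and A'="tensor k H2 H"]) simp_all
    qed simp_all
    also have "\<dots> = ?b4 ?q2' (tensor_reassoc k V ?WX Y ?s1)"
      by (rule tensor_act_pullback[where A=H and B="H2"]) simp_all
    also have "tensor_reassoc k V ?WX Y ?s1 = ?b4 ?q1' ?r2"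
      by (rule tensor_reassoc_act[where A=H and B="H2" and C=H]) simp_all
    finally show ?thesis .
  qed
  let ?rho = "tensor_map k V (tensor k W ?XY) (\<lambda>v. v) (tensor_reassoc k W X Y)"
  have b4: "is_action k (tensor k H (tensor k H2 H)) ?MM ?b4" by simp
  have bc [simp]: "?b4 ?q1' ?r2 \<in> carrier ?MM" by (rule bilinearD(3)[OF is_action_bilinear[OF b4]]) simp_all
  have bc' [simp]: "?b4 ?q2' (?b4 ?q1' ?r2) \<in> carrier ?MM" by (rule bilinearD(3)[OF is_action_bilinear[OF b4]]) simp_all
  \<comment> \<open>\<open>id \<otimes> rebracketing\<close> carries both actions into \<open>V \<otimes> (W \<otimes> (X \<otimes> Y))\<close>\<close>
  have rho_b4: "?rho (?b4 s u) = ?a4 (tensor_map k H H3 id reassoc3 s) (?rho u)"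
    if "s \<in> carrier (tensor k H (tensor k H2 H))" "u \<in> carrier ?MM" for s u
    by (rule tensor_map_act[where A=H and B="tensor k H2 H"])
      (simp_all add: that rl tensor_reassoc_act[where A=H and B=H and C=H])
  have rc [simp]: "?rho u \<in> carrier ?M" if "u \<in> carrier ?MM" for u
    by (rule tensor_map_closed[OF that]) (simp_all add: rl)
  have "?rhs = tensor_map k V (tensor k W ?XY) (\<lambda>v\<in>carrier V. v) (associator k H (W, X, Y)) (?b4 ?q2' (?b4 ?q1' ?r2))"
    using S1 S2 bc' by (simp add: tensor_mor_def)
  also have "\<dots> = tensor_map k V (tensor k W ?XY) (\<lambda>v. act V \<one>\<^bsub>H\<^esub> v) (\<lambda>s. ?aWXY ?\<phi> (tensor_reassoc k W X Y s)) (?b4 ?q2' (?b4 ?q1' ?r2))"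
    by (rule tensor_map_cong[OF bc']) (simp_all add: assocl W X Y associator_eq is_actionD(2)[OF m(2)])
  also have "\<dots> = tensor_map k V (tensor k W ?XY) (\<lambda>v. act V \<one>\<^bsub>H\<^esub> v) (?aWXY ?\<phi>) (?rho (?b4 ?q2' (?b4 ?q1' ?r2)))"
    by (rule tensor_map_comp[OF bc', symmetric])
     (simp_all add: rl bilinearD(1)[OF is_action_bilinear[OF is_action_act3[OF W X Y]]] bilinearD(1)[OF is_action_bilinear[OF m(2)]])
  also have "\<dots> = ?a4 ?q3 (?rho (?b4 ?q2' (?b4 ?q1' ?r2)))"
    by (rule tensor_act_simple_left[symmetric, where A=H and B="H3"]) simp_all
  also have "?rho (?b4 ?q2' (?b4 ?q1' ?r2)) =
     ?a4 (tensor_map k H H3 id reassoc3 ?q2') (?a4 ?q1 (?rho ?r2))"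
    by (simp add: rho_b4)
  also have "tensor_map k H H3 id reassoc3 ?q2' = ?q2"
    using tensor_map_comp[OF phi_closed, where f=id and f'=id and V=H and V'=H and g="tensor_map k H2 H \<Delta>\<^bsub>H\<^esub> id"
      and W="tensor k H2 H" and W'="H3" and g'="reassoc3"]
    by (simp add: rl id_def)
  also have "?rho ?r2 = ?R"
    by (rule reassoc_pentagon) simp_all
  finally have rhs: "?rhs = ?a4 ?q3 (?a4 ?q2 (?a4 ?q1 ?R))" .
  show ?thesis by (rule HOL.trans[OF lhs rhs[symmetric]])
qed

end

lemma simple_smult:
  assumes "module k V" "module k W" "c \<in> carrier k" "v \<in> carrier V" "w \<in> carrier W"
  shows "simple_tensor k V W (c \<odot>\<^bsub>V\<^esub> v) w = c \<odot>\<^bsub>tensor k V W\<^esub> simple_tensor k V W v w"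
    and "simple_tensor k V W v (c \<odot>\<^bsub>W\<^esub> w) = c \<odot>\<^bsub>tensor k V W\<^esub> simple_tensor k V W v w"
  by (rule bilinearD(6,7)[OF simple_bilinear]; fact)+

section \<open>The counit in the last slot of the reassociator\<close>

context quasi_bialgebra
begin

lemma H_unit_smult [simp]:
  "\<one>\<^bsub>H\<^esub> \<in> carrier H"
  "a \<in> carrier H \<Longrightarrow> \<one>\<^bsub>H\<^esub> \<cdot> a = a"
  "a \<in> carrier H \<Longrightarrow> a \<cdot> \<one>\<^bsub>H\<^esub> = a"
  "c \<in> carrier k \<Longrightarrow> a \<in> carrier H \<Longrightarrow> c \<odot>\<^bsub>H\<^esub> a \<in> carrier H"
  "a \<in> carrier H \<Longrightarrow> \<one>\<^bsub>k\<^esub> \<odot>\<^bsub>H\<^esub> a = a"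
  by simp_all

lemma H_assoc: "a \<in> carrier H \<Longrightarrow> b \<in> carrier H \<Longrightarrow> c \<in> carrier H \<Longrightarrow>
   a \<cdot> b \<cdot> c = a \<cdot> (b \<cdot> c)"
  using assoc_algebra.axioms(2)[OF H_algebra(1)] by (simp add: ring_def Group.monoid.m_assoc)

lemmas H_smult = smult_mult_left smult_mult_right

lemma counit_mult [simp]: "a \<in> carrier H \<Longrightarrow> b \<in> carrier H \<Longrightarrow> \<epsilon>\<^bsub>H\<^esub> (a \<cdot> b) = \<epsilon>\<^bsub>H\<^esub> a \<otimes>\<^bsub>k\<^esub> \<epsilon>\<^bsub>H\<^esub> b"
  using multiplicativeD[OF algebra_homD(2)[OF counit_hom]] by simp

lemma counit_one [simp]: "\<epsilon>\<^bsub>H\<^esub> \<one>\<^bsub>H\<^esub> = \<one>\<^bsub>k\<^esub>"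
  using algebra_homD(3)[OF counit_hom] by simp

lemma comult_one [simp]: "\<Delta>\<^bsub>H\<^esub> \<one>\<^bsub>H\<^esub> = pure2 \<one>\<^bsub>H\<^esub> \<one>\<^bsub>H\<^esub>"
  using algebra_homD(3)[OF comult_hom] by simp

lemmas H_lin [lin] = lin_comp[OF _ comult_linear] lin_comp[OF _ counit_linear]
  lin_comp[OF _ counit_l_linear] lin_comp[OF _ counit_r_linear]

lemma counit_l_closed [simp]: "s \<in> carrier H2 \<Longrightarrow> counit_l s \<in> carrier H"
  by (rule linear_mapD(1)[OF counit_l_linear])

lemma counit_r_closed [simp]: "s \<in> carrier H2 \<Longrightarrow> counit_r s \<in> carrier H"
  by (rule linear_mapD(1)[OF counit_r_linear])

lemma counit_l_hom [simp]: "algebra_hom k H2 H counit_l"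
proof (rule algebra_homI)
  have "counit_l (s \<cdot>\<^sub>2 t) = counit_l s \<cdot> counit_l t"
    if s: "s \<in> carrier H2" "t \<in> carrier H2" for s t
    by (rule bilinear_eqI[OF bilinear_lin_comp[OF mult_bilinear counit_l_linear]
          bilinear_comp_lin[OF mult_bilinear counit_l_linear counit_l_linear] _ _ _ _ _ _ s])
      (simp_all add: H_smult smult_assoc1 smult_left_comm[of k H])
  then show "multiplicative H2 H counit_l" by (simp add: multiplicative_def)
qed simp_all

lemma counit_r_hom [simp]: "algebra_hom k H2 H counit_r"
proof (rule algebra_homI)
  have "counit_r (s \<cdot>\<^sub>2 t) = counit_r s \<cdot> counit_r t"
    if s: "s \<in> carrier H2" "t \<in> carrier H2" for s t
    by (rule bilinear_eqI[OF bilinear_lin_comp[OF mult_bilinear counit_r_linear]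
          bilinear_comp_lin[OF mult_bilinear counit_r_linear counit_r_linear] _ _ _ _ _ _ s])
      (simp_all add: H_smult smult_assoc1 smult_left_comm[of k H])
  then show "multiplicative H2 H counit_r" by (simp add: multiplicative_def)
qed simp_all

abbreviation "on_tail f \<equiv> tensor_map k H H id f"

text \<open>
  The map \<open>q \<mapsto> q \<otimes> 1\<close> into the right-bracketed \<open>H4\<close>.
\<close>

definition pad :: "('h, ('h, 'h) tens) tens \<Rightarrow> ('h, ('h, ('h, 'h) tens) tens) tens" where
  "pad q = tensor_map k H H3 id reassoc3
         (tensor_reassoc k H H2 H (simple_tensor k H3 H q \<one>\<^bsub>H\<^esub>))"

lemma reassoc_H_linear [simp]: "linear_map k (tensor k H2 H) H3 reassoc3"
  by (rule reassoc_linear) simp_all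

lemma pad_hom: "algebra_hom k H3 H4 pad"
proof -
  have 1: "algebra_hom k H3 (tensor k H3 H) (\<lambda>q. simple_tensor k H3 H q \<one>\<^bsub>H\<^esub>)"
    by (rule algebra_homI) (rule lin | simp add: multiplicative_def assoc_algebra_closed[of k])+
  have 2: "algebra_hom k (tensor k H3 H) (tensor k H (tensor k H2 H)) (tensor_reassoc k H H2 H)"
    by (rule reassoc_algebra_hom) simp_all
  have 3: "algebra_hom k (tensor k H (tensor k H2 H)) H4 (tensor_map k H H3 id reassoc3)"
    by (rule tensor_map_algebra_hom) simp_all
  show ?thesis unfolding pad_def[abs_def] by (rule algebra_hom_comp[OF algebra_hom_comp[OF 1 2] 3])
qed

lemma pad_linear [simp]: "linear_map k H3 H4 pad"
  by (rule algebra_homD(1)[OF pad_hom])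

lemma pad_closed [simp]: "q \<in> carrier H3 \<Longrightarrow> pad q \<in> carrier H4"
  by (rule linear_mapD(1)[OF pad_linear])

lemma pad_simple [simp]: "a \<in> carrier H \<Longrightarrow> b \<in> carrier H \<Longrightarrow> c \<in> carrier H \<Longrightarrow>
   pad (pure3 a (pure2 b c)) =
   pure4 a (pure3 b (pure2 c \<one>\<^bsub>H\<^esub>))"
  by (simp add: pad_def)

text \<open>
  Together with \<open>pad\<close> these are the five algebra maps from \<open>H3\<close> to \<open>H4\<close> that are applied to \<open>\<phi>\<close> in the
  pentagon; the digits give the two slots that receive a comultiplied component.
\<close>

abbreviation "comult_34 p \<equiv> tensor_map k H H3 id (\<lambda>t. comult_right t) p"
abbreviation "comult_23 p \<equiv> tensor_map k H H3 id (\<lambda>t. comult_left t) p"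
abbreviation "comult_12 p \<equiv> reassoc4 (tensor_map k H2 H2 \<Delta>\<^bsub>H\<^esub> id p)"
abbreviation "shift p \<equiv> pure4 \<one>\<^bsub>H\<^esub> p"

lemma comult_34_hom: "algebra_hom k H3 H4 (\<lambda>p. comult_34 p)"
  by (rule tensor_map_algebra_hom) (simp_all add: comult_right_hom)

lemma comult_23_hom: "algebra_hom k H3 H4 (\<lambda>p. comult_23 p)"
  by (rule tensor_map_algebra_hom) (simp_all add: comult_left_hom)

lemma comult_12_hom: "algebra_hom k H3 H4 (\<lambda>p. comult_12 p)"
  by (rule algebra_hom_comp[OF tensor_map_algebra_hom reassoc_algebra_hom]) (simp_all add: comult_hom)

lemma shift_hom: "algebra_hom k H3 H4 (\<lambda>p. shift p)"
  by (rule algebra_homI) (rule lin | simp add: multiplicative_def assoc_algebra_closed[of k])+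

lemma pentagon_embedded: "comult_34 phi \<cdot>\<^sub>4 comult_12 phi =
   shift phi \<cdot>\<^sub>4 comult_23 phi \<cdot>\<^sub>4 pad phi"
  unfolding pad_def using pentagon by simp

lemma counit_middle_phi: "on_tail counit_l phi = \<one>\<^bsub>H2\<^esub>"
  using counit_reassociator by (simp add: counit_l_def[abs_def])

lemma counit_l_comult_left:
  assumes t: "t \<in> carrier H2"
  shows "on_tail counit_l (comult_left t) = t"
proof -
  have 1: "\<forall>u\<in>carrier H2. on_tail counit_l (reassoc3 (simple_tensor k H2 H u y)) =
     pure2 (counit_r u) y" if [simp]: "y \<in> carrier H" for y
    by (rule tensor_eqI, (rule lin | simp add: simple_smult)+)
  have "\<forall>t\<in>carrier H2. on_tail counit_l (comult_left t) = t"
    by (rule tensor_eqI, (rule lin | simp add: 1)+)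
  then show ?thesis using t by blast
qed

lemma tensor4_monoid: "Group.monoid H4"
  using assoc_algebra.axioms(2)[of k "H4"] by (simp add: ring_def)

text \<open>
  Apply the counit to the third slot of the pentagon.  By the counit axioms and the normalisation of
  the middle component, the two outer comultiplications of \<open>\<phi>\<close> become \<open>\<phi>\<close> and \<open>1\<close> on the left, and \<open>1\<close> and
  \<open>\<phi>\<close> on the right, where the factor \<open>(id \<otimes> id \<otimes> \<epsilon>)(\<phi>) \<otimes> 1\<close> is left over.  Cancelling \<open>\<phi>\<close> shows that it is \<open>1\<close>.
\<close>

lemma counit_last_phi: "on_tail counit_r phi = \<one>\<^bsub>H2\<^esub>"
proof -
  let ?F = "tensor_map k H H2 id (on_tail counit_l)"
  have F: "algebra_hom k H4 H3 ?F"
    by (rule tensor_map_algebra_hom) simp_all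
  note Fl = algebra_homD(1)[OF F]
  note c = linear_mapD(1)[OF algebra_homD(1)[OF comult_34_hom] phi_closed] linear_mapD(1)[OF algebra_homD(1)[OF comult_23_hom] phi_closed]
    linear_mapD(1)[OF algebra_homD(1)[OF comult_12_hom] phi_closed] linear_mapD(1)[OF algebra_homD(1)[OF shift_hom] phi_closed]
  note cl = algebra_homD(1)[OF comult_left_hom] and cr = algebra_homD(1)[OF comult_right_hom]
  have "\<forall>p\<in>carrier H3. ?F (comult_34 p) = p"
    by (rule tensor3_eqI, (rule lin cr | simp add: cr)+)
  then have f34: "?F (comult_34 phi) = phi" by simp
  have "\<forall>p\<in>carrier H3. ?F (comult_23 p) = p"
    by (rule tensor_eqI, (rule lin cl | simp add: cl counit_l_comult_left)+)
  then have f23: "?F (comult_23 phi) = phi" by simp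
  have fs: "?F (shift phi) = \<one>\<^bsub>H3\<^esub>" using counit_middle_phi by simp
  have 1: "\<forall>u\<in>carrier H2. ?F (reassoc4 (simple_tensor k H2 H2 u t)) =
    reassoc3 (simple_tensor k H2 H u (counit_l t))" if [simp]: "t \<in> carrier H2" for t
    by (rule tensor_eqI, (rule lin | simp)+)
  have "\<forall>p\<in>carrier H3. ?F (comult_12 p) = comult_left (on_tail counit_l p)"
    by (rule tensor_eqI, (rule lin cl | simp add: 1)+)
  then have f12: "?F (comult_12 phi) = \<one>\<^bsub>H3\<^esub>" by (simp add: counit_middle_phi)
  have "\<forall>p\<in>carrier H3. ?F (pad p) = reassoc3 (simple_tensor k H2 H (on_tail counit_r p) \<one>\<^bsub>H\<^esub>)"
    by (rule tensor3_eqI, (rule lin lin_comp[OF _ pad_linear] | simp add: simple_smult linear_mapD(3)[OF reassoc_H_linear])+)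
  then have fp: "?F (pad phi) = reassoc3 (simple_tensor k H2 H (on_tail counit_r phi) \<one>\<^bsub>H\<^esub>)" (is "_ = ?e")
    by simp
  have sc: "on_tail counit_r phi \<in> carrier H2" by (rule tensor_map_closed[OF phi_closed]) simp_all
  then have ec: "?e \<in> carrier H3" by simp
  have t4: "a \<cdot>\<^sub>4 b \<in> carrier H4" if "a \<in> carrier H4" "b \<in> carrier H4" for a b
    using that by (simp add: assoc_algebra_closed[of k])
  interpret M: Group.monoid "H3" by (rule tensor3_monoid)
  have "phi \<cdot>\<^sub>3 \<one>\<^bsub>H3\<^esub> = \<one>\<^bsub>H3\<^esub> \<cdot>\<^sub>3 phi \<cdot>\<^sub>3 ?e"
    using arg_cong[OF pentagon_embedded, of ?F] c pad_closed[OF phi_closed] t4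
    by (simp only: multiplicativeD[OF algebra_homD(2)[OF F]] f34 f23 fs f12 fp)
  then have "phi \<cdot>\<^sub>3 ?e = phi" using ec by (simp del: tensor_one)
  then have "phi_inv \<cdot>\<^sub>3 (phi \<cdot>\<^sub>3 ?e) = \<one>\<^bsub>H3\<^esub>" by (simp only: phi_inv_left)
  then have e1: "?e = \<one>\<^bsub>H3\<^esub>"
    using ec by (simp add: M.m_assoc[symmetric] phi_inv_left del: tensor_one)
  \<comment> \<open>a further counit removes the factor \<open>1\<close> in the last slot\<close>
  have "\<forall>u\<in>carrier H2. on_tail counit_r (reassoc3 (simple_tensor k H2 H u \<one>\<^bsub>H\<^esub>)) = u"
    by (rule tensor_eqI, (rule lin | simp)+)
  then have "on_tail counit_r phi = on_tail counit_r ?e" using sc by simp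
  also have "\<dots> = \<one>\<^bsub>H2\<^esub>" by (simp add: e1)
  finally show ?thesis .
qed

lemma on_tail_inv:
  assumes f: "algebra_hom k H2 H f" and 1: "on_tail f phi = \<one>\<^bsub>H2\<^esub>"
  shows "on_tail f phi_inv = \<one>\<^bsub>H2\<^esub>"
proof -
  have F: "algebra_hom k H3 H2 (on_tail f)"
    by (rule tensor_map_algebra_hom) (simp_all add: f)
  interpret M: ring "H2" using assoc_algebra.axioms(2)[of k "H2"] by simp
  have c: "on_tail f phi_inv \<in> carrier H2" by (rule linear_mapD(1)[OF algebra_homD(1)[OF F]]) simp
  have "on_tail f phi_inv \<cdot>\<^sub>2 on_tail f phi = \<one>\<^bsub>H2\<^esub>"
    using arg_cong[OF phi_inv_left, of "on_tail f"] multiplicativeD[OF algebra_homD(2)[OF F] phi_inv_closed phi_closed]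
      algebra_homD(3)[OF F] by (simp only:)
  then show ?thesis using c by (simp add: 1 del: tensor_one)
qed

lemmas counit_phi_inv = on_tail_inv[OF counit_l_hom counit_middle_phi] on_tail_inv[OF counit_r_hom counit_last_phi]

lemma embed_inv:
  assumes F: "algebra_hom k H3 H4 F"
  shows "F phi_inv \<cdot>\<^sub>4 F phi = \<one>\<^bsub>H4\<^esub>" "F phi \<cdot>\<^sub>4 F phi_inv = \<one>\<^bsub>H4\<^esub>"
    "F phi_inv \<in> carrier H4" "F phi \<in> carrier H4"
  using arg_cong[OF phi_inv_left, of F] arg_cong[OF phi_inv_right, of F]
    multiplicativeD[OF algebra_homD(2)[OF F] phi_inv_closed phi_closed]
    multiplicativeD[OF algebra_homD(2)[OF F] phi_closed phi_inv_closed] algebra_homD(3)[OF F]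
    linear_mapD(1)[OF algebra_homD(1)[OF F]]
  by simp_all

text \<open>
  The pentagon, solved for the two elements that occur in the composites of the transposes.
\<close>

lemma pentagon_left:
  "comult_12 phi \<cdot>\<^sub>4 pad phi_inv =
   comult_34 phi_inv \<cdot>\<^sub>4 shift phi \<cdot>\<^sub>4 comult_23 phi"
proof -
  interpret M: Group.monoid "H4" by (rule tensor4_monoid)
  note c [simp] = embed_inv(3,4)[OF comult_34_hom] embed_inv(3,4)[OF comult_12_hom] embed_inv(3,4)[OF comult_23_hom]
     embed_inv(3,4)[OF shift_hom] embed_inv(3,4)[OF pad_hom]
  have "comult_12 phi \<cdot>\<^sub>4 pad phi_inv =
    (comult_34 phi_inv \<cdot>\<^sub>4 comult_34 phi) \<cdot>\<^sub>4 comult_12 phi \<cdot>\<^sub>4 pad phi_inv"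
    by (simp only: embed_inv(1)[OF comult_34_hom] M.l_one c)
  also have "\<dots> = comult_34 phi_inv \<cdot>\<^sub>4 (comult_34 phi \<cdot>\<^sub>4 comult_12 phi) \<cdot>\<^sub>4 pad phi_inv"
    by (simp only: M.m_assoc M.m_closed c)
  also have "\<dots> = comult_34 phi_inv \<cdot>\<^sub>4 shift phi \<cdot>\<^sub>4 comult_23 phi \<cdot>\<^sub>4 (pad phi \<cdot>\<^sub>4 pad phi_inv)"
    by (simp only: pentagon_embedded M.m_assoc M.m_closed c)
  also have "\<dots> = comult_34 phi_inv \<cdot>\<^sub>4 shift phi \<cdot>\<^sub>4 comult_23 phi"
    by (simp only: embed_inv(2)[OF pad_hom] M.r_one M.m_closed c)
  finally show ?thesis .
qed

lemma pentagon_right: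
  "pad phi \<cdot>\<^sub>4 comult_12 phi_inv =
   comult_23 phi_inv \<cdot>\<^sub>4 shift phi_inv \<cdot>\<^sub>4 comult_34 phi"
proof -
  interpret M: Group.monoid "H4" by (rule tensor4_monoid)
  note c [simp] = embed_inv(3,4)[OF comult_34_hom] embed_inv(3,4)[OF comult_12_hom] embed_inv(3,4)[OF comult_23_hom]
     embed_inv(3,4)[OF shift_hom] embed_inv(3,4)[OF pad_hom]
  have "pad phi \<cdot>\<^sub>4 comult_12 phi_inv =
    comult_23 phi_inv \<cdot>\<^sub>4 (shift phi_inv \<cdot>\<^sub>4 shift phi) \<cdot>\<^sub>4
      comult_23 phi \<cdot>\<^sub>4 pad phi \<cdot>\<^sub>4 comult_12 phi_inv"
    by (simp only: embed_inv(1)[OF shift_hom] M.r_one c embed_inv(1)[OF comult_23_hom] M.l_one)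
  also have "\<dots> = comult_23 phi_inv \<cdot>\<^sub>4 shift phi_inv \<cdot>\<^sub>4
      (shift phi \<cdot>\<^sub>4 comult_23 phi \<cdot>\<^sub>4 pad phi) \<cdot>\<^sub>4 comult_12 phi_inv"
    by (simp only: M.m_assoc M.m_closed c)
  also have "\<dots> = comult_23 phi_inv \<cdot>\<^sub>4 shift phi_inv \<cdot>\<^sub>4
      (comult_34 phi \<cdot>\<^sub>4 (comult_12 phi \<cdot>\<^sub>4 comult_12 phi_inv))"
    by (simp only: pentagon_embedded[symmetric] M.m_assoc M.m_closed c)
  also have "\<dots> = comult_23 phi_inv \<cdot>\<^sub>4 shift phi_inv \<cdot>\<^sub>4 comult_34 phi"
    by (simp only: embed_inv(2)[OF comult_12_hom] M.r_one c)
  finally show ?thesis .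
qed

end

section \<open>Contractions with the quasi-antipode\<close>

context quasi_hopf_algebra
begin

abbreviation "S \<equiv> antipode H"
abbreviation "\<alpha> \<equiv> alpha H"
abbreviation "\<beta> \<equiv> beta H"

lemmas [simp] = antipode_linear alpha_closed beta_closed antipode_one antipode_mult

lemma antipode_closed [simp]: "h \<in> carrier H \<Longrightarrow> S h \<in> carrier H"
  by (rule linear_mapD(1)[OF antipode_linear])

lemma antipode_smult [simp]: "c \<in> carrier k \<Longrightarrow> h \<in> carrier H \<Longrightarrow> S (c \<odot>\<^bsub>H\<^esub> h) = c \<odot>\<^bsub>H\<^esub> S h"
  by (rule linear_mapD(3)[OF antipode_linear])

lemmas antipode_lin [lin] = lin_comp[OF _ antipode_linear]

text \<open>
  The four expressions of the quasi-antipode axioms, as linear maps on \<open>H2\<close> and \<open>H3\<close>.  In an expression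
  \<open>S(x) \<alpha> y\<close> or \<open>x \<beta> S(y)\<close> a factor \<open>\<Delta>(h)\<close> on the side of \<open>\<alpha>\<close> or \<open>\<beta>\<close> is absorbed and leaves \<open>\<epsilon>(h)\<close>; the
  lemmas of this section spell this out for each position.
\<close>

definition contract_beta :: "('h, 'h) tens \<Rightarrow> 'h" where
  "contract_beta = tensor_lift H (\<lambda>a b. a \<cdot> \<beta> \<cdot> S b)"

definition contract_alpha :: "('h, 'h) tens \<Rightarrow> 'h" where
  "contract_alpha = tensor_lift H (\<lambda>a b. S a \<cdot> \<alpha> \<cdot> b)"

definition contract_beta_alpha :: "('h, ('h, 'h) tens) tens \<Rightarrow> 'h" where
  "contract_beta_alpha = tensor_lift H (\<lambda>a. tensor_lift H (\<lambda>b c.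
         a \<cdot> \<beta> \<cdot> S b \<cdot> \<alpha> \<cdot> c))"

definition contract_alpha_beta :: "('h, ('h, 'h) tens) tens \<Rightarrow> 'h" where
  "contract_alpha_beta = tensor_lift H (\<lambda>a. tensor_lift H (\<lambda>b c.
         S a \<cdot> \<alpha> \<cdot> b \<cdot> \<beta> \<cdot> S c))"

lemma contract_beta_bilinear: "bilinear k H H H (\<lambda>a b. a \<cdot> \<beta> \<cdot> S b)"
  by (rule bilinearI, (rule lin | simp)+)

lemma contract_alpha_bilinear: "bilinear k H H H (\<lambda>a b. S a \<cdot> \<alpha> \<cdot> b)"
  by (rule bilinearI, (rule lin | simp)+)

lemma contract_beta_alpha_bilinear_inner:
  "a \<in> carrier H \<Longrightarrow> bilinear k H H H (\<lambda>b c. a \<cdot> \<beta> \<cdot> S b \<cdot> \<alpha> \<cdot> c)"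
  by (rule bilinearI, (rule lin | simp)+)

lemma contract_alpha_beta_bilinear_inner:
  "a \<in> carrier H \<Longrightarrow> bilinear k H H H (\<lambda>b c. S a \<cdot> \<alpha> \<cdot> b \<cdot> \<beta> \<cdot> S c)"
  by (rule bilinearI, (rule lin | simp)+)

lemma contract_beta_alpha_bilinear:
  "bilinear k H H2 H (\<lambda>a. tensor_lift H (\<lambda>b c. a \<cdot> \<beta> \<cdot> S b \<cdot> \<alpha> \<cdot> c))"
proof (rule bilinearI)
  fix t assume t: "t \<in> carrier H2"
  show "linear_map k H H (\<lambda>a. tensor_lift H (\<lambda>b c. a \<cdot> \<beta> \<cdot> S b \<cdot> \<alpha> \<cdot> c) t)"
    by (rule lin_lift_param[OF t], (rule contract_beta_alpha_bilinear_inner | rule lin | simp)+)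
qed (simp add: tensor_lift_linear contract_beta_alpha_bilinear_inner)

lemma contract_alpha_beta_bilinear:
  "bilinear k H H2 H (\<lambda>a. tensor_lift H (\<lambda>b c. S a \<cdot> \<alpha> \<cdot> b \<cdot> \<beta> \<cdot> S c))"
proof (rule bilinearI)
  fix t assume t: "t \<in> carrier H2"
  show "linear_map k H H (\<lambda>a. tensor_lift H (\<lambda>b c. S a \<cdot> \<alpha> \<cdot> b \<cdot> \<beta> \<cdot> S c) t)"
    by (rule lin_lift_param[OF t], (rule contract_alpha_beta_bilinear_inner | rule lin | simp)+)
qed (simp add: tensor_lift_linear contract_alpha_beta_bilinear_inner)

lemma contract_linear [simp]:
  "linear_map k H2 H contract_beta"
  "linear_map k H2 H contract_alpha"
  "linear_map k H3 H contract_beta_alpha"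
  "linear_map k H3 H contract_alpha_beta"
  by (simp_all add: tensor_lift_linear contract_beta_def contract_alpha_def contract_beta_alpha_def contract_alpha_beta_def
      contract_beta_bilinear contract_alpha_bilinear contract_beta_alpha_bilinear contract_alpha_beta_bilinear)

lemmas contract_lin [lin] = contract_linear[THEN lin_comp[rotated]]
lemmas contract_closed [simp] = contract_linear[THEN linear_mapD(1)]

lemma contract_simple [simp]:
  "a \<in> carrier H \<Longrightarrow> b \<in> carrier H \<Longrightarrow>
    contract_beta (pure2 a b) = a \<cdot> \<beta> \<cdot> S b"
  "a \<in> carrier H \<Longrightarrow> b \<in> carrier H \<Longrightarrow>
    contract_alpha (pure2 a b) = S a \<cdot> \<alpha> \<cdot> b"
  by (simp_all add: tensor_lift_simple contract_beta_def contract_alpha_def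
      contract_beta_bilinear contract_alpha_bilinear)

lemma contract_triple_simple:
  "a \<in> carrier H \<Longrightarrow> b \<in> carrier H \<Longrightarrow> c \<in> carrier H \<Longrightarrow>
    contract_beta_alpha (pure3 a (pure2 b c)) =
     a \<cdot> \<beta> \<cdot> S b \<cdot> \<alpha> \<cdot> c"
  "a \<in> carrier H \<Longrightarrow> b \<in> carrier H \<Longrightarrow> c \<in> carrier H \<Longrightarrow>
    contract_alpha_beta (pure3 a (pure2 b c)) =
     S a \<cdot> \<alpha> \<cdot> b \<cdot> \<beta> \<cdot> S c"
  by (simp_all add: tensor_lift_simple contract_beta_alpha_def contract_alpha_beta_def
      contract_beta_alpha_bilinear contract_beta_alpha_bilinear_inner contract_alpha_beta_bilinear contract_alpha_beta_bilinear_inner)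

lemma contract_comult [simp]:
  "h \<in> carrier H \<Longrightarrow> contract_beta (\<Delta>\<^bsub>H\<^esub> h) = \<epsilon>\<^bsub>H\<^esub> h \<odot>\<^bsub>H\<^esub> \<beta>"
  "h \<in> carrier H \<Longrightarrow> contract_alpha (\<Delta>\<^bsub>H\<^esub> h) = \<epsilon>\<^bsub>H\<^esub> h \<odot>\<^bsub>H\<^esub> \<alpha>"
  by (simp_all add: contract_beta_def contract_alpha_def antipode_beta antipode_alpha)

lemma contract_phi: "contract_beta_alpha phi = \<one>\<^bsub>H\<^esub>" "contract_alpha_beta phi_inv = \<one>\<^bsub>H\<^esub>"
  unfolding contract_beta_alpha_def contract_alpha_beta_def phi_inv_def
  by (rule antipode_reassociator antipode_reassociator_inv)+

lemma tensor2_mult_closed [simp]: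
  "s \<in> carrier H2 \<Longrightarrow> t \<in> carrier H2 \<Longrightarrow> s \<cdot>\<^sub>2 t \<in> carrier H2"
  "p \<in> carrier H3 \<Longrightarrow> q \<in> carrier H3 \<Longrightarrow> p \<cdot>\<^sub>3 q \<in> carrier H3"
  "x \<in> carrier H4 \<Longrightarrow> y \<in> carrier H4 \<Longrightarrow> x \<cdot>\<^sub>4 y \<in> carrier H4"
  by (simp_all add: assoc_algebra_closed[of k])

lemma tensor2_smult:
  "c \<in> carrier k \<Longrightarrow> s \<in> carrier H2 \<Longrightarrow> t \<in> carrier H2 \<Longrightarrow>
    (c \<odot>\<^bsub>H2\<^esub> s) \<cdot>\<^sub>2 t = c \<odot>\<^bsub>H2\<^esub> (s \<cdot>\<^sub>2 t)"
  "c \<in> carrier k \<Longrightarrow> s \<in> carrier H2 \<Longrightarrow> t \<in> carrier H2 \<Longrightarrow>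
    s \<cdot>\<^sub>2 (c \<odot>\<^bsub>H2\<^esub> t) = c \<odot>\<^bsub>H2\<^esub> (s \<cdot>\<^sub>2 t)"
  using bilinearD(6,7)[OF mult_bilinear[of k "H2"]] by simp_all

text \<open>
  For a pure \<open>t = c \<otimes> d\<close> the left side is \<open>S(c) S(h\<^sub>1) \<alpha> h\<^sub>2 d\<close>.  The auxiliary fact leaves the first factor
  an arbitrary tensor, because \<open>\<Delta>(h)\<close> itself is not pure; the same device is used in all later proofs
  of this kind.
\<close>

lemma contract_alpha_comult_mult:
  assumes h [simp]: "h \<in> carrier H" and t: "t \<in> carrier H2"
  shows "contract_alpha (\<Delta>\<^bsub>H\<^esub> h \<cdot>\<^sub>2 t) = \<epsilon>\<^bsub>H\<^esub> h \<odot>\<^bsub>H\<^esub> contract_alpha t"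
proof -
  have 1: "\<forall>u\<in>carrier H2. contract_alpha (u \<cdot>\<^sub>2 pure2 c d) =
      S c \<cdot> contract_alpha u \<cdot> d" if [simp]: "c \<in> carrier H" "d \<in> carrier H" for c d
    by (rule tensor_eqI, (rule lin | simp add: H_assoc)+)
  have "\<forall>t\<in>carrier H2. contract_alpha (\<Delta>\<^bsub>H\<^esub> h \<cdot>\<^sub>2 t) = \<epsilon>\<^bsub>H\<^esub> h \<odot>\<^bsub>H\<^esub> contract_alpha t"
    by (rule tensor_eqI, (rule lin | simp add: 1 H_smult)+)
  then show ?thesis using t by blast
qed

lemma contract_beta_mult_comult:
  assumes h [simp]: "h \<in> carrier H" and t: "t \<in> carrier H2"
  shows "contract_beta (t \<cdot>\<^sub>2 \<Delta>\<^bsub>H\<^esub> h) = \<epsilon>\<^bsub>H\<^esub> h \<odot>\<^bsub>H\<^esub> contract_beta t"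
proof -
  have 1: "\<forall>u\<in>carrier H2. contract_beta (pure2 c d \<cdot>\<^sub>2 u) =
      c \<cdot> contract_beta u \<cdot> S d" if [simp]: "c \<in> carrier H" "d \<in> carrier H" for c d
    by (rule tensor_eqI, (rule lin | simp add: H_assoc)+)
  have "\<forall>t\<in>carrier H2. contract_beta (t \<cdot>\<^sub>2 \<Delta>\<^bsub>H\<^esub> h) = \<epsilon>\<^bsub>H\<^esub> h \<odot>\<^bsub>H\<^esub> contract_beta t"
    by (rule tensor_eqI, (rule lin | simp add: 1 H_smult)+)
  then show ?thesis using t by blast
qed

lemma contract_beta_alpha_left:
  assumes [simp]: "a \<in> carrier H"
  shows "t \<in> carrier H2 \<Longrightarrow>
    contract_beta_alpha (pure3 a t) = a \<cdot> \<beta> \<cdot> contract_alpha t"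
proof -
  have "\<forall>t\<in>carrier H2.
    contract_beta_alpha (pure3 a t) = a \<cdot> \<beta> \<cdot> contract_alpha t"
    by (rule tensor_eqI, (rule lin | simp add: H_assoc contract_triple_simple)+)
  then show "t \<in> carrier H2 \<Longrightarrow>
    contract_beta_alpha (pure3 a t) = a \<cdot> \<beta> \<cdot> contract_alpha t" by blast
qed

lemma contract_alpha_beta_left:
  assumes [simp]: "a \<in> carrier H"
  shows "t \<in> carrier H2 \<Longrightarrow>
    contract_alpha_beta (pure3 a t) = S a \<cdot> \<alpha> \<cdot> contract_beta t"
proof -
  have "\<forall>t\<in>carrier H2.
    contract_alpha_beta (pure3 a t) = S a \<cdot> \<alpha> \<cdot> contract_beta t"
    by (rule tensor_eqI, (rule lin | simp add: H_assoc contract_triple_simple)+)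
  then show "t \<in> carrier H2 \<Longrightarrow>
    contract_alpha_beta (pure3 a t) = S a \<cdot> \<alpha> \<cdot> contract_beta t" by blast
qed

text \<open>
  In \<open>x \<beta> S(y) \<alpha> z\<close>, a factor \<open>\<Delta>\<close> multiplied from the left to \<open>y \<otimes> z\<close> sits around \<open>\<alpha>\<close>, and one multiplied
  from the right to \<open>x \<otimes> y\<close> sits around \<open>\<beta>\<close>.  For \<open>S(x) \<alpha> y \<beta> S(z)\<close> the two sides are exchanged.
\<close>

lemma contract_beta_alpha_comult_right:
  assumes s: "s \<in> carrier H2" and q: "q \<in> carrier H3"
  shows "contract_beta_alpha (comult_right s \<cdot>\<^sub>3 q) = counit_r s \<cdot> contract_beta_alpha q"
  by (rule bilinear_eqI[OF bilinear_comp_lin[OF bilinear_lin_comp[OF mult_bilinear contract_linear(3)] algebra_homD(1)[OF comult_right_hom] lin_id]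
       bilinear_comp_lin[OF mult_bilinear counit_r_linear contract_linear(3)] _ _ _ _ _ _ s q])
    (simp_all add: contract_beta_alpha_left contract_alpha_comult_mult H_smult H_assoc)

lemma contract_alpha_beta_comult_right:
  assumes s: "s \<in> carrier H2" and q: "q \<in> carrier H3"
  shows "contract_alpha_beta (q \<cdot>\<^sub>3 comult_right s) = S (counit_r s) \<cdot> contract_alpha_beta q"
proof -
  let ?L = "\<lambda>s q. contract_alpha_beta (q \<cdot>\<^sub>3 comult_right s)"
  let ?R = "\<lambda>s q. S (counit_r s) \<cdot> contract_alpha_beta q"
  have 1: "\<forall>s\<in>carrier H2. ?L s (pure3 a t) = ?R s (pure3 a t)"
    if [simp]: "a \<in> carrier H" "t \<in> carrier H2" for a t
    by (rule tensor_eqI,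
        (rule lin | simp add: contract_alpha_beta_left contract_beta_mult_comult H_smult H_assoc)+)
  have "\<forall>q\<in>carrier H3. ?L s q = ?R s q"
    by (rule tensor_eqI, (rule lin | simp add: 1 s)+)
  then show ?thesis using q by blast
qed

lemma contract_beta_alpha_comult_left:
  assumes s: "s \<in> carrier H2" and q: "q \<in> carrier H3"
  shows "contract_beta_alpha (q \<cdot>\<^sub>3 comult_left s) = contract_beta_alpha q \<cdot> counit_l s"
proof -
  let ?L = "\<lambda>s q. contract_beta_alpha (q \<cdot>\<^sub>3 comult_left s)"
  let ?R = "\<lambda>s q. contract_beta_alpha q \<cdot> counit_l s"
  have 0: "\<forall>u\<in>carrier H2. contract_beta_alpha (pure3 b (pure2 c d) \<cdot>\<^sub>3 reassoc3 (simple_tensor k H2 H u x)) =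
      b \<cdot> contract_beta u \<cdot> S c \<cdot> \<alpha> \<cdot> d \<cdot> x"
    if [simp]: "b \<in> carrier H" "c \<in> carrier H" "d \<in> carrier H" "x \<in> carrier H" for b c d x
    by (rule tensor_eqI, (rule lin | simp add: contract_triple_simple H_assoc)+)
  have 1: "\<forall>s\<in>carrier H2. ?L s (pure3 b (pure2 c d)) = ?R s (pure3 b (pure2 c d))"
    if [simp]: "b \<in> carrier H" "c \<in> carrier H" "d \<in> carrier H" for b c d
    by (rule tensor_eqI, (rule lin | simp add: 0 contract_triple_simple H_smult H_assoc)+)
  have "\<forall>q\<in>carrier H3. ?L s q = ?R s q"
    by (rule tensor3_eqI, (rule lin | simp add: 1 s)+)
  then show ?thesis using q by blast
qed

lemma contract_alpha_beta_comult_left: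
  assumes s: "s \<in> carrier H2" and q: "q \<in> carrier H3"
  shows "contract_alpha_beta (comult_left s \<cdot>\<^sub>3 q) = contract_alpha_beta q \<cdot> S (counit_l s)"
proof -
  let ?L = "\<lambda>s q. contract_alpha_beta (comult_left s \<cdot>\<^sub>3 q)"
  let ?R = "\<lambda>s q. contract_alpha_beta q \<cdot> S (counit_l s)"
  have 0: "\<forall>u\<in>carrier H2. contract_alpha_beta (reassoc3 (simple_tensor k H2 H u x) \<cdot>\<^sub>3 pure3 b (pure2 c d)) =
      S b \<cdot> contract_alpha u \<cdot> c \<cdot> \<beta> \<cdot> S d \<cdot> S x"
    if [simp]: "b \<in> carrier H" "c \<in> carrier H" "d \<in> carrier H" "x \<in> carrier H" for b c d x
    by (rule tensor_eqI, (rule lin | simp add: contract_triple_simple H_assoc)+)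
  have 1: "\<forall>s\<in>carrier H2. ?L s (pure3 b (pure2 c d)) = ?R s (pure3 b (pure2 c d))"
    if [simp]: "b \<in> carrier H" "c \<in> carrier H" "d \<in> carrier H" for b c d
    by (rule tensor_eqI, (rule lin | simp add: 0 contract_triple_simple H_smult H_assoc)+)
  have "\<forall>q\<in>carrier H3. ?L s q = ?R s q"
    by (rule tensor3_eqI, (rule lin | simp add: 1 s)+)
  then show ?thesis using q by blast
qed

text \<open>
  The same contractions on all slots but the first.  \<open>K phi_inv\<close> and \<open>J phi\<close> are the coefficients of the two
  transposes, \<open>T4\<close> and \<open>U4\<close> compute their composites.
\<close>

abbreviation "K \<equiv> on_tail contract_beta"
abbreviation "J \<equiv> on_tail contract_alpha"
abbreviation "T4 \<equiv> tensor_map k H H id contract_beta_alpha"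
abbreviation "U4 \<equiv> tensor_map k H H id contract_alpha_beta"
abbreviation "in1 h \<equiv> pure2 h \<one>\<^bsub>H\<^esub>"
abbreviation "in2 h \<equiv> pure2 \<one>\<^bsub>H\<^esub> h"

lemma tail_contract_linear [simp]:
  "linear_map k H3 H2 K"
  "linear_map k H3 H2 J"
  "linear_map k H4 H2 T4"
  "linear_map k H4 H2 U4"
  by simp_all

lemmas tail_contract_closed [simp] = tail_contract_linear[THEN linear_mapD(1)]

text \<open>
  \<open>K_comult_right\<close> and \<open>K_reassoc\<close> are the two halves of the \<open>H\<close>-linearity of \<open>curry_map\<close>: an element
  \<open>(id \<otimes> \<Delta>)(s)\<close> next to \<open>\<phi>\<^sup>-\<^sup>1\<close> acts on the first argument alone, and \<open>(\<Delta> \<otimes> id)(s)\<close> acts from both sides.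
\<close>

lemma K_comult_right:
  assumes s: "s \<in> carrier H2" and q: "q \<in> carrier H3"
  shows "K (q \<cdot>\<^sub>3 comult_right s) = K q \<cdot>\<^sub>2 in1 (counit_r s)"
proof -
  let ?L = "\<lambda>s q. K (q \<cdot>\<^sub>3 comult_right s)"
  let ?R = "\<lambda>s q. K q \<cdot>\<^sub>2 in1 (counit_r s)"
  have 1: "\<forall>s\<in>carrier H2. ?L s (pure3 a t) = ?R s (pure3 a t)"
    if [simp]: "a \<in> carrier H" "t \<in> carrier H2" for a t
    by (rule tensor_eqI,
        (rule lin | simp add: contract_beta_mult_comult H_smult simple_smult tensor2_smult)+)
  have "\<forall>q\<in>carrier H3. ?L s q = ?R s q"
    by (rule tensor_eqI, (rule lin | simp add: 1 s)+)
  then show ?thesis using q by blast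
qed

lemma J_comult_right:
  assumes s: "s \<in> carrier H2" and q: "q \<in> carrier H3"
  shows "J (comult_right s \<cdot>\<^sub>3 q) = in1 (counit_r s) \<cdot>\<^sub>2 J q"
proof -
  let ?L = "\<lambda>s q. J (comult_right s \<cdot>\<^sub>3 q)"
  let ?R = "\<lambda>s q. in1 (counit_r s) \<cdot>\<^sub>2 J q"
  have 1: "\<forall>s\<in>carrier H2. ?L s (pure3 a t) = ?R s (pure3 a t)"
    if [simp]: "a \<in> carrier H" "t \<in> carrier H2" for a t
    by (rule tensor_eqI,
        (rule lin | simp add: contract_alpha_comult_mult H_smult simple_smult tensor2_smult)+)
  have "\<forall>q\<in>carrier H3. ?L s q = ?R s q"
    by (rule tensor_eqI, (rule lin | simp add: 1 s)+)
  then show ?thesis using q by blast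
qed

lemma K_reassoc:
  assumes u: "u \<in> carrier H2" and b [simp]: "b \<in> carrier H" and q: "q \<in> carrier H3"
  shows "K (reassoc3 (simple_tensor k H2 H u b) \<cdot>\<^sub>3 q) = u \<cdot>\<^sub>2 K q \<cdot>\<^sub>2 in2 (S b)"
proof -
  let ?L = "\<lambda>u q. K (reassoc3 (simple_tensor k H2 H u b) \<cdot>\<^sub>3 q)"
  let ?R = "\<lambda>u q. u \<cdot>\<^sub>2 K q \<cdot>\<^sub>2 in2 (S b)"
  have 1: "\<forall>u\<in>carrier H2. ?L u (pure3 x (pure2 y z)) = ?R u (pure3 x (pure2 y z))"
    if [simp]: "x \<in> carrier H" "y \<in> carrier H" "z \<in> carrier H" for x y z
    by (rule tensor_eqI, (rule lin | simp add: H_assoc)+)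
  have "\<forall>q\<in>carrier H3. ?L u q = ?R u q"
    by (rule tensor3_eqI, (rule lin | simp add: 1 u)+)
  then show ?thesis using q by blast
qed

text \<open>
  On pure tensors both sides are \<open>u\<^sub>1 q\<^sub>1 \<otimes> u\<^sub>2 q\<^sub>2 \<beta> S(q\<^sub>3) S(c) \<alpha> d\<close>, for \<open>t = c \<otimes> d\<close>.
\<close>

lemma K_contract_alpha:
  assumes u: "u \<in> carrier H2" and t: "t \<in> carrier H2" and q: "q \<in> carrier H3"
  shows "u \<cdot>\<^sub>2 K q \<cdot>\<^sub>2 in2 (contract_alpha t) = T4 (reassoc4 (simple_tensor k H2 H2 u t) \<cdot>\<^sub>4 pad q)"
proof -
  let ?L = "\<lambda>u t q. u \<cdot>\<^sub>2 K q \<cdot>\<^sub>2 in2 (contract_alpha t)"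
  let ?R = "\<lambda>u t q. T4 (reassoc4 (simple_tensor k H2 H2 u t) \<cdot>\<^sub>4 pad q)"
  note [lin] = lin_comp[OF _ pad_linear]
  have 1: "\<forall>u\<in>carrier H2. ?L u (pure2 c d) (pure3 x (pure2 y z)) = ?R u (pure2 c d) (pure3 x (pure2 y z))"
    if [simp]: "x \<in> carrier H" "y \<in> carrier H" "z \<in> carrier H" "c \<in> carrier H" "d \<in> carrier H"
    for x y z c d
    by (rule tensor_eqI, (rule lin | simp add: H_assoc contract_triple_simple)+)
  have 2: "\<forall>t\<in>carrier H2. ?L u t (pure3 x (pure2 y z)) = ?R u t (pure3 x (pure2 y z))"
    if [simp]: "x \<in> carrier H" "y \<in> carrier H" "z \<in> carrier H" for x y z
  proof (rule tensor_eqI)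
    show "\<forall>c\<in>carrier H. \<forall>d\<in>carrier H.
        ?L u (pure2 c d) (pure3 x (pure2 y z)) = ?R u (pure2 c d) (pure3 x (pure2 y z))"
      using 1 u that by blast
  qed (rule lin | simp add: u)+
  have "\<forall>q\<in>carrier H3. ?L u t q = ?R u t q"
    by (rule tensor3_eqI, (rule lin 2[THEN bspec] | simp add: u t)+)
  then show ?thesis using q by blast
qed

text \<open>
  On pure tensors both sides are \<open>p\<^sub>1 u\<^sub>1 \<otimes> S(u\<^sub>2) S(p\<^sub>2) \<alpha> p\<^sub>3 c \<beta> S(d)\<close>, for \<open>t = c \<otimes> d\<close>.
\<close>

lemma J_contract_beta:
  assumes u: "u \<in> carrier H2" and t: "t \<in> carrier H2" and p: "p \<in> carrier H3"
  shows "J (p \<cdot>\<^sub>3 reassoc3 (simple_tensor k H2 H u (contract_beta t))) =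
    U4 (pad p \<cdot>\<^sub>4 reassoc4 (simple_tensor k H2 H2 u t))"
proof -
  let ?L = "\<lambda>u t p. J (p \<cdot>\<^sub>3 reassoc3 (simple_tensor k H2 H u (contract_beta t)))"
  let ?R = "\<lambda>u t p. U4 (pad p \<cdot>\<^sub>4 reassoc4 (simple_tensor k H2 H2 u t))"
  note [lin] = lin_comp[OF _ pad_linear]
  have 1: "\<forall>u\<in>carrier H2. ?L u (pure2 c d) (pure3 x (pure2 y z)) = ?R u (pure2 c d) (pure3 x (pure2 y z))"
    if [simp]: "x \<in> carrier H" "y \<in> carrier H" "z \<in> carrier H" "c \<in> carrier H" "d \<in> carrier H"
    for x y z c d
    by (rule tensor_eqI, (rule lin | simp add: H_assoc contract_triple_simple)+)
  have 2: "\<forall>t\<in>carrier H2. ?L u t (pure3 x (pure2 y z)) = ?R u t (pure3 x (pure2 y z))"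
    if [simp]: "x \<in> carrier H" "y \<in> carrier H" "z \<in> carrier H" for x y z
    by (rule tensor_eqI, (rule lin | simp del: contract_simple pad_simple add: 1 u)+)
  have "\<forall>p\<in>carrier H3. ?L u t p = ?R u t p"
    by (rule tensor3_eqI, (rule lin | simp del: pad_simple add: 2 u t)+)
  then show ?thesis using p by blast
qed

lemma comult_23_linear [simp]: "linear_map k H3 H4 (\<lambda>p. comult_23 p)"
  by (rule algebra_homD(1)[OF comult_23_hom])

lemma comult_34_linear [simp]: "linear_map k H3 H4 (\<lambda>p. comult_34 p)"
  by (rule algebra_homD(1)[OF comult_34_hom])

text \<open>
  Both comultiplied pairs are absorbed, and a middle factor with contraction \<open>1\<close> disappears.
\<close>

lemma T4_comult:
  assumes q [simp]: "q \<in> carrier H3" and 1: "contract_beta_alpha q = \<one>\<^bsub>H\<^esub>"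
    and p: "p \<in> carrier H3" "p' \<in> carrier H3"
  shows "T4 (comult_34 p \<cdot>\<^sub>4 shift q \<cdot>\<^sub>4 comult_23 p') = on_tail counit_r p \<cdot>\<^sub>2 on_tail counit_l p'"
proof (rule bilinear_eqI[OF bilinear_lin_comp[OF _ tail_contract_linear(3)] bilinear_comp_lin[OF mult_bilinear] _ _ _ _ _ _ p])
  note [simp] = algebra_homD(1)[OF comult_left_hom] algebra_homD(1)[OF comult_right_hom]
  have "shift q \<in> carrier H4" by simp
  then show "bilinear k H3 H3 H4 (\<lambda>p p'. comult_34 p \<cdot>\<^sub>4 shift q \<cdot>\<^sub>4 comult_23 p')"
    by (intro bilinear_comp_lin[OF mult_bilinear lin_mult_left[OF comult_34_linear] comult_23_linear]) simp_all
  show "T4 (comult_34 (pure3 a s) \<cdot>\<^sub>4 shift q \<cdot>\<^sub>4 comult_23 (pure3 a' s')) =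
      on_tail counit_r (pure3 a s) \<cdot>\<^sub>2 on_tail counit_l (pure3 a' s')"
    if "a \<in> carrier H" "s \<in> carrier H2" "a' \<in> carrier H" "s' \<in> carrier H2" for a s a' s'
    using that by (simp add: contract_beta_alpha_comult_left contract_beta_alpha_comult_right 1)
qed simp_all

lemma U4_comult:
  assumes q [simp]: "q \<in> carrier H3" and 1: "contract_alpha_beta q = \<one>\<^bsub>H\<^esub>"
    and p: "p \<in> carrier H3" "p' \<in> carrier H3"
  shows "U4 (comult_23 p \<cdot>\<^sub>4 shift q \<cdot>\<^sub>4 comult_34 p') = on_tail S (on_tail counit_l p \<cdot>\<^sub>2 on_tail counit_r p')"
proof (rule bilinear_eqI[OF bilinear_lin_comp[OF _ tail_contract_linear(4)]
      bilinear_lin_comp[OF bilinear_comp_lin[OF mult_bilinear]] _ _ _ _ _ _ p])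
  note [simp] = algebra_homD(1)[OF comult_left_hom] algebra_homD(1)[OF comult_right_hom]
  have "shift q \<in> carrier H4" by simp
  then show "bilinear k H3 H3 H4 (\<lambda>p p'. comult_23 p \<cdot>\<^sub>4 shift q \<cdot>\<^sub>4 comult_34 p')"
    by (intro bilinear_comp_lin[OF mult_bilinear lin_mult_left[OF comult_23_linear] comult_34_linear]) simp_all
  show "linear_map k H2 H2 (on_tail S)" by simp
  show "U4 (comult_23 (pure3 a s) \<cdot>\<^sub>4 shift q \<cdot>\<^sub>4 comult_34 (pure3 a' s')) =
      on_tail S (on_tail counit_l (pure3 a s) \<cdot>\<^sub>2 on_tail counit_r (pure3 a' s'))"
    if "a \<in> carrier H" "s \<in> carrier H2" "a' \<in> carrier H" "s' \<in> carrier H2" for a s a' s'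
    using that by (simp add: contract_alpha_beta_comult_left contract_alpha_beta_comult_right 1)
qed simp_all

lemma T4_phi: "T4 (comult_12 phi \<cdot>\<^sub>4 pad phi_inv) = \<one>\<^bsub>H2\<^esub>"
  unfolding pentagon_left
  by (simp add: T4_comult contract_phi counit_middle_phi counit_phi_inv)

lemma U4_phi: "U4 (pad phi \<cdot>\<^sub>4 comult_12 phi_inv) = \<one>\<^bsub>H2\<^esub>"
  unfolding pentagon_right
  by (simp add: U4_comult contract_phi counit_last_phi counit_phi_inv)

end

section \<open>Modules of linear maps\<close>

lemma linear_homs_sel [simp]:
  "L \<in> carrier (linear_homs k V W) \<longleftrightarrow> L \<in> extensional (carrier V) \<and> linear_map k V W L"
  "zero (linear_homs k V W) = (\<lambda>v\<in>carrier V. \<zero>\<^bsub>W\<^esub>)"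
  "L \<oplus>\<^bsub>linear_homs k V W\<^esub> M = (\<lambda>v\<in>carrier V. L v \<oplus>\<^bsub>W\<^esub> M v)"
  "c \<odot>\<^bsub>linear_homs k V W\<^esub> L = (\<lambda>v\<in>carrier V. c \<odot>\<^bsub>W\<^esub> L v)"
  by (simp_all add: linear_homs_def)

lemma linear_homs_eqI:
  assumes "L \<in> carrier (linear_homs k V W)" "M \<in> carrier (linear_homs k V W)"
    "\<And>v. v \<in> carrier V \<Longrightarrow> L v = M v"
  shows "L = M"
  using assms by (auto intro: extensionalityI)

lemma restrict_linear_homs:
  assumes "linear_map k V W f" "module k V"
  shows "restrict f (carrier V) \<in> carrier (linear_homs k V W)"
  using linear_map_cong[OF assms(1), of "restrict f (carrier V)"] assms(2) by simp

lemma linear_homs_module [simp]: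
  fixes k :: "'k ring"
  assumes V [simp]: "module k V" and W [simp]: "module k W"
  shows "module k (linear_homs k V W)"
proof -
  interpret V: module k V by fact
  interpret W: module k W by fact
  let ?M = "linear_homs k V W"
  have zero: "linear_map k V W (\<lambda>v. \<zero>\<^bsub>W\<^esub>)" by (rule linear_mapI) simp_all
  \<comment> \<open>negatives are multiples by \<open>-1\<close>, so that linearity of the negative comes from \<open>lin_smult\<close>\<close>
  have neg: "linear_map k V W (\<lambda>v. (\<ominus>\<^bsub>k\<^esub> \<one>\<^bsub>k\<^esub>) \<odot>\<^bsub>W\<^esub> L v)" if "linear_map k V W L" for L
    by (rule lin_smult[OF that]) simp_all
  have ng: "(\<ominus>\<^bsub>k\<^esub> \<one>\<^bsub>k\<^esub>) \<odot>\<^bsub>W\<^esub> w \<oplus>\<^bsub>W\<^esub> w = \<zero>\<^bsub>W\<^esub>" if "w \<in> carrier W" for w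
    using that W.smult_l_distr[of "\<ominus>\<^bsub>k\<^esub> \<one>\<^bsub>k\<^esub>" "\<one>\<^bsub>k\<^esub>" w] by (simp add: V.R.l_neg)
  note cl = linear_mapD(1)[of k V W]
  have add: "L \<oplus>\<^bsub>?M\<^esub> M \<in> carrier ?M" if "L \<in> carrier ?M" "M \<in> carrier ?M" for L M
    using restrict_linear_homs[OF lin_add[OF W] V] that by simp
  have ab: "abelian_group ?M"
  proof (rule abelian_groupI)
    show "\<zero>\<^bsub>?M\<^esub> \<in> carrier ?M" using restrict_linear_homs[OF zero V] by simp
    show "\<exists>M\<in>carrier ?M. M \<oplus>\<^bsub>?M\<^esub> L = \<zero>\<^bsub>?M\<^esub>" if "L \<in> carrier ?M" for L
      using restrict_linear_homs[OF neg, of L] that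
      by (intro bexI[of _ "\<lambda>v\<in>carrier V. (\<ominus>\<^bsub>k\<^esub> \<one>\<^bsub>k\<^esub>) \<odot>\<^bsub>W\<^esub> L v"]) (auto simp: ng cl intro: restrict_ext)
  qed (use add in \<open>auto intro!: ext simp: restrict_def W.M.a_ac cl extensional_def\<close>)
  have sm: "c \<odot>\<^bsub>?M\<^esub> L \<in> carrier ?M" if "c \<in> carrier k" "L \<in> carrier ?M" for c L
    using restrict_linear_homs[OF lin_smult[OF _ W] V] that by simp
  show ?thesis
    by (rule moduleI[OF V.R.is_cring ab sm])
      (auto intro!: ext simp: restrict_def W.smult_l_distr W.smult_r_distr W.smult_assoc1 cl extensional_def)
qed

lemma lin_eval:
  assumes "v \<in> carrier V"
  shows "linear_map k (linear_homs k V W) W (\<lambda>L. L v)"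
  using assms linear_mapD(1)[of k V W] by (intro linear_mapI) auto

text \<open>
  Linearity of a map with values in linear maps is checked pointwise.
\<close>

lemma linear_map_into_homs:
  assumes "\<And>x. x \<in> carrier U \<Longrightarrow> f x \<in> carrier (linear_homs k V W)"
    and "\<And>v. v \<in> carrier V \<Longrightarrow> linear_map k U W (\<lambda>x. f x v)" and "module (k :: 'k ring) U"
  shows "linear_map k U (linear_homs k V W) f"
proof (rule linear_mapI)
  interpret U: module k U by fact
  fix x y c assume xy: "x \<in> carrier U" "y \<in> carrier U" 
  have e: "f z = (\<lambda>v\<in>carrier V. f z v)" if "z \<in> carrier U" for z
    using assms(1)[OF that] by (auto simp: extensional_restrict)
  show "f (x \<oplus>\<^bsub>U\<^esub> y) = f x \<oplus>\<^bsub>linear_homs k V W\<^esub> f y"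
    using xy linear_mapD(2)[OF assms(2)] by (subst e) (auto intro: restrict_ext)
next
  interpret U: module k U by fact
  have e: "f z = (\<lambda>v\<in>carrier V. f z v)" if "z \<in> carrier U" for z
    using assms(1)[OF that] by (auto simp: extensional_restrict)
  fix c x assume "c \<in> carrier k" "x \<in> carrier U"
  then show "f (c \<odot>\<^bsub>U\<^esub> x) = c \<odot>\<^bsub>linear_homs k V W\<^esub> f x"
    using linear_mapD(3)[OF assms(2)] by (subst e) (auto intro: restrict_ext)
qed (use assms in auto)

section \<open>The internal hom\<close>

context quasi_hopf_algebra
begin

definition conj_map :: "('k, 'h, 'v) lmod \<Rightarrow> ('k, 'h, 'w) lmod \<Rightarrow> 'h \<Rightarrow> 'h \<Rightarrow> ('v \<Rightarrow> 'w) \<Rightarrow> ('v \<Rightarrow> 'w)" where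
  "conj_map V W a b L = (\<lambda>v\<in>carrier V. act W a (L (act V (S b) v)))"

text \<open>
  The action of \<open>H \<otimes> H\<close> on \<open>Hom\<^sub>k(V, W)\<close>.  It is a left action because \<open>S\<close> and precomposition both reverse
  the order of products.
\<close>

definition hom_act :: "('k, 'h, 'v) lmod \<Rightarrow> ('k, 'h, 'w) lmod \<Rightarrow> ('h, 'h) tens \<Rightarrow> ('v \<Rightarrow> 'w) \<Rightarrow> ('v \<Rightarrow> 'w)" where
  "hom_act V W s L = tensor_lift (linear_homs k V W) (\<lambda>a b. conj_map V W a b L) s"

lemma hom_ob_alt: "hom_ob k H V W = module.extend (linear_homs k V W) (lmod.fields (\<lambda>h. hom_act V W (\<Delta>\<^bsub>H\<^esub> h)))"
  by (simp add: hom_ob_def hom_act_def conj_map_def fun_eq_iff)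

lemma hom_ob_simps [simp]:
  "carrier (hom_ob k H V W) = carrier (linear_homs k V W)"
  "linear_map k (hom_ob k H V W) X = linear_map k (linear_homs k V W) X"
  "linear_map k X (hom_ob k H V W) = linear_map k X (linear_homs k V W)"
  "act (hom_ob k H V W) h L = hom_act V W (\<Delta>\<^bsub>H\<^esub> h) L"
  by (simp_all add: hom_ob_alt)

context
  fixes V :: "('k, 'h, 'v) lmod" and W :: "('k, 'h, 'w) lmod"
  assumes V: "left_module k H V" and W: "left_module k H W"
begin

lemma hom_modules [simp]: "module k V" "module k W"
  "bilinear k H V V (act V)" "bilinear k H W W (act W)"
  "h \<in> carrier H \<Longrightarrow> v \<in> carrier V \<Longrightarrow> act V h v \<in> carrier V"
  "h \<in> carrier H \<Longrightarrow> w \<in> carrier W \<Longrightarrow> act W h w \<in> carrier W"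
  using V W by (auto dest: left_moduleD)

lemmas hom_modules_lin = lin_bilinear_left[OF _ hom_modules(3)] lin_bilinear_right[OF _ hom_modules(3)]
  lin_bilinear_left[OF _ hom_modules(4)] lin_bilinear_right[OF _ hom_modules(4)]

lemma conj_map_closed [simp]:
  assumes "a \<in> carrier H" "b \<in> carrier H" and L: "L \<in> carrier (linear_homs k V W)"
  shows "conj_map V W a b L \<in> carrier (linear_homs k V W)"
proof -
  have "linear_map k V W L" using L by simp
  note [lin] = hom_modules_lin lin_comp[OF _ this]
  show ?thesis unfolding conj_map_def
    by (rule restrict_linear_homs) ((rule lin | simp add: assms del: linear_homs_sel)+)
qed

lemma conj_map_bilinear:
  assumes L: "L \<in> carrier (linear_homs k V W)"
  shows "bilinear k H H (linear_homs k V W) (\<lambda>a b. conj_map V W a b L)"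
proof -
  have "linear_map k V W L" using L by simp
  note Ll [lin] = hom_modules_lin lin_comp[OF _ this]
  have [simp]: "L v \<in> carrier W" if "v \<in> carrier V" for v using L linear_mapD(1)[of k V W L] that by simp
  show ?thesis
  proof (rule bilinearI)
    fix a assume a [simp]: "a \<in> carrier H"
    show "linear_map k H (linear_homs k V W) (\<lambda>b. conj_map V W a b L)"
    proof (rule linear_map_into_homs)
      fix v assume v [simp]: "v \<in> carrier V"
      have "linear_map k H W (\<lambda>b. act W a (L (act V (S b) v)))" by (rule lin | simp)+
      then show "linear_map k H W (\<lambda>b. conj_map V W a b L v)" by (simp add: conj_map_def)
    qed (simp_all add: L del: linear_homs_sel)
    show "linear_map k H (linear_homs k V W) (\<lambda>b. conj_map V W b a L)"
    proof (rule linear_map_into_homs)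
      fix v assume v [simp]: "v \<in> carrier V"
      have "linear_map k H W (\<lambda>b. act W b (L (act V (S a) v)))" by (rule lin | simp)+
      then show "linear_map k H W (\<lambda>b. conj_map V W b a L v)" by (simp add: conj_map_def)
    qed (simp_all add: L del: linear_homs_sel)
  qed
qed

lemma hom_act_bilinear: "bilinear k H2 (linear_homs k V W) (linear_homs k V W) (hom_act V W)"
  unfolding hom_act_def
proof (rule bilinearI)
  fix s assume s: "s \<in> carrier H2"
  show "linear_map k (linear_homs k V W) (linear_homs k V W)
     (\<lambda>L. tensor_lift (linear_homs k V W) (\<lambda>a b. conj_map V W a b L) s)"
  proof (rule lin_lift_param[OF s])
    fix a b assume ab [simp]: "a \<in> carrier H" "b \<in> carrier H"
    show "linear_map k (linear_homs k V W) (linear_homs k V W) (\<lambda>L. conj_map V W a b L)"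
    proof (rule linear_map_into_homs)
      fix v assume v [simp]: "v \<in> carrier V"
      have "linear_map k (linear_homs k V W) W (\<lambda>L. act W a (L (act V (S b) v)))"
        by (rule lin_bilinear_right[OF _ hom_modules(4)], rule lin_eval) simp_all
      then show "linear_map k (linear_homs k V W) W (\<lambda>L. conj_map V W a b L v)" by (simp add: conj_map_def)
    qed (simp_all del: linear_homs_sel)
  qed (simp_all add: conj_map_bilinear del: linear_homs_sel)
next
  fix L assume L: "L \<in> carrier (linear_homs k V W)"
  show "linear_map k H2 (linear_homs k V W)
     (\<lambda>s. tensor_lift (linear_homs k V W) (\<lambda>a b. conj_map V W a b L) s)"
    by (rule tensor_lift_linear) (simp_all add: conj_map_bilinear[OF L])
qed

lemma hom_act_simple:
  "a \<in> carrier H \<Longrightarrow> b \<in> carrier H \<Longrightarrow> L \<in> carrier (linear_homs k V W) \<Longrightarrow>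
    hom_act V W (pure2 a b) L = conj_map V W a b L"
  unfolding hom_act_def by (rule tensor_lift_simple[OF _ _ _ conj_map_bilinear]) simp_all

lemma hom_act_closed:
  "s \<in> carrier H2 \<Longrightarrow> L \<in> carrier (linear_homs k V W) \<Longrightarrow> hom_act V W s L \<in> carrier (linear_homs k V W)"
  by (rule bilinearD(3)[OF hom_act_bilinear])

lemma conj_map_conj_map:
  assumes [simp]: "a \<in> carrier H" "b \<in> carrier H" "c \<in> carrier H" "d \<in> carrier H" and L: "L \<in> carrier (linear_homs k V W)"
  shows "conj_map V W (a \<cdot> c) (b \<cdot> d) L = conj_map V W a b (conj_map V W c d L)"
proof -
  have [simp]: "L v \<in> carrier W" if "v \<in> carrier V" for v using L linear_mapD(1)[of k V W L] that by simp
  show ?thesis unfolding conj_map_def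
    by (rule restrict_ext) (simp add: is_actionD(3)[OF left_moduleD(2)[OF V]] is_actionD(3)[OF left_moduleD(2)[OF W]])
qed

lemma is_action_hom_act: "is_action k H2 (linear_homs k V W) (hom_act V W)"
  unfolding is_action_def
proof (intro conjI ballI hom_act_bilinear)
  note B = hom_act_bilinear
  fix L assume L: "L \<in> carrier (linear_homs k V W)"
  have Lc [simp]: "L v \<in> carrier W" if "v \<in> carrier V" for v using L linear_mapD(1)[of k V W L] that by simp
  have "conj_map V W \<one>\<^bsub>H\<^esub> \<one>\<^bsub>H\<^esub> L = L"
    by (rule linear_homs_eqI[OF conj_map_closed[OF _ _ L] L])
      (simp_all add: conj_map_def is_actionD(2)[OF left_moduleD(2)[OF V]] is_actionD(2)[OF left_moduleD(2)[OF W]])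
  then show "hom_act V W \<one>\<^bsub>H2\<^esub> L = L" using L by (simp add: hom_act_simple del: linear_homs_sel)
  note [lin] = lin_bilinear_left[OF _ B] lin_bilinear_right[OF _ B]
  fix s t assume s: "s \<in> carrier H2" and t: "t \<in> carrier H2"
  have 1: "\<forall>t\<in>carrier H2. hom_act V W (pure2 a b \<cdot>\<^sub>2 t) L =
      hom_act V W (pure2 a b) (hom_act V W t L)" if [simp]: "a \<in> carrier H" "b \<in> carrier H" for a b
    by (rule tensor_eqI, (rule lin | simp add: L hom_act_simple conj_map_conj_map hom_act_closed del: linear_homs_sel)+)
  have "\<forall>s\<in>carrier H2. hom_act V W (s \<cdot>\<^sub>2 t) L = hom_act V W s (hom_act V W t L)"
    by (rule tensor_eqI, (rule lin | simp add: L 1 t hom_act_closed del: linear_homs_sel)+)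
  then show "hom_act V W (s \<cdot>\<^sub>2 t) L = hom_act V W s (hom_act V W t L)" using s by blast
qed

lemma left_module_hom_ob: "left_module k H (hom_ob k H V W)"
  using is_action_pullback[OF is_action_hom_act comult_hom]
  by (simp add: left_module_iff hom_ob_alt del: linear_homs_sel)

end

text \<open>
  \<open>L \<mapsto> g \<circ> L \<circ> f\<close> commutes with the action of all of \<open>H \<otimes> H\<close>, as \<open>f\<close> and \<open>g\<close> are equivariant.
\<close>

lemma hom_mor_hom:
  assumes V: "left_module k H V" and W: "left_module k H W" and V': "left_module k H V'" and W': "left_module k H W'"
    and f: "f \<in> lmod_hom k H V' V" and g: "g \<in> lmod_hom k H W W'"
  shows "hom_mor k V W V' f g \<in> lmod_hom k H (hom_ob k H V W) (hom_ob k H V' W')"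
proof -
  note [simp] = left_moduleD(1,3,4)[OF V] left_moduleD(1,3,4)[OF W] left_moduleD(1,3,4)[OF V'] left_moduleD(1,3,4)[OF W']
  note [simp] = lmod_homD(4)[OF f] lmod_homD(4)[OF g]
  let ?F = "\<lambda>L. \<lambda>v\<in>carrier V'. g (L (f v))"
  have F: "?F L \<in> carrier (linear_homs k V' W')" if "L \<in> carrier (linear_homs k V W)" for L
    by (rule restrict_linear_homs[OF lin_comp[OF lin_comp[OF lmod_homD(2)[OF f]] lmod_homD(2)[OF g]]]) (use that in simp_all)
  have Fl: "linear_map k (linear_homs k V W) (linear_homs k V' W') ?F"
  proof (rule linear_map_into_homs[OF F])
    fix v assume v [simp]: "v \<in> carrier V'"
    have "linear_map k (linear_homs k V W) W' (\<lambda>L. g (L (f v)))"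
      by (rule lin_comp[OF lin_eval lmod_homD(2)[OF g]]) simp
    then show "linear_map k (linear_homs k V W) W' (\<lambda>L. ?F L v)" by simp
  qed simp_all
  have "restrict ?F (carrier (hom_ob k H V W)) \<in> lmod_hom k H (hom_ob k H V W) (hom_ob k H V' W')"
  proof (rule restrict_lmod_hom[OF left_module_hom_ob[OF V W]])
    show "linear_map k (hom_ob k H V W) (hom_ob k H V' W') ?F" using Fl by simp
    fix h L assume h: "h \<in> carrier H" and "L \<in> carrier (hom_ob k H V W)"
    then have L: "L \<in> carrier (linear_homs k V W)" by simp
    have [simp]: "L v \<in> carrier W" if "v \<in> carrier V" for v using L linear_mapD(1)[of k V W L] that by simp
    have "\<forall>s\<in>carrier H2. ?F (hom_act V W s L) = hom_act V' W' s (?F L)"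
    proof (rule tensor_eqI)
      show "linear_map k H2 (linear_homs k V' W') (\<lambda>s. ?F (hom_act V W s L))"
        by (rule lin_comp[OF bilinearD(2)[OF hom_act_bilinear[OF V W] L] Fl])
      show "linear_map k H2 (linear_homs k V' W') (\<lambda>s. hom_act V' W' s (?F L))"
        by (rule bilinearD(2)[OF hom_act_bilinear[OF V' W'] F[OF L]])
      show "\<forall>a\<in>carrier H. \<forall>b\<in>carrier H. ?F (hom_act V W (pure2 a b) L) = hom_act V' W' (pure2 a b) (?F L)"
      proof (intro ballI)
        fix a b assume [simp]: "a \<in> carrier H" "b \<in> carrier H"
        show "?F (hom_act V W (pure2 a b) L) = hom_act V' W' (pure2 a b) (?F L)"
          unfolding hom_act_simple[OF V W \<open>a \<in> _\<close> \<open>b \<in> _\<close> L] hom_act_simple[OF V' W' \<open>a \<in> _\<close> \<open>b \<in> _\<close> F[OF L]]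
          unfolding conj_map_def
          by (rule restrict_ext) (simp add: lmod_homD(3)[OF f] lmod_homD(3)[OF g])
      qed
    qed simp_all
    then show "?F (act (hom_ob k H V W) h L) = act (hom_ob k H V' W') h (?F L)" using h by simp
  qed
  then show ?thesis by (simp add: hom_mor_def)
qed

lemma is_functor_hom:
  "is_functor (prod_cat (op_cat (LMod k H)) (LMod k H)) (LMod k H) (hom_func k H)"
proof (rule is_functorI, goal_cases)
  case (1 a)
  then show ?case by (auto simp: hom_func_def left_module_hom_ob)
next
  case (2 a b m)
  then show ?case by (cases a; cases b; cases m) (auto simp: hom_func_def intro: hom_mor_hom)
next
  case (3 a)
  have "hom_mor k V W V (\<lambda>v\<in>carrier V. v) (\<lambda>v\<in>carrier W. v) = (\<lambda>v\<in>carrier (linear_homs k V W). v)" 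
    for V :: "('k, 'h, 'c) lmod" and W :: "('k, 'h, 'd) lmod"
    unfolding hom_mor_def using linear_mapD(1)[of k V W]
    by (auto intro!: restrict_ext ext simp: extensional_def restrict_def)
  then show ?case by (cases a) (simp add: hom_func_def del: linear_homs_sel)
next
  case (4 a b c m n)
  obtain V W V' W' V'' W'' f g f' g' where e: "a = (V, W)" "b = (V', W')" "c = (V'', W'')" "m = (f, g)" "n = (f', g')"
    by (metis surj_pair)
  have f: "f \<in> lmod_hom k H V' V" "f' \<in> lmod_hom k H V'' V'" and g: "g \<in> lmod_hom k H W W'"
    and L: "left_module k H V" "left_module k H V'" "left_module k H W" "left_module k H W'"
    using 4 by (auto simp: e)
  note [simp] = lmod_homD(4)[OF f(1)] lmod_homD(4)[OF f(2)]
  have c: "hom_mor k V W V' f g L \<in> carrier (linear_homs k V' W')" if "L \<in> carrier (linear_homs k V W)" for L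
    using lmod_homD(4)[OF hom_mor_hom[OF L(1,3,2,4) f(1) g], of L] that by (simp only: hom_ob_simps)
  have "hom_mor k V W V'' (compose (carrier V'') f f') (compose (carrier W) g' g) L =
     hom_mor k V' W' V'' f' g' (hom_mor k V W V' f g L)" if M: "L \<in> carrier (linear_homs k V W)" for L
  proof -
    have [simp]: "L v \<in> carrier W" if "v \<in> carrier V" for v using M linear_mapD(1)[of k V W L] that by simp
    have "hom_mor k V' W' V'' f' g' (hom_mor k V W V' f g L) = (\<lambda>v\<in>carrier V''. g' (hom_mor k V W V' f g L (f' v)))"
      using c[OF M] by (simp add: hom_mor_def[of k V' W'] del: linear_homs_sel)
    also have "\<dots> = (\<lambda>v\<in>carrier V''. g' (g (L (f (f' v)))))"
      using M by (intro restrict_ext) (simp add: hom_mor_def del: linear_homs_sel)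
    also have "\<dots> = hom_mor k V W V'' (compose (carrier V'') f f') (compose (carrier W) g' g) L"
      using M unfolding hom_mor_def by (simp add: compose_def del: linear_homs_sel cong: restrict_cong)
    finally show ?thesis by simp
  qed
  then have "hom_mor k V W V'' (compose (carrier V'') f f') (compose (carrier W) g' g) =
    compose (carrier (linear_homs k V W)) (hom_mor k V' W' V'' f' g') (hom_mor k V W V' f g)"
    by (auto simp: fun_eq_iff compose_def hom_mor_def simp del: linear_homs_sel)
  then show ?case by (simp add: hom_func_def e del: linear_homs_sel)
qed

end

section \<open>The adjunction\<close>

context quasi_hopf_algebra
begin

text \<open>
  The pure tensor \<open>a \<otimes> b\<close> sends \<open>L\<close> and \<open>w\<close> to \<open>a L(b w)\<close>.  At \<open>J phi\<close> this is the evaluation map of the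
  internal hom.
\<close>

definition pairing :: "('k, 'h, 'w) lmod \<Rightarrow> ('k, 'h, 'x) lmod \<Rightarrow> ('h, 'h) tens \<Rightarrow> ('w \<Rightarrow> 'x) \<Rightarrow> 'w \<Rightarrow> 'x" where
  "pairing W X s L w = tensor_lift X (\<lambda>a b. act X a (L (act W b w))) s"

context
  fixes W :: "('k, 'h, 'w) lmod" and X :: "('k, 'h, 'x) lmod"
  assumes W: "left_module k H W" and X: "left_module k H X"
begin

lemmas pairing_lin = hom_modules_lin[OF W X]
lemmas [simp] = hom_modules[OF W X]

lemma pairing_bilinear_inner:
  assumes L: "L \<in> carrier (linear_homs k W X)" and w [simp]: "w \<in> carrier W"
  shows "bilinear k H H X (\<lambda>a b. act X a (L (act W b w)))"
proof -
  have Ll: "linear_map k W X L" using L by simp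
  note [lin] = pairing_lin lin_comp[OF _ Ll]
  note [simp] = linear_mapD(1)[OF Ll]
  show ?thesis by (rule bilinearI) (rule lin | simp)+
qed

lemma pairing_simple:
  "a \<in> carrier H \<Longrightarrow> b \<in> carrier H \<Longrightarrow> L \<in> carrier (linear_homs k W X) \<Longrightarrow> w \<in> carrier W \<Longrightarrow>
    pairing W X (pure2 a b) L w = act X a (L (act W b w))"
  unfolding pairing_def by (rule tensor_lift_simple[OF _ _ _ pairing_bilinear_inner]) simp_all

lemma pairing_linear_tensor:
  "L \<in> carrier (linear_homs k W X) \<Longrightarrow> w \<in> carrier W \<Longrightarrow> linear_map k H2 X (\<lambda>s. pairing W X s L w)"
  unfolding pairing_def by (rule tensor_lift_linear) (simp_all add: pairing_bilinear_inner del: linear_homs_sel)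

lemma pairing_linear_vec:
  assumes s: "s \<in> carrier H2" and L: "L \<in> carrier (linear_homs k W X)"
  shows "linear_map k W X (\<lambda>w. pairing W X s L w)"
proof -
  have Ll: "linear_map k W X L" using L by simp
  note [lin] = pairing_lin lin_comp[OF _ Ll]
  show ?thesis unfolding pairing_def
    by (rule lin_lift_param[OF s], (rule lin pairing_bilinear_inner | simp add: L del: linear_homs_sel)+)
qed

lemma pairing_linear_hom:
  assumes s: "s \<in> carrier H2" and w: "w \<in> carrier W"
  shows "linear_map k (linear_homs k W X) X (\<lambda>L. pairing W X s L w)"
  unfolding pairing_def
proof (rule lin_lift_param[OF s])
  fix a b assume ab: "a \<in> carrier H" "b \<in> carrier H"
  show "linear_map k (linear_homs k W X) X (\<lambda>L. act X a (L (act W b w)))"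
    by (rule lin_bilinear_right[OF lin_eval hom_modules(4)[OF W X]]) (simp_all add: ab w)
qed (simp_all add: pairing_bilinear_inner w del: linear_homs_sel)

lemma pairing_bilinear: "s \<in> carrier H2 \<Longrightarrow> bilinear k (linear_homs k W X) W X (pairing W X s)"
  by (intro bilinearI pairing_linear_vec pairing_linear_hom)

lemma pairing_one: "L \<in> carrier (linear_homs k W X) \<Longrightarrow> w \<in> carrier W \<Longrightarrow> pairing W X \<one>\<^bsub>H2\<^esub> L w = L w"
  using linear_mapD(1)[of k W X L w]
  by (simp add: pairing_simple is_actionD(2)[OF left_moduleD(2)[OF W]] is_actionD(2)[OF left_moduleD(2)[OF X]])

lemma pairing_in1:
  assumes h [simp]: "h \<in> carrier H" and s: "s \<in> carrier H2"
    and L: "L \<in> carrier (linear_homs k W X)" and w [simp]: "w \<in> carrier W"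
  shows "pairing W X (in1 h \<cdot>\<^sub>2 s) L w = act X h (pairing W X s L w)"
proof -
  have [simp]: "L v \<in> carrier X" if "v \<in> carrier W" for v using L linear_mapD(1)[of k W X L] that by simp
  note P [simp] = pairing_simple[OF _ _ L]
  note [lin] = pairing_lin lin_comp[OF _ pairing_linear_tensor[OF L w]]
  have "\<forall>s\<in>carrier H2. pairing W X (in1 h \<cdot>\<^sub>2 s) L w = act X h (pairing W X s L w)"
    by (rule tensor_eqI, (rule lin | simp add: is_actionD(3)[OF left_moduleD(2)[OF X]])+)
  then show ?thesis using s by blast
qed

text \<open>
  On pure tensors both sides are \<open>p\<^sub>1 u\<^sub>1 L(S(u\<^sub>2) S(p\<^sub>2) \<alpha> p\<^sub>3 c w)\<close>: the antipode that contracts the second slot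
  is the one in the definition of the action on \<open>L\<close>.
\<close>

lemma pairing_J_reassoc:
  assumes p: "p \<in> carrier H3" and u: "u \<in> carrier H2" and c [simp]: "c \<in> carrier H"
    and L: "L \<in> carrier (linear_homs k W X)" and w [simp]: "w \<in> carrier W"
  shows "pairing W X (J (p \<cdot>\<^sub>3 reassoc3 (simple_tensor k H2 H u c))) L w =
    pairing W X (J p) (hom_act W X u L) (act W c w)"
proof -
  have [simp]: "L v \<in> carrier X" if "v \<in> carrier W" for v using L linear_mapD(1)[of k W X L] that by simp
  have hc: "hom_act W X u L \<in> carrier (linear_homs k W X)" if "u \<in> carrier H2" for u
    by (rule hom_act_closed[OF W X that L])
  note mult = is_actionD(3)[OF left_moduleD(2)[OF X]] is_actionD(3)[OF left_moduleD(2)[OF W]]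
  have hl: "linear_map k H2 (linear_homs k W X) (\<lambda>u. hom_act W X u L)"
    by (rule bilinearD(2)[OF hom_act_bilinear[OF W X] L])
  note [lin] = pairing_lin lin_comp[OF _ pairing_linear_tensor[OF L w]]
  let ?L = "\<lambda>p u. pairing W X (J (p \<cdot>\<^sub>3 reassoc3 (simple_tensor k H2 H u c))) L w"
  let ?R = "\<lambda>p u. pairing W X (J p) (hom_act W X u L) (act W c w)"
  have 1: "\<forall>u\<in>carrier H2. ?L (pure3 x (pure2 y z)) u = ?R (pure3 x (pure2 y z)) u"
    if [simp]: "x \<in> carrier H" "y \<in> carrier H" "z \<in> carrier H" for x y z
  proof (rule tensor_eqI)
    show "linear_map k H2 X (?R (pure3 x (pure2 y z)))"
      by (rule lin_comp[OF hl pairing_linear_hom]) simp_all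
    show "\<forall>a\<in>carrier H. \<forall>b\<in>carrier H.
        ?L (pure3 x (pure2 y z)) (pure2 a b) = ?R (pure3 x (pure2 y z)) (pure2 a b)"
    proof (intro ballI)
      fix a b assume [simp]: "a \<in> carrier H" "b \<in> carrier H"
      show "?L (pure3 x (pure2 y z)) (pure2 a b) = ?R (pure3 x (pure2 y z)) (pure2 a b)"
        using hc[of "pure2 a b"]
        by (simp add: hom_act_simple[OF W X] pairing_simple L mult conj_map_closed[OF W X]
              del: linear_homs_sel)
          (simp add: conj_map_def mult)
    qed
  qed (rule lin | simp)+
  have "\<forall>p\<in>carrier H3. ?L p u = ?R p u"
  proof (rule tensor3_eqI)
    show "linear_map k H3 X (\<lambda>p. ?R p u)"
      by (rule lin_comp[OF tail_contract_linear(2) pairing_linear_tensor[OF hc[OF u]]]) simp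
  qed (rule lin 1[THEN bspec] | simp add: u)+
  then show ?thesis using p by blast
qed

end

text \<open>
  The transposes \<open>\<theta>\<close> and \<open>\<theta>'\<close>.  The second one is defined as a linear map first, since equations between
  its values are proved by linearity, and then cut down to the carrier.
\<close>

definition curry_map :: "('k, 'h, 'v) lmod \<Rightarrow> ('k, 'h, 'w) lmod \<Rightarrow> (('v, 'w) tens \<Rightarrow> 'x) \<Rightarrow> 'v \<Rightarrow> 'w \<Rightarrow> 'x" where
  "curry_map V W L = (\<lambda>v\<in>carrier V. \<lambda>w\<in>carrier W.
     L (tensor_act k V W (act V) (act W) (K phi_inv) (simple_tensor k V W v w)))"

definition uncurry_lin :: "('k, 'h, 'v) lmod \<Rightarrow> ('k, 'h, 'w) lmod \<Rightarrow> ('k, 'h, 'x) lmod \<Rightarrow>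
    ('v \<Rightarrow> 'w \<Rightarrow> 'x) \<Rightarrow> ('v, 'w) tens \<Rightarrow> 'x" where
  "uncurry_lin V W X M = tensor_lift X (\<lambda>v w. pairing W X (J phi) (M v) w)"

definition uncurry_map :: "('k, 'h, 'v) lmod \<Rightarrow> ('k, 'h, 'w) lmod \<Rightarrow> ('k, 'h, 'x) lmod \<Rightarrow>
    ('v \<Rightarrow> 'w \<Rightarrow> 'x) \<Rightarrow> ('v, 'w) tens \<Rightarrow> 'x" where
  "uncurry_map V W X M = restrict (uncurry_lin V W X M) (carrier (tensor k V W))"

context
  fixes V :: "('k, 'h, 'v) lmod" and W :: "('k, 'h, 'w) lmod" and X :: "('k, 'h, 'x) lmod"
  assumes V: "left_module k H V" and W: "left_module k H W" and X: "left_module k H X"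
begin

abbreviation "tact \<equiv> tensor_act k V W (act V) (act W)"

lemma curry_modules [simp]: "module k V" "module k W" "module k X"
  using V W X by (auto dest: left_moduleD)

lemma curry_actions [simp]:
  "is_action k H V (act V)" "is_action k H W (act W)" "is_action k H X (act X)"
  "h \<in> carrier H \<Longrightarrow> v \<in> carrier V \<Longrightarrow> act V h v \<in> carrier V"
  "h \<in> carrier H \<Longrightarrow> w \<in> carrier W \<Longrightarrow> act W h w \<in> carrier W"
  "h \<in> carrier H \<Longrightarrow> x \<in> carrier X \<Longrightarrow> act X h x \<in> carrier X"
  using V W X by (auto dest: left_moduleD)

lemma tact_action: "is_action k H2 (tensor k V W) tact"
  by simp

lemma tact_closed [simp]: "s \<in> carrier H2 \<Longrightarrow> t \<in> carrier (tensor k V W) \<Longrightarrow> tact s t \<in> carrier (tensor k V W)"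
  by (rule bilinearD(3)[OF is_action_bilinear[OF tact_action]])

lemmas tact_lin = lin_bilinear_left[OF _ is_action_bilinear[OF tact_action]] lin_bilinear_right[OF _ is_action_bilinear[OF tact_action]]

lemma tact_simple [simp]:
  "a \<in> carrier H \<Longrightarrow> b \<in> carrier H \<Longrightarrow> v \<in> carrier V \<Longrightarrow> w \<in> carrier W \<Longrightarrow>
   tact (pure2 a b) (simple_tensor k V W v w) = simple_tensor k V W (act V a v) (act W b w)"
  by (rule tensor_act_simple[where A=H and B=H]) simp_all

lemma tact_mult: "s \<in> carrier H2 \<Longrightarrow> s' \<in> carrier H2 \<Longrightarrow> t \<in> carrier (tensor k V W) \<Longrightarrow>
    tact (s \<cdot>\<^sub>2 s') t = tact s (tact s' t)"
  by (rule is_actionD(3)[OF tact_action])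

lemma curry_act_one [simp]:
  "v \<in> carrier V \<Longrightarrow> act V \<one>\<^bsub>H\<^esub> v = v" "w \<in> carrier W \<Longrightarrow> act W \<one>\<^bsub>H\<^esub> w = w" "x \<in> carrier X \<Longrightarrow> act X \<one>\<^bsub>H\<^esub> x = x"
  using is_actionD(2)[OF curry_actions(1)] is_actionD(2)[OF curry_actions(2)] is_actionD(2)[OF curry_actions(3)] by simp_all

lemma curry_map_apply: "v \<in> carrier V \<Longrightarrow> w \<in> carrier W \<Longrightarrow>
   curry_map V W L v w = L (tact (K phi_inv) (simple_tensor k V W v w))"
  by (simp add: curry_map_def)

lemma curry_map_closed:
  assumes L: "linear_map k (tensor k V W) X L" and v [simp]: "v \<in> carrier V"
  shows "curry_map V W L v \<in> carrier (linear_homs k W X)"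
proof -
  note [lin] = tact_lin lin_comp[OF _ L]
  have "linear_map k W X (\<lambda>w. L (tact (K phi_inv) (simple_tensor k V W v w)))"
    by (rule lin | simp)+
  then show ?thesis using restrict_linear_homs[of k W X] by (simp add: curry_map_def)
qed

lemma curry_map_linear:
  assumes L: "linear_map k (tensor k V W) X L"
  shows "linear_map k V (linear_homs k W X) (curry_map V W L)"
proof (rule linear_map_into_homs)
  show "curry_map V W L v \<in> carrier (linear_homs k W X)" if "v \<in> carrier V" for v
    by (rule curry_map_closed[OF L that])
  fix w assume w [simp]: "w \<in> carrier W"
  note [lin] = tact_lin lin_comp[OF _ L]
  have "linear_map k V X (\<lambda>v. L (tact (K phi_inv) (simple_tensor k V W v w)))"
    by (rule lin | simp)+
  then show "linear_map k V X (\<lambda>v. curry_map V W L v w)"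
    by (rule linear_map_cong) (simp_all add: curry_map_apply)
qed simp

text \<open>
  Equivariance of \<open>L\<close> turns the outer action into one of \<open>\<Delta>(a)\<close>, so that \<open>K_reassoc\<close> collects all coefficients.
\<close>

lemma hom_act_curry_map:
  assumes L: "L \<in> lmod_hom k H (tensor_ob k H V W) X"
    and s: "s \<in> carrier H2" and v [simp]: "v \<in> carrier V" and w [simp]: "w \<in> carrier W"
  shows "hom_act W X s (curry_map V W L v) w =
    L (tact (K (comult_left s \<cdot>\<^sub>3 phi_inv)) (simple_tensor k V W v w))"
proof -
  have Ll: "linear_map k (tensor k V W) X L" using lmod_homD(2)[OF L] by simp
  note c = curry_map_closed[OF Ll v]
  note [lin] = tact_lin lin_comp[OF _ Ll]
  let ?vw = "simple_tensor k V W v w"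
  let ?L = "\<lambda>s. hom_act W X s (curry_map V W L v) w"
  let ?R = "\<lambda>s. L (tact (K (comult_left s \<cdot>\<^sub>3 phi_inv)) ?vw)"
  have "\<forall>s\<in>carrier H2. ?L s = ?R s"
  proof (rule tensor_eqI)
    show "linear_map k H2 X ?L"
      by (rule lin_comp[OF bilinearD(2)[OF hom_act_bilinear[OF W X] c] lin_eval[OF w]])
    show "\<forall>a\<in>carrier H. \<forall>b\<in>carrier H. ?L (pure2 a b) = ?R (pure2 a b)"
    proof (intro ballI)
      fix a b assume [simp]: "a \<in> carrier H" "b \<in> carrier H"
      let ?u = "tact (K phi_inv) (simple_tensor k V W v (act W (S b) w))"
      have "?L (pure2 a b) = act X a (L ?u)"
        using c by (simp add: hom_act_simple[OF W X] conj_map_def curry_map_apply del: linear_homs_sel)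
      also have "\<dots> = L (tact (\<Delta>\<^bsub>H\<^esub> a) ?u)"
        using lmod_homD(3)[OF L, of a ?u] by simp
      also have "\<dots> = L (tact (\<Delta>\<^bsub>H\<^esub> a) (tact (K phi_inv) (tact (in2 (S b)) ?vw)))"
        by simp
      also have "\<dots> = L (tact (\<Delta>\<^bsub>H\<^esub> a \<cdot>\<^sub>2 K phi_inv \<cdot>\<^sub>2 in2 (S b)) ?vw)"
        by (simp add: tact_mult del: tact_simple)
      also have "\<Delta>\<^bsub>H\<^esub> a \<cdot>\<^sub>2 K phi_inv \<cdot>\<^sub>2 in2 (S b) = K (comult_left (pure2 a b) \<cdot>\<^sub>3 phi_inv)"
        using K_reassoc[of "\<Delta>\<^bsub>H\<^esub> a" b phi_inv] by simp
      finally show "?L (pure2 a b) = ?R (pure2 a b)" .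
    qed
  qed (rule lin | simp)+
  then show ?thesis using s by blast
qed

lemma phi_inv_coassoc:
  assumes h [simp]: "h \<in> carrier H"
  shows "comult_left (\<Delta>\<^bsub>H\<^esub> h) \<cdot>\<^sub>3 phi_inv = phi_inv \<cdot>\<^sub>3 comult_right (\<Delta>\<^bsub>H\<^esub> h)"
proof -
  interpret M: Group.monoid "H3" by (rule tensor3_monoid)
  have c: "comult_left (\<Delta>\<^bsub>H\<^esub> h) \<in> carrier H3" "comult_right (\<Delta>\<^bsub>H\<^esub> h) \<in> carrier H3" by simp_all
  have "comult_left (\<Delta>\<^bsub>H\<^esub> h) \<cdot>\<^sub>3 phi_inv =
    (phi_inv \<cdot>\<^sub>3 phi) \<cdot>\<^sub>3 comult_left (\<Delta>\<^bsub>H\<^esub> h) \<cdot>\<^sub>3 phi_inv"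
    by (simp only: phi_inv_left M.l_one c)
  also have "\<dots> = phi_inv \<cdot>\<^sub>3 (phi \<cdot>\<^sub>3 comult_left (\<Delta>\<^bsub>H\<^esub> h)) \<cdot>\<^sub>3 phi_inv"
    by (simp only: M.m_assoc M.m_closed c phi_closed phi_inv_closed)
  also have "\<dots> = phi_inv \<cdot>\<^sub>3 comult_right (\<Delta>\<^bsub>H\<^esub> h) \<cdot>\<^sub>3 (phi \<cdot>\<^sub>3 phi_inv)"
    by (simp only: quasi_coassoc[OF h, symmetric] M.m_assoc M.m_closed c phi_closed phi_inv_closed)
  also have "\<dots> = phi_inv \<cdot>\<^sub>3 comult_right (\<Delta>\<^bsub>H\<^esub> h)"
    by (simp only: phi_inv_right M.r_one M.m_closed c phi_inv_closed)
  finally show ?thesis .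
qed

text \<open>
  For \<open>s = \<Delta>(h)\<close> the coefficient \<open>K ((\<Delta> \<otimes> id) \<Delta>(h) \<phi>\<^sup>-\<^sup>1)\<close> equals \<open>K (\<phi>\<^sup>-\<^sup>1 (id \<otimes> \<Delta>) \<Delta>(h)) = K \<phi>\<^sup>-\<^sup>1 (h \<otimes> 1)\<close>.
\<close>

lemma curry_map_hom:
  assumes L: "L \<in> lmod_hom k H (tensor_ob k H V W) X"
  shows "curry_map V W L \<in> lmod_hom k H V (hom_ob k H W X)"
proof -
  have Ll: "linear_map k (tensor k V W) X L" using lmod_homD(2)[OF L] by simp
  have "restrict (curry_map V W L) (carrier V) \<in> lmod_hom k H V (hom_ob k H W X)"
  proof (rule restrict_lmod_hom[OF V])
    show "linear_map k V (hom_ob k H W X) (curry_map V W L)" using curry_map_linear[OF Ll] by simp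
    fix h v assume h [simp]: "h \<in> carrier H" and v [simp]: "v \<in> carrier V"
    have "curry_map V W L (act V h v) = hom_act W X (\<Delta>\<^bsub>H\<^esub> h) (curry_map V W L v)"
    proof (rule linear_homs_eqI[OF curry_map_closed[OF Ll] hom_act_closed[OF W X _ curry_map_closed[OF Ll]]])
      fix w assume w [simp]: "w \<in> carrier W"
      have "hom_act W X (\<Delta>\<^bsub>H\<^esub> h) (curry_map V W L v) w =
        L (tact (K (phi_inv \<cdot>\<^sub>3 comult_right (\<Delta>\<^bsub>H\<^esub> h))) (simple_tensor k V W v w))"
        by (simp add: hom_act_curry_map[OF L] phi_inv_coassoc)
      also have "\<dots> = L (tact (K phi_inv) (simple_tensor k V W (act V h v) w))"
        by (simp add: K_comult_right tact_mult)
      finally show "curry_map V W L (act V h v) w = hom_act W X (\<Delta>\<^bsub>H\<^esub> h) (curry_map V W L v) w"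
        by (simp add: curry_map_apply)
    qed simp_all
    then show "curry_map V W L (act V h v) = act (hom_ob k H W X) h (curry_map V W L v)" by simp
  qed
  then show ?thesis by (simp add: curry_map_def)
qed

context
  fixes M assumes M: "M \<in> lmod_hom k H V (hom_ob k H W X)"
begin

lemma transpose_linear: "linear_map k V (linear_homs k W X) M"
  using lmod_homD(2)[OF M] by simp

lemma transpose_closed: "v \<in> carrier V \<Longrightarrow> M v \<in> carrier (linear_homs k W X)"
  using lmod_homD(4)[OF M] by (simp only: hom_ob_simps)

lemma transpose_act: "h \<in> carrier H \<Longrightarrow> v \<in> carrier V \<Longrightarrow> M (act V h v) = hom_act W X (\<Delta>\<^bsub>H\<^esub> h) (M v)"
  using lmod_homD(3)[OF M] by simp

lemma J_phi [simp]: "J phi \<in> carrier H2" by simp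

lemma uncurry_bilinear: "bilinear k V W X (\<lambda>v w. pairing W X (J phi) (M v) w)"
  by (rule bilinear_comp_lin[OF pairing_bilinear[OF W X J_phi] transpose_linear lin_id])

lemma uncurry_linear: "linear_map k (tensor k V W) X (uncurry_lin V W X M)"
  unfolding uncurry_lin_def by (rule tensor_lift_linear[OF _ _ _ uncurry_bilinear]) simp_all

lemma uncurry_simple: "v \<in> carrier V \<Longrightarrow> w \<in> carrier W \<Longrightarrow>
   uncurry_lin V W X M (simple_tensor k V W v w) = pairing W X (J phi) (M v) w"
  unfolding uncurry_lin_def by (rule tensor_lift_simple[OF _ _ _ uncurry_bilinear]) simp_all

text \<open>
  The analogue of \<open>hom_act_curry_map\<close>, by equivariance of \<open>M\<close> and \<open>pairing_J_reassoc\<close>.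
\<close>

lemma uncurry_tact:
  assumes s: "s \<in> carrier H2" and v [simp]: "v \<in> carrier V" and w [simp]: "w \<in> carrier W"
  shows "uncurry_lin V W X M (tact s (simple_tensor k V W v w)) =
     pairing W X (J (phi \<cdot>\<^sub>3 comult_left s)) (M v) w"
proof -
  note [lin] = tact_lin lin_comp[OF _ uncurry_linear] lin_comp[OF _ pairing_linear_tensor[OF W X transpose_closed[OF v] w]]
  have "\<forall>s\<in>carrier H2. uncurry_lin V W X M (tact s (simple_tensor k V W v w)) =
     pairing W X (J (phi \<cdot>\<^sub>3 comult_left s)) (M v) w"
    by (rule tensor_eqI, (rule lin | simp add: uncurry_simple transpose_act pairing_J_reassoc[OF W X] transpose_closed del: linear_homs_sel)+)
  then show ?thesis using s by blast
qed

text \<open>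
  \<open>J (\<phi> (\<Delta> \<otimes> id) \<Delta>(h)) = J ((id \<otimes> \<Delta>) \<Delta>(h) \<phi>) = (h \<otimes> 1) J \<phi>\<close>, and the factor \<open>h\<close> leaves the pairing.
\<close>

lemma uncurry_act:
  assumes h [simp]: "h \<in> carrier H" and t: "t \<in> carrier (tensor k V W)"
  shows "uncurry_lin V W X M (tact (\<Delta>\<^bsub>H\<^esub> h) t) = act X h (uncurry_lin V W X M t)"
proof -
  note [lin] = tact_lin lin_comp[OF _ uncurry_linear] pairing_lin[OF W X]
  have "\<forall>t\<in>carrier (tensor k V W). uncurry_lin V W X M (tact (\<Delta>\<^bsub>H\<^esub> h) t) = act X h (uncurry_lin V W X M t)"
  proof (rule tensor_eqI)
    show "\<forall>v\<in>carrier V. \<forall>w\<in>carrier W. uncurry_lin V W X M (tact (\<Delta>\<^bsub>H\<^esub> h) (simple_tensor k V W v w)) =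
       act X h (uncurry_lin V W X M (simple_tensor k V W v w))"
      by (simp add: uncurry_tact uncurry_simple quasi_coassoc[symmetric] J_comult_right pairing_in1[OF W X] transpose_closed del: linear_homs_sel)
  qed (rule lin | simp)+
  then show ?thesis using t by blast
qed

lemma uncurry_map_hom: "uncurry_map V W X M \<in> lmod_hom k H (tensor_ob k H V W) X"
proof -
  have "restrict (uncurry_lin V W X M) (carrier (tensor_ob k H V W)) \<in> lmod_hom k H (tensor_ob k H V W) X"
    by (rule restrict_lmod_hom) (simp_all add: V W uncurry_linear uncurry_act)
  then show ?thesis by (simp add: uncurry_map_def)
qed

text \<open>
  The composite is the pairing at \<open>J (\<phi> (\<Delta> \<otimes> id)(K \<phi>\<^sup>-\<^sup>1))\<close>, which is the element evaluated in \<open>U4_phi\<close>.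
\<close>

lemma curry_uncurry: "curry_map V W (uncurry_map V W X M) = M"
proof (rule lmod_hom_eqI[OF curry_map_hom[OF uncurry_map_hom] M])
  fix v assume v [simp]: "v \<in> carrier V"
  have ul: "linear_map k (tensor k V W) X (uncurry_map V W X M)"
    using lmod_homD(2)[OF uncurry_map_hom] by simp
  show "curry_map V W (uncurry_map V W X M) v = M v"
  proof (rule linear_homs_eqI[OF curry_map_closed[OF ul v] transpose_closed[OF v]])
    fix w assume w [simp]: "w \<in> carrier W"
    have 1: "\<forall>q\<in>carrier H3. J (phi \<cdot>\<^sub>3 comult_left (K q)) = U4 (pad phi \<cdot>\<^sub>4 comult_12 q)"
      by (rule tensor_eqI, (rule lin algebra_homD(1)[OF comult_12_hom] | simp add: J_contract_beta)+)
    have "curry_map V W (uncurry_map V W X M) v w = uncurry_lin V W X M (tact (K phi_inv) (simple_tensor k V W v w))"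
      by (simp add: curry_map_apply uncurry_map_def)
    also have "\<dots> = pairing W X (J (phi \<cdot>\<^sub>3 comult_left (K phi_inv))) (M v) w"
      by (rule uncurry_tact) simp_all
    also have "J (phi \<cdot>\<^sub>3 comult_left (K phi_inv)) = \<one>\<^bsub>H2\<^esub>"
      using 1 U4_phi by (simp del: tensor_one)
    also have "pairing W X \<one>\<^bsub>H2\<^esub> (M v) w = M v w"
      by (rule pairing_one[OF W X transpose_closed]) simp_all
    finally show "curry_map V W (uncurry_map V W X M) v w = M v w" .
  qed
qed

end

text \<open>
  The composite acts with \<open>\<Delta>(a) K(\<phi>\<^sup>-\<^sup>1) (1 \<otimes> y)\<close>, summed over \<open>a \<otimes> y = J \<phi>\<close>.  This is the element evaluated in
  \<open>T4_phi\<close>.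
\<close>

lemma uncurry_curry:
  assumes L: "L \<in> lmod_hom k H (tensor_ob k H V W) X"
  shows "uncurry_map V W X (curry_map V W L) = L"
proof -
  note C = curry_map_hom[OF L]
  have Ll: "linear_map k (tensor k V W) X L" using lmod_homD(2)[OF L] by simp
  have "\<forall>t\<in>carrier (tensor k V W). uncurry_lin V W X (curry_map V W L) t = L t"
  proof (rule tensor_eqI[OF uncurry_linear[OF C] Ll])
    show "\<forall>v\<in>carrier V. \<forall>w\<in>carrier W. uncurry_lin V W X (curry_map V W L) (simple_tensor k V W v w) = L (simple_tensor k V W v w)"
    proof (intro ballI)
      fix v w assume v [simp]: "v \<in> carrier V" and w [simp]: "w \<in> carrier W"
      let ?vw = "simple_tensor k V W v w"
      note cc = curry_map_closed[OF Ll v]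
      note [lin] = tact_lin lin_comp[OF _ Ll] lin_comp[OF _ pairing_linear_tensor[OF W X cc w]]
      let ?L = "\<lambda>p. pairing W X (J p) (curry_map V W L v) w"
      let ?R = "\<lambda>p. L (tact (T4 (comult_12 p \<cdot>\<^sub>4 pad phi_inv)) ?vw)"
      have 1: "\<forall>p\<in>carrier H3. ?L p = ?R p"
      proof (rule tensor_eqI)
        show "\<forall>a\<in>carrier H. \<forall>t\<in>carrier H2. ?L (pure3 a t) = ?R (pure3 a t)"
        proof (intro ballI)
          fix a t assume [simp]: "a \<in> carrier H" "t \<in> carrier H2"
          let ?y = "contract_alpha t"
          let ?u = "tact (K phi_inv) (simple_tensor k V W v (act W ?y w))"
          have "?L (pure3 a t) = act X a (L ?u)"
            using cc by (simp add: pairing_simple[OF W X] curry_map_apply del: linear_homs_sel)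
          also have "\<dots> = L (tact (\<Delta>\<^bsub>H\<^esub> a) ?u)"
            using lmod_homD(3)[OF L, of a ?u] by simp
          also have "\<dots> = L (tact (\<Delta>\<^bsub>H\<^esub> a) (tact (K phi_inv) (tact (in2 ?y) ?vw)))"
            by simp
          also have "\<dots> = L (tact (\<Delta>\<^bsub>H\<^esub> a \<cdot>\<^sub>2 K phi_inv \<cdot>\<^sub>2 in2 ?y) ?vw)"
            by (simp add: tact_mult del: tact_simple)
          also have "\<Delta>\<^bsub>H\<^esub> a \<cdot>\<^sub>2 K phi_inv \<cdot>\<^sub>2 in2 ?y = T4 (comult_12 (pure3 a t) \<cdot>\<^sub>4 pad phi_inv)"
            using K_contract_alpha[of "\<Delta>\<^bsub>H\<^esub> a" t phi_inv] by simp
          finally show "?L (pure3 a t) = ?R (pure3 a t)" .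
        qed
      qed (rule lin algebra_homD(1)[OF comult_12_hom] | simp)+
      have "uncurry_lin V W X (curry_map V W L) ?vw = pairing W X (J phi) (curry_map V W L v) w"
        by (rule uncurry_simple[OF C]) simp_all
      also have "\<dots> = L (tact (T4 (comult_12 phi \<cdot>\<^sub>4 pad phi_inv)) ?vw)"
        using 1 by simp
      also have "\<dots> = L ?vw"
        unfolding T4_phi by simp
      finally show "uncurry_lin V W X (curry_map V W L) ?vw = L ?vw" .
    qed
  qed simp_all
  then show ?thesis
    using lmod_homD(1)[OF uncurry_map_hom[OF C]] lmod_homD(1)[OF L]
    by (intro extensionalityI[of _ "carrier (tensor k V W)"]) (simp_all add: uncurry_map_def)
qed

lemma curry_map_bij:
  "bij_betw (curry_map V W) (lmod_hom k H (tensor_ob k H V W) X) (lmod_hom k H V (hom_ob k H W X))"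
  by (rule bij_betwI[where g="uncurry_map V W X"])
    (auto simp: curry_map_hom uncurry_map_hom uncurry_curry curry_uncurry)

end

text \<open>
  \<open>f \<otimes> g\<close> commutes with the action of every element of \<open>H \<otimes> H\<close>, in particular with that of \<open>K phi_inv\<close>.
\<close>

lemma curry_map_natural:
  assumes V: "left_module k H V" and W: "left_module k H W" and X: "left_module k H X"
    and V': "left_module k H V'" and W': "left_module k H W'" and X': "left_module k H X'"
    and f: "f \<in> lmod_hom k H V' V" and g: "g \<in> lmod_hom k H W' W" and l: "l \<in> lmod_hom k H X X'"
    and L: "L \<in> lmod_hom k H (tensor_ob k H V W) X"
  shows "curry_map V' W'
            (compose (carrier (tensor_ob k H V' W')) l
              (compose (carrier (tensor_ob k H V' W')) L (tensor_mor k V' W' V W f g))) =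
          compose (carrier V') (hom_mor k W X W' g l) (compose (carrier V') (curry_map V W L) f)"
proof -
  note [simp] = curry_modules[OF V W X] curry_modules[OF V' W' X'] curry_actions(1,2)[OF V W X] curry_actions(1,2)[OF V' W' X']
    lmod_homD(2,4)[OF f] lmod_homD(2,4)[OF g] tact_closed[OF V' W' X'] tact_closed[OF V W X]
  have Ll: "linear_map k (tensor k V W) X L" using lmod_homD(2)[OF L] by simp
  note cc = curry_map_closed[OF V W X Ll]
  have "l (L (tensor_map k V W f g (tensor_act k V' W' (act V') (act W') (K phi_inv) (simple_tensor k V' W' v w)))) =
     l (curry_map V W L (f v) (g w))" if [simp]: "v \<in> carrier V'" "w \<in> carrier W'" for v w
  proof -
    have "tensor_map k V W f g (tensor_act k V' W' (act V') (act W') (K phi_inv) (simple_tensor k V' W' v w)) =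
      tensor_act k V W (act V) (act W) (tensor_map k H H id id (K phi_inv)) (tensor_map k V W f g (simple_tensor k V' W' v w))"
      by (rule tensor_map_act[where A=H and B=H]) (simp_all add: lmod_homD(3)[OF f] lmod_homD(3)[OF g])
    then show ?thesis by (simp add: tensor_map_ident curry_map_apply[OF V W X])
  qed
  then show ?thesis
    using cc
    by (auto intro!: ext simp: curry_map_def[of V' W'] compose_def tensor_mor_def hom_mor_def restrict_def simp del: linear_homs_sel)
qed

end

theorem theorem2p10:
  fixes k :: "'k ring" and H :: "('k, 'h) quasi_hopf_data"
  assumes "quasi_hopf_algebra k H"
  shows
    "\<comment> \<open>the monoidal category\<close>
     is_category (LMod k H :: (('k, 'h, 'v) lmod, 'v \<Rightarrow> 'v) cat) \<and>
     is_functor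
       (prod_cat (LMod k H :: (('k, 'h, 'v) lmod, 'v \<Rightarrow> 'v) cat)
                 (LMod k H :: (('k, 'h, 'w) lmod, 'w \<Rightarrow> 'w) cat))
       (LMod k H) (tensor_func k H) \<and>
     unit_ob k H \<in> Ob (LMod k H) \<and>
     lmod_natural_iso k H
       (prod_cat (LMod k H :: (('k, 'h, 'v) lmod, 'v \<Rightarrow> 'v) cat)
         (prod_cat (LMod k H :: (('k, 'h, 'w) lmod, 'w \<Rightarrow> 'w) cat)
                   (LMod k H :: (('k, 'h, 'x) lmod, 'x \<Rightarrow> 'x) cat)))
       (tensor_left_func k H) (tensor_right_func k H) (associator k H) \<and>
     lmod_natural_iso k H (LMod k H :: (('k, 'h, 'v) lmod, 'v \<Rightarrow> 'v) cat)
       (tensor_unit_left_func k H) id_func (left_unitor k H) \<and>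
     lmod_natural_iso k H (LMod k H :: (('k, 'h, 'v) lmod, 'v \<Rightarrow> 'v) cat)
       (tensor_unit_right_func k H) id_func (right_unitor k H) \<and>
     \<comment> \<open>pentagon\<close>
     (\<forall>(V :: ('k, 'h, 'v) lmod)\<in>Ob (LMod k H). \<forall>(W :: ('k, 'h, 'w) lmod)\<in>Ob (LMod k H).
      \<forall>(X :: ('k, 'h, 'x) lmod)\<in>Ob (LMod k H). \<forall>(Y :: ('k, 'h, 'y) lmod)\<in>Ob (LMod k H).
      \<forall>t\<in>carrier (tensor_ob k H (tensor_ob k H (tensor_ob k H V W) X) Y).
        associator k H (V, W, tensor_ob k H X Y) (associator k H (tensor_ob k H V W, X, Y) t) =
        tensor_mor k V (tensor_ob k H (tensor_ob k H W X) Y) V (tensor_ob k H W (tensor_ob k H X Y))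
          (Ident (LMod k H) V) (associator k H (W, X, Y))
          (associator k H (V, tensor_ob k H W X, Y)
            (tensor_mor k (tensor_ob k H (tensor_ob k H V W) X) Y
               (tensor_ob k H V (tensor_ob k H W X)) Y
               (associator k H (V, W, X)) (Ident (LMod k H) Y) t))) \<and>
     \<comment> \<open>triangle\<close>
     (\<forall>(V :: ('k, 'h, 'v) lmod)\<in>Ob (LMod k H). \<forall>(W :: ('k, 'h, 'w) lmod)\<in>Ob (LMod k H).
      \<forall>t\<in>carrier (tensor_ob k H (tensor_ob k H V (unit_ob k H)) W).
        tensor_mor k V (tensor_ob k H (unit_ob k H) W) V W (Ident (LMod k H) V) (left_unitor k H W)
          (associator k H (V, unit_ob k H, W) t) =
        tensor_mor k (tensor_ob k H V (unit_ob k H)) W V W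
          (right_unitor k H V) (Ident (LMod k H) W) t) \<and>
     \<comment> \<open>the internal hom-functor\<close>
     is_functor
       (prod_cat (op_cat (LMod k H :: (('k, 'h, 'v) lmod, 'v \<Rightarrow> 'v) cat))
                 (LMod k H :: (('k, 'h, 'w) lmod, 'w \<Rightarrow> 'w) cat))
       (LMod k H) (hom_func k H) \<and>
     \<comment> \<open>the natural bijection\<close>
     (\<exists>\<theta> :: ('k, 'h, 'v) lmod \<Rightarrow> ('k, 'h, 'w) lmod \<Rightarrow> ('k, 'h, 'x) lmod
           \<Rightarrow> (('v, 'w) tens \<Rightarrow> 'x) \<Rightarrow> ('v \<Rightarrow> 'w \<Rightarrow> 'x).
       (\<forall>V\<in>Ob (LMod k H). \<forall>W\<in>Ob (LMod k H). \<forall>X\<in>Ob (LMod k H).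
          bij_betw (\<theta> V W X)
            (lmod_hom k H (tensor_ob k H V W) X) (lmod_hom k H V (hom_ob k H W X))) \<and>
       (\<forall>V\<in>Ob (LMod k H). \<forall>W\<in>Ob (LMod k H). \<forall>X\<in>Ob (LMod k H).
        \<forall>V'\<in>Ob (LMod k H). \<forall>W'\<in>Ob (LMod k H). \<forall>X'\<in>Ob (LMod k H).
        \<forall>f\<in>Hom (LMod k H) V' V. \<forall>g\<in>Hom (LMod k H) W' W. \<forall>l\<in>Hom (LMod k H) X X'.
        \<forall>L\<in>lmod_hom k H (tensor_ob k H V W) X.
          \<theta> V' W' X'
            (compose (carrier (tensor_ob k H V' W')) l
              (compose (carrier (tensor_ob k H V' W')) L (tensor_mor k V' W' V W f g))) =
          compose (carrier V') (hom_mor k W X W' g l) (compose (carrier V') (\<theta> V W X L) f)))"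
proof -
  interpret quasi_hopf_algebra k H by fact
  show ?thesis
  proof (intro conjI, goal_cases)
    case 1 show ?case by (rule is_category_LMod)
  next
    case 2 show ?case by (rule is_functor_tensor)
  next
    case 3 show ?case by simp
  next
    case 4 show ?case by (rule associator_natural_iso)
  next
    case 5 show ?case by (rule left_unitor_natural_iso)
  next
    case 6 show ?case by (rule right_unitor_natural_iso)
  next
    case 7 show ?case by (intro ballI, rule pentagon_identity) simp_all
  next
    case 8 show ?case by (intro ballI, rule triangle) simp_all
  next
    case 9 show ?case by (rule is_functor_hom)
  next
    case 10
    show ?case
    proof (rule exI[of _ "\<lambda>V W X. curry_map V W"], intro conjI ballI, goal_cases)
      case (1 V W X)
      then show ?case by (intro curry_map_bij) simp_all
    next
      case (2 V W X V' W' X' f g l L)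
      then show ?case by (intro curry_map_natural[where X'=X']) simp_all
    qed
  qed
qed

end
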